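(* Let $H_1,\dots,H_Q$ be Hamiltonians and $w_1,\dots,w_Q$ weights (constant, or slowly varying in time in the sense given in the context) such that $\|H_i\|_\infty\le C$ for all $i$, $\sum_{i=1}^Q w_i=1$ and $w_i\ge 0$. Let $\epsilon_0>0$. If each elementary Hamiltonian $H_i$ can be applied during any time-step $\tau$ with an error smaller than $\epsilon_1$, for any error $\epsilon_1$, at gate-cost $(\alpha+\beta C\tau)\ln\left(\epsilon_1^{-1}\right)$, then there exists a $\lambda$ such that the Markov-chain compiler with total transition rate $\lambda$ simulates $H=\sum_{i=1}^Q w_iH_i$ for a duration $T$ with an error smaller than $\epsilon_0$, with an expected number of gates $$\bar G=O\left(CT\left(\frac{\alpha CT}{\epsilon_0}+\beta\right)\ln\left(\frac{CT}{\epsilon_0}\right)\right).$$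
   Context: The $H_i$ are Hermitian operators on the finite-dimensional Hilbert space of a quantum system (typically $n$ qubits), and $\|\cdot\|_\infty$ is the operator norm. Markov-chain compiler with total transition rate $\lambda$: let $\lambda$ be constant and finite. Consider the continuous-time Markov chain on nodes $\{1,\dots,Q\}$ over the time interval $[0,T]$ with initial distribution $(w_i(0))_i$ and transition rates from node $i$ to node $j\ne i$ given by $A_{ij}=\dot w_j+\lambda w_j$ (which must be nonnegative); the chain is then at node $i$ with probability $w_i(t)$ at every time $t$. Sample a realization of this chain, recorded as a list of pairs $(k,\tau)$ of successive nodes and times spent in them, with total duration $T$. Apply to the quantum system, in this order, the evolutions $e^{-iH_k\tau}$, each implemented approximately with error $\epsilon_1$, for a suitably chosen $\epsilon_1$. Let $S_T$ be the resulting quantum channel, averaged over realizations of the chain. $\bar G$ is the expected number of gates used, the expectation being over realizations of the chain. The error $\epsilon_1$ of an approximately implemented evolution is the distance, in the induced trace norm $\|\cdot\|_{1\to1}$ on channels, between the implemented channel and $\sigma\mapsto e^{-iH_k\tau}\sigma e^{iH_k\tau}$. Slowly varying weights: the $w_j$ are differentiable in $t$ and $-\dot w_j/w_j$ is bounded above by some constant, so that the rates $A_{ij}$ are nonnegative for all large enough $\lambda$ (automatic for constant weights). Exact channel: $E_T(\sigma)=U\sigma U^\dagger$ with $U=\mathcal T\exp\left(-i\int_0^T H\,dt\right)$, where $\mathcal T$ denotes time ordering. Simulation error smaller than $\epsilon_0$ means $F(E_T,S_T)\ge 1-\epsilon_0$, where $F(E_T,S_T)$ is the minimum, over (pure) input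 states, of the fidelity between the outputs of the two channels for the same input; for a pure state $\psi=|\psi\rangle\langle\psi|$ and a state $\rho$, the fidelity is $F(\psi,\rho)=\langle\psi|\rho|\psi\rangle$.
   Formalization: The O-bound is stated for CT/ε₀ sufficiently large (threshold depending only on the bound on −ẇ/w relative to C) and (CT)²/ε₀ ≥ 1; outside this regime the printed bound fails, since at least one evolution is always applied and the logarithm may be non-positive. *)

theory Defs
  imports
    "HOL-Probability.Probability"
    "Jordan_Normal_Form.Schur_Decomposition"
begin

text \<open>
  Operators on a Hilbert space of dimension \<open>d\<close> are \<open>d \<times> d\<close> complex matrices, with \<open>d\<close> an ordinary
  natural number, so that the constants hidden in an \<open>O\<close>-bound can be required to be independent
  of the dimension.
\<close>

section \<open>Operators, norms and exponentials\<close>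

definition hermitian_op :: "nat \<Rightarrow> complex mat \<Rightarrow> bool" where
  "hermitian_op d A \<longleftrightarrow> A \<in> carrier_mat d d \<and> mat_adjoint A = A"

definition hilbert_norm :: "complex vec \<Rightarrow> real" where
  "hilbert_norm v = sqrt (Re (v \<bullet>c v))"

text \<open>Suprema are taken in \<open>ennreal\<close>, so they are meaningful without a boundedness proof.\<close>

definition operator_norm :: "nat \<Rightarrow> complex mat \<Rightarrow> ennreal" where
  "operator_norm d A =
     (SUP v\<in>{v \<in> carrier_vec d. hilbert_norm v = 1}. ennreal (hilbert_norm (A *\<^sub>v v)))"

text \<open>Sum of the singular values; \<open>Polynomial.order x (char_poly B)\<close> is the multiplicity of the eigenvalue \<open>x\<close>.\<close>

definition trace_norm :: "complex mat \<Rightarrow> real" where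
  "trace_norm A = (let B = mat_adjoint A * A in
     \<Sum>x | eigenvalue B x. real (Polynomial.order x (char_poly B)) * sqrt (Re x))"

text \<open>The norm \<open>\<parallel>\<cdot>\<parallel>\<close> of type \<open>1 \<rightarrow> 1\<close> of a linear map on operators.\<close>

definition induced_trace_norm :: "nat \<Rightarrow> (complex mat \<Rightarrow> complex mat) \<Rightarrow> ennreal" where
  "induced_trace_norm d \<Phi> =
     (SUP X\<in>{X \<in> carrier_mat d d. trace_norm X \<le> 1}. ennreal (trace_norm (\<Phi> X)))"

definition mat_exp :: "nat \<Rightarrow> complex mat \<Rightarrow> complex mat" where
  "mat_exp d A = mat d d (\<lambda>ij. \<Sum>n. (A ^\<^sub>m n) $$ ij / fact n)"

text \<open>Terms of the Dyson series
  \<open>(-i)\<^sup>n \<integral>\<^bsub>0 \<le> t\<^sub>1 \<le> \<dots> \<le> t\<^sub>n \<le> t\<^esub> H(t\<^sub>n) \<cdots> H(t\<^sub>1)\<close>, integrating over the latest time last.\<close>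

fun dyson_term :: "nat \<Rightarrow> (real \<Rightarrow> complex mat) \<Rightarrow> nat \<Rightarrow> real \<Rightarrow> complex mat" where
  "dyson_term d H 0 t = 1\<^sub>m d"
| "dyson_term d H (Suc n) t =
     mat d d (\<lambda>ij. - \<i> * integral {0..t} (\<lambda>s. (H s * dyson_term d H n s) $$ ij))"

definition time_ordered_exp :: "nat \<Rightarrow> (real \<Rightarrow> complex mat) \<Rightarrow> real \<Rightarrow> complex mat" where
  "time_ordered_exp d H t = mat d d (\<lambda>ij. \<Sum>n. dyson_term d H n t $$ ij)"


section \<open>Channels and fidelity\<close>

definition conj_channel :: "complex mat \<Rightarrow> complex mat \<Rightarrow> complex mat" where
  "conj_channel U \<sigma> = U * \<sigma> * mat_adjoint U"

text \<open>Quantum channels (completely positive trace-preserving maps), in Kraus form.\<close>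

definition quantum_channel :: "nat \<Rightarrow> (complex mat \<Rightarrow> complex mat) \<Rightarrow> bool" where
  "quantum_channel d \<Phi> \<longleftrightarrow> (\<exists>As. set As \<subseteq> carrier_mat d d \<and>
     foldr (+) (map (\<lambda>A. mat_adjoint A * A) As) (0\<^sub>m d d) = 1\<^sub>m d \<and>
     (\<forall>X\<in>carrier_mat d d. \<Phi> X = foldr (+) (map (\<lambda>A. conj_channel A X) As) (0\<^sub>m d d)))"

definition pure_states :: "nat \<Rightarrow> complex vec set" where
  "pure_states d = {\<psi> \<in> carrier_vec d. hilbert_norm \<psi> = 1}"

definition proj :: "nat \<Rightarrow> complex vec \<Rightarrow> complex mat" where
  "proj d \<psi> = mat d d (\<lambda>(a, b). \<psi> $ a * cnj (\<psi> $ b))"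

text \<open>\<open>\<langle>\<psi>|\<rho>|\<psi>\<rangle>\<close>; the product \<open>\<bullet>c\<close> is conjugate-linear in its second argument.\<close>

definition fidelity :: "complex vec \<Rightarrow> complex mat \<Rightarrow> real" where
  "fidelity \<psi> \<rho> = Re ((\<rho> *\<^sub>v \<psi>) \<bullet>c \<psi>)"

text \<open>\<open>F(E, S)\<close> for the channel \<open>E(\<sigma>) = U \<sigma> U\<^sup>\<dagger>\<close> with \<open>U\<close> unitary: on the pure input \<open>\<psi>\<close> its output
  is the pure state \<open>U \<psi>\<close>.\<close>

definition channel_fidelity :: "nat \<Rightarrow> complex mat \<Rightarrow> (complex mat \<Rightarrow> complex mat) \<Rightarrow> real" where
  "channel_fidelity d U S = (INF \<psi>\<in>pure_states d. fidelity (U *\<^sub>v \<psi>) (S (proj d \<psi>)))"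


section \<open>Weights and Hamiltonian\<close>

text \<open>\<open>w' j\<close> is the derivative of \<open>w j\<close>. The condition \<open>- w' / w \<le> c\<close> is written without division,
  and hence demanded at zeros of \<open>w\<close> as well, where it says that the derivative is nonnegative.\<close>

definition slowly_varying_weights ::
    "nat \<Rightarrow> real \<Rightarrow> real \<Rightarrow> (nat \<Rightarrow> real \<Rightarrow> real) \<Rightarrow> (nat \<Rightarrow> real \<Rightarrow> real) \<Rightarrow> bool" where
  "slowly_varying_weights Q T c w w' \<longleftrightarrow> (\<forall>t\<in>{0..T}.
     (\<Sum>j\<in>{1..Q}. w j t) = 1 \<and>
     (\<forall>j\<in>{1..Q}. 0 \<le> w j t \<and>
        (w j has_real_derivative w' j t) (at t within {0..T}) \<and>
        - w' j t \<le> c * w j t))"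

definition total_hamiltonian ::
    "nat \<Rightarrow> nat \<Rightarrow> (nat \<Rightarrow> complex mat) \<Rightarrow> (nat \<Rightarrow> real \<Rightarrow> real) \<Rightarrow> real \<Rightarrow> complex mat" where
  "total_hamiltonian d Q Hs w t =
     mat d d (\<lambda>ij. \<Sum>k\<in>{1..Q}. complex_of_real (w k t) * Hs k $$ ij)"


section \<open>Continuous-time Markov chains on \<open>{1..Q}\<close> over \<open>[0,T]\<close>\<close>

text \<open>\<open>A t i j\<close> is the transition rate from \<open>i\<close> to \<open>j \<noteq> i\<close> at time \<open>t\<close>; its diagonal values are
  ignored.\<close>

definition generator :: "nat \<Rightarrow> (real \<Rightarrow> nat \<Rightarrow> nat \<Rightarrow> real) \<Rightarrow> real \<Rightarrow> nat \<Rightarrow> nat \<Rightarrow> real" where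
  "generator Q A t i j = (if i = j then - (\<Sum>k\<in>{1..Q} - {i}. A t i k) else A t i j)"

text \<open>\<open>p s t i j\<close> is the probability of being at \<open>j\<close> at time \<open>t\<close> given that the chain is at \<open>i\<close> at
  time \<open>s\<close>: the solution of Kolmogorov's forward equation.\<close>

definition transition_function ::
    "nat \<Rightarrow> real \<Rightarrow> (real \<Rightarrow> nat \<Rightarrow> nat \<Rightarrow> real) \<Rightarrow> (real \<Rightarrow> real \<Rightarrow> nat \<Rightarrow> nat \<Rightarrow> real) \<Rightarrow> bool" where
  "transition_function Q T A p \<longleftrightarrow> (\<forall>s\<in>{0..T}. \<forall>i\<in>{1..Q}.
     (\<forall>j\<in>{1..Q}. p s s i j = of_bool (i = j)) \<and>
     (\<forall>t\<in>{s..T}.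
        (\<Sum>j\<in>{1..Q}. p s t i j) = 1 \<and>
        (\<forall>j\<in>{1..Q}. 0 \<le> p s t i j \<and>
           ((\<lambda>u. p s u i j) has_real_derivative
              (\<Sum>k\<in>{1..Q}. p s t i k * generator Q A t k j)) (at t within {s..T}))))"

text \<open>A realization is recorded as the list of successive nodes and the times spent in them; the
  total time is \<open>T\<close>. (Jumps exactly at time \<open>T\<close> have probability \<open>0\<close> and are left out.)\<close>

definition realizations :: "nat \<Rightarrow> real \<Rightarrow> (nat \<times> real) list set" where
  "realizations Q T = {l. l \<noteq> [] \<and> distinct_adj (map fst l) \<and>
     (\<forall>(k, \<tau>)\<in>set l. k \<in> {1..Q} \<and> 0 < \<tau>) \<and> sum_list (map snd l) = T}"

definition realization_space :: "nat \<Rightarrow> real \<Rightarrow> (nat \<times> real) list measure" where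
  "realization_space Q T = sigma (realizations Q T)
     {{l \<in> realizations Q T. map fst l = ks \<and> (\<forall>m<length ks. snd (l ! m) \<le> a m)} | ks a. True}"

fun node_at :: "(nat \<times> real) list \<Rightarrow> real \<Rightarrow> nat" where
  "node_at [] t = 0"
| "node_at ((k, \<tau>) # l) t = (if l = [] \<or> t < \<tau> then k else node_at l (t - \<tau>))"

text \<open>\<open>M\<close> is the law of the realizations of the Markov chain with initial distribution \<open>\<mu>\<close> and
  transition rates \<open>A\<close>. The Markov property is expressed by the finite-dimensional distributions.\<close>

definition markov_chain_law ::
    "nat \<Rightarrow> real \<Rightarrow> (nat \<Rightarrow> real) \<Rightarrow> (real \<Rightarrow> nat \<Rightarrow> nat \<Rightarrow> real) \<Rightarrow> (nat \<times> real) list measure \<Rightarrow> bool"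
  where
  "markov_chain_law Q T \<mu> A M \<longleftrightarrow>
     prob_space M \<and> space M = realizations Q T \<and> sets M = sets (realization_space Q T) \<and>
     (\<exists>p. transition_function Q T A p \<and>
        (\<forall>n (t :: nat \<Rightarrow> real) k. t 0 = 0 \<and> (\<forall>m<n. t m \<le> t (Suc m)) \<and> t n \<le> T \<and>
             (\<forall>m\<le>n. k m \<in> {1..Q}) \<longrightarrow>
           measure M {l \<in> space M. \<forall>m\<le>n. node_at l (t m) = k m} =
             \<mu> (k 0) * (\<Prod>m<n. p (t m) (t (Suc m)) (k m) (k (Suc m)))))"


section \<open>The compiler\<close>

text \<open>\<open>sim k \<tau> \<epsilon>\<close> is the channel implementing the evolution under \<open>Hs k\<close> during \<open>\<tau>\<close> with error
  at most \<open>\<epsilon>\<close>, and \<open>cost k \<tau> \<epsilon>\<close> is its number of gates. Measurability in \<open>\<tau>\<close> is what makes averages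
  over realizations of the chain well defined.\<close>

definition elementary_implementation ::
    "nat \<Rightarrow> nat \<Rightarrow> (nat \<Rightarrow> complex mat) \<Rightarrow> real \<Rightarrow> real \<Rightarrow> real \<Rightarrow>
     (nat \<Rightarrow> real \<Rightarrow> real \<Rightarrow> complex mat \<Rightarrow> complex mat) \<Rightarrow> (nat \<Rightarrow> real \<Rightarrow> real \<Rightarrow> real) \<Rightarrow> bool" where
  "elementary_implementation d Q Hs C \<alpha> \<beta> sim cost \<longleftrightarrow>
     (\<forall>k\<in>{1..Q}. \<forall>\<epsilon>. 0 < \<epsilon> \<and> \<epsilon> < 1 \<longrightarrow>
        (\<forall>\<tau>\<ge>0. quantum_channel d (sim k \<tau> \<epsilon>) \<and>
           induced_trace_norm d (\<lambda>X. sim k \<tau> \<epsilon> X -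
             conj_channel (mat_exp d ((- \<i> * complex_of_real \<tau>) \<cdot>\<^sub>m Hs k)) X) \<le> ennreal \<epsilon> \<and>
           0 \<le> cost k \<tau> \<epsilon> \<and> cost k \<tau> \<epsilon> \<le> (\<alpha> + \<beta> * C * \<tau>) * ln (1 / \<epsilon>)) \<and>
        (\<forall>X\<in>carrier_mat d d. \<forall>a<d. \<forall>b<d.
           (\<lambda>\<tau>. sim k \<tau> \<epsilon> X $$ (a, b)) \<in> borel_measurable (restrict_space borel {0..})) \<and>
        (\<lambda>\<tau>. cost k \<tau> \<epsilon>) \<in> borel_measurable (restrict_space borel {0..}))"

text \<open>The transition rates of the compiler with total transition rate \<open>lam\<close>.\<close>

definition compiler_rate ::
    "real \<Rightarrow> (nat \<Rightarrow> real \<Rightarrow> real) \<Rightarrow> (nat \<Rightarrow> real \<Rightarrow> real) \<Rightarrow> real \<Rightarrow> nat \<Rightarrow> nat \<Rightarrow> real" where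
  "compiler_rate lam w w' t i j = w' j t + lam * w j t"

definition run_realization ::
    "(nat \<Rightarrow> real \<Rightarrow> real \<Rightarrow> complex mat \<Rightarrow> complex mat) \<Rightarrow> real \<Rightarrow> (nat \<times> real) list \<Rightarrow>
     complex mat \<Rightarrow> complex mat" where
  "run_realization sim \<epsilon> l = fold (\<lambda>(k, \<tau>). sim k \<tau> \<epsilon>) l"

definition compiled_channel ::
    "nat \<Rightarrow> (nat \<Rightarrow> real \<Rightarrow> real \<Rightarrow> complex mat \<Rightarrow> complex mat) \<Rightarrow> real \<Rightarrow>
     (nat \<times> real) list measure \<Rightarrow> complex mat \<Rightarrow> complex mat" where
  "compiled_channel d sim \<epsilon> M \<sigma> = mat d d (\<lambda>ij. \<integral>l. run_realization sim \<epsilon> l \<sigma> $$ ij \<partial>M)"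

definition expected_gates ::
    "(nat \<Rightarrow> real \<Rightarrow> real \<Rightarrow> real) \<Rightarrow> real \<Rightarrow> (nat \<times> real) list measure \<Rightarrow> ennreal" where
  "expected_gates cost \<epsilon> M = (\<integral>\<^sup>+l. ennreal (\<Sum>(k, \<tau>)\<leftarrow>l. cost k \<tau> \<epsilon>) \<partial>M)"

end

(*
  Fix a pure input psi and let u = U psi be its exact evolution. For a realization l of the chain
  let V_l be the product of its exact elementary evolutions. Since |z|^2 >= 2 Re z - 1, the averaged
  fidelity is at least 2 Re <u(T), E[V_l psi]> - 1, so it suffices to bound the overlap of u(T) with
  the mean state vector; no operator estimates on channels are needed for this part.

  Discretise [0,T] with step h. Kolmogorov's equation has an explicit solution: in each step the
  chain keeps its node with probability exp(-lam h) and is otherwise resampled, the result being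
  distributed as w. If v_j is the mean of the state on the event that the chain is at j, and
  v = sum_j v_j, then the deviations v_j - w_j v shrink by exp(-lam h) and grow by 2 C h in each
  step, so their norms sum to at most 2 C / lam. The overlap <u, v> would be constant if they
  vanished, because the generators are skew; hence it loses at most 2 C^2 T / lam in total, and the
  fidelity at most 4 C^2 T / lam. As h tends to 0 dominated convergence transfers the bound to V_l,
  and Fatou's lemma applied to the number of changes on the grid bounds the expected length of a
  realization by 1 + lam T.

  Each approximate evolution costs at most eps1 in fidelity. With x = C T / eps0 the choice
  lam = 8 C x, eps1 = 1 / (18 x^2) makes both losses at most eps0 / 2.
*)
theory Submission
  imports Defs "HOL-Library.Poly_Mapping"
begin

unbundle no vec_syntax

section \<open>Flows generated by skew operators\<close>

text \<open>The law is given only through its finite-dimensional distributions, whereas a compiled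
  state depends on the jump times themselves. This is why a grid appears at all: at grid times every
  expectation is a finite sum over paths, and nothing else about the law can be computed directly.
  The forward equation can be solved because the rate into \<open>j\<close> is the same from every
  other node. The part of a transition probability that does not depend on the old node then acts on
  the sum of all mean states. The linear lower bound on the fidelity needs only the real part of the
  Hermitian product. So the estimates live in an abstract real inner product space, where a
  Hamiltonian is just a skew operator of norm at most \<open>C\<close>; matrices come in at the end,
  and no constant can depend on the dimension. On the channel side only lower bounds on fidelities
  are transported, which keeps the trace norm down to two facts: it is at least the Frobenius norm,
  and it is \<open>1\<close> on unit projections.\<close>

lemma norm_constant_of_orthogonal_derivative:
  fixes y :: "real \<Rightarrow> 'a::real_inner"
  assumes der: "\<And>t. t \<in> {0..T} \<Longrightarrow> (y has_vector_derivative y' t) (at t within {0..T})"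
    and orth: "\<And>t. t \<in> {0..T} \<Longrightarrow> inner (y' t) (y t) = 0"
    and t: "t \<in> {0..T}"
  shows "norm (y t) = norm (y 0)"
proof -
  have "((\<lambda>t. inner (y t) (y t)) has_derivative (\<lambda>h. 0)) (at s within {0..T})" if "s \<in> {0..T}" for s
  proof -
    have 1: "(y has_derivative (\<lambda>h. h *\<^sub>R y' s)) (at s within {0..T})"
      using der[OF that] by (simp add: has_vector_derivative_def)
    show ?thesis
      using has_derivative_inner[OF 1 1] orth[OF that] by (simp add: inner_commute)
  qed
  then obtain c where "\<And>s. s \<in> {0..T} \<Longrightarrow> inner (y s) (y s) = c"
    using has_derivative_zero_constant[of "{0..T}" "\<lambda>t. inner (y t) (y t)"] by auto
  then have "inner (y t) (y t) = inner (y 0) (y 0)" using t by auto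
  then show ?thesis by (simp add: norm_eq_sqrt_inner)
qed

lemma vector_differentiable_bound:
  fixes y :: "real \<Rightarrow> 'a::real_normed_vector"
  assumes der: "\<And>t. t \<in> {a..b} \<Longrightarrow> (y has_vector_derivative y' t) (at t within {a..b})"
    and bd: "\<And>t. t \<in> {a..b} \<Longrightarrow> norm (y' t) \<le> B"
    and ab: "a \<le> b"
  shows "norm (y b - y a) \<le> B * (b - a)"
proof -
  have "norm (y b - y a) \<le> B * norm (b - a)"
  proof (rule differentiable_bound[of "{a..b}" y "\<lambda>t h. h *\<^sub>R y' t"])
    fix t assume t: "t \<in> {a..b}"
    show "(y has_derivative (\<lambda>h. h *\<^sub>R y' t)) (at t within {a..b})"
      using der[OF t] by (simp add: has_vector_derivative_def)
    have "onorm (\<lambda>h. h *\<^sub>R y' t) = norm (y' t)"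
      by (simp add: onorm_scaleR_left onorm_id bounded_linear_ident)
    then show "onorm (\<lambda>h. h *\<^sub>R y' t) \<le> B" using bd[OF t] by simp
  qed (use ab in auto)
  then show ?thesis using ab by simp
qed

text \<open>\<open>E\<close> is given merely as a family of solution curves of
  \<open>x' = G x\<close> on the half-line. Isometry, uniqueness, linearity and the semigroup law
  all follow from the skewness of \<open>G\<close>, so the locale does not refer to
  exponentials.\<close>

locale skew_flow =
  fixes G :: "'a::real_inner \<Rightarrow> 'a" and C :: real and E :: "real \<Rightarrow> 'a \<Rightarrow> 'a"
  assumes linear_G: "linear G"
    and skew_G: "inner (G x) x = 0"
    and bound_G: "norm (G x) \<le> C * norm x"
    and C_pos: "0 < C"
    and E_0: "E 0 x = x"
    and deriv_E: "0 \<le> t \<Longrightarrow> ((\<lambda>t. E t x) has_vector_derivative G (E t x)) (at t within {0..})"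
begin

lemma deriv_E_within:
  "t \<in> {a..b} \<Longrightarrow> 0 \<le> a \<Longrightarrow> ((\<lambda>t. E t x) has_vector_derivative G (E t x)) (at t within {a..b})"
  by (rule has_vector_derivative_within_subset[OF deriv_E]) auto

lemma norm_E: "0 \<le> t \<Longrightarrow> norm (E t x) = norm x"
  using norm_constant_of_orthogonal_derivative[of t "\<lambda>t. E t x" "\<lambda>t. G (E t x)" t]
  by (auto simp: deriv_E_within skew_G E_0)

text \<open>The difference of two solutions is again a solution, so its norm is constant, and it
  starts at zero.\<close>

lemma flow_unique:
  assumes "\<And>s. s \<in> {0..t} \<Longrightarrow> (y has_vector_derivative G (y s)) (at s within {0..t})" "0 \<le> t"
  shows "y t = E t (y 0)"
proof -
  have "norm (y t - E t (y 0)) = norm (y 0 - E 0 (y 0))"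
  proof (rule norm_constant_of_orthogonal_derivative[of t "\<lambda>t. y t - E t (y 0)"
        "\<lambda>s. G (y s) - G (E s (y 0))"])
    fix s assume s: "s \<in> {0..t}"
    show "((\<lambda>t. y t - E t (y 0)) has_vector_derivative G (y s) - G (E s (y 0))) (at s within {0..t})"
      by (intro has_vector_derivative_diff assms deriv_E_within s) auto
    show "inner (G (y s) - G (E s (y 0))) (y s - E s (y 0)) = 0"
      by (simp add: linear_diff[OF linear_G, symmetric] skew_G)
  qed (use assms in auto)
  then show ?thesis by (simp add: E_0)
qed

lemma E_semigroup:
  assumes "0 \<le> a" "0 \<le> b"
  shows "E (a + b) x = E b (E a x)"
proof -
  have "E (a + b) x = E b (E (a + 0) x)"
  proof (rule flow_unique[of b "\<lambda>t. E (a + t) x"])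
    fix s assume s: "s \<in> {0..b}"
    have "((\<lambda>t. E t x) has_vector_derivative G (E (a + s) x)) (at (a + s) within (\<lambda>t. a + t) ` {0..b})"
      by (rule has_vector_derivative_within_subset[OF deriv_E]) (use assms s in auto)
    moreover have "((\<lambda>t. a + t) has_vector_derivative 1) (at s within {0..b})"
      by (auto intro!: derivative_eq_intros)
    ultimately show "((\<lambda>t. E (a + t) x) has_vector_derivative G (E (a + s) x)) (at s within {0..b})"
      using vector_diff_chain_within[of "\<lambda>t. a + t" 1 s "{0..b}"] by (simp add: o_def)
  qed (use assms in auto)
  then show ?thesis by simp
qed

text \<open>Sums and multiples of solutions are solutions, hence equal to the flow of their initial
  value by \<open>flow_unique\<close>.\<close>

lemma linear_E: "0 \<le> t \<Longrightarrow> linear (E t)"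
proof (rule linearI)
  fix x y assume t: "0 \<le> t"
  have "E t x + E t y = E t (E 0 x + E 0 y)"
    by (rule flow_unique[of t "\<lambda>t. E t x + E t y"])
      (auto simp: linear_add[OF linear_G] t intro!: has_vector_derivative_add deriv_E_within)
  then show "E t (x + y) = E t x + E t y" by (simp add: E_0)
next
  fix r x assume t: "0 \<le> t"
  have "r *\<^sub>R E t x = E t (r *\<^sub>R E 0 x)"
    by (rule flow_unique[of t "\<lambda>t. r *\<^sub>R E t x"])
      (auto simp: linear_scale[OF linear_G] t
        intro!: bounded_linear.has_vector_derivative[OF bounded_linear_scaleR_right] deriv_E_within)
  then show "E t (r *\<^sub>R x) = r *\<^sub>R E t x" by (simp add: E_0)
qed

lemma E_lipschitz_le:
  assumes "0 \<le> a" "a \<le> b"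
  shows "norm (E b x - E a x) \<le> C * norm x * (b - a)"
  by (rule vector_differentiable_bound[of a b _ "\<lambda>t. G (E t x)"])
    (use assms bound_G norm_E in \<open>auto intro!: deriv_E_within simp: order_trans[OF bound_G]\<close>)

lemma E_lipschitz:
  assumes "0 \<le> a" "0 \<le> b"
  shows "norm (E b x - E a x) \<le> C * norm x * \<bar>b - a\<bar>"
  using E_lipschitz_le[of a b x] E_lipschitz_le[of b a x] assms
  by (cases "a \<le> b") (auto simp: norm_minus_commute)

lemma E_minus_id: "0 \<le> h \<Longrightarrow> norm (E h x - x) \<le> C * h * norm x"
  using E_lipschitz_le[of 0 h x] by (simp add: E_0 mult_ac)

text \<open>The curve \<open>E t x - t *\<^sub>R G x\<close> has derivative
  \<open>G (E t x - x)\<close>, which the first-order bound \<open>E_minus_id\<close> makes at most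
  \<open>C\<^sup>2 * h * norm x\<close>.\<close>

lemma E_second_order:
  assumes "0 \<le> h"
  shows "norm (E h x - x - h *\<^sub>R G x) \<le> C\<^sup>2 * h\<^sup>2 * norm x"
proof -
  have "norm ((E h x - h *\<^sub>R G x) - (E 0 x - 0 *\<^sub>R G x)) \<le> (C\<^sup>2 * h * norm x) * (h - 0)"
  proof (rule vector_differentiable_bound[of 0 h "\<lambda>t. E t x - t *\<^sub>R G x" "\<lambda>t. G (E t x) - G x"])
    fix t assume t: "t \<in> {0..h}"
    have "((\<lambda>t. t *\<^sub>R G x) has_vector_derivative G x) (at t within {0..h})"
      by (auto intro!: derivative_eq_intros)
    then show "((\<lambda>t. E t x - t *\<^sub>R G x) has_vector_derivative G (E t x) - G x) (at t within {0..h})"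
      by (intro has_vector_derivative_diff deriv_E_within t) auto
    have "norm (G (E t x - x)) \<le> C * norm (E t x - x)" by (rule bound_G)
    also have "\<dots> \<le> C * (C * t * norm x)"
      using E_minus_id[of t x] t C_pos by (intro mult_left_mono) auto
    also have "\<dots> \<le> C * (C * h * norm x)"
      using t C_pos by (intro mult_left_mono mult_right_mono) auto
    finally show "norm (G (E t x) - G x) \<le> C\<^sup>2 * h * norm x"
      by (simp add: linear_diff[OF linear_G] power2_eq_square mult_ac)
  qed (use assms in auto)
  then show ?thesis by (simp add: E_0 power2_eq_square algebra_simps)
qed

lemma E_funpow: "0 \<le> h \<Longrightarrow> (E h ^^ m) x = E (real m * h) x"
  by (induction m) (auto simp: E_0 E_semigroup[symmetric] algebra_simps)

text \<open>Polarisation: of the four terms of \<open>inner (G (x + y)) (x + y) = 0\<close> only the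
  mixed ones survive.\<close>

lemma inner_G: "inner (G x) y = - inner x (G y)"
proof -
  have "inner (G (x + y)) (x + y) = 0" by (rule skew_G)
  then show ?thesis
    by (simp add: linear_add[OF linear_G] inner_add_left inner_add_right skew_G inner_commute[of x])
qed

end

section \<open>Evolution along a realization and along a grid\<close>

lemma node_at_in_fst_set: "l \<noteq> [] \<Longrightarrow> node_at l t \<in> fst ` set l"
proof (induction l arbitrary: t)
  case (Cons p l)
  then show ?case by (cases p; cases "l = []"; auto)
qed simp

lemma grid_split:
  fixes s h \<tau> :: real
  assumes "0 < h" "0 \<le> s" "s \<le> h" "0 < \<tau>" "\<tau> \<le> s + real m * h"
  obtains m1 where "m1 \<le> m" "\<And>j. j < m1 \<Longrightarrow> s + real j * h < \<tau>"
    "\<tau> \<le> s + real m1 * h" "s + real m1 * h - \<tau> \<le> h" "\<bar>real m1 * h - \<tau>\<bar> \<le> h"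
proof
  define m1 where "m1 = (LEAST j. \<tau> \<le> s + real j * h)"
  show "m1 \<le> m" unfolding m1_def using assms(5) by (rule Least_le)
  show lt: "s + real j * h < \<tau>" if "j < m1" for j
    using not_less_Least[OF that[unfolded m1_def]] by simp
  show ge: "\<tau> \<le> s + real m1 * h" unfolding m1_def using assms(5) by (rule LeastI)
  show *: "s + real m1 * h - \<tau> \<le> h"
  proof (cases m1)
    case (Suc j)
    then show ?thesis using lt[of j] by (simp add: algebra_simps)
  qed (use assms in auto)
  then show "\<bar>real m1 * h - \<tau>\<bar> \<le> h" using ge assms by linarith
qed

locale skew_flows =
  fixes Q :: nat and G :: "nat \<Rightarrow> 'a::real_inner \<Rightarrow> 'a" and C :: real
    and E :: "nat \<Rightarrow> real \<Rightarrow> 'a \<Rightarrow> 'a"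
  assumes flows: "k \<in> {1..Q} \<Longrightarrow> skew_flow (G k) C (E k)"
begin

definition run :: "(nat \<times> real) list \<Rightarrow> 'a \<Rightarrow> 'a" where
  "run l = fold (\<lambda>(k, \<tau>). E k \<tau>) l"

definition grid_run :: "(nat \<Rightarrow> nat) \<Rightarrow> real \<Rightarrow> nat \<Rightarrow> 'a \<Rightarrow> 'a" where
  "grid_run k h m = fold (\<lambda>j. E (k j) h) [0..<m]"

lemma grid_run_0 [simp]: "grid_run k h 0 x = x"
  by (simp add: grid_run_def)

lemma grid_run_Suc: "grid_run k h (Suc m) x = E (k m) h (grid_run k h m x)"
  by (simp add: grid_run_def)

lemma grid_run_cong: "(\<And>j. j < m \<Longrightarrow> k j = k' j) \<Longrightarrow> grid_run k h m x = grid_run k' h m x"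
  by (induction m) (auto simp: grid_run_Suc)

lemma grid_run_add: "grid_run k h (m + n) x = grid_run (\<lambda>j. k (m + j)) h n (grid_run k h m x)"
  by (induction n) (auto simp: grid_run_Suc)

lemma grid_run_isometry:
  assumes "0 \<le> h" "\<And>j. j < m \<Longrightarrow> k j \<in> {1..Q}"
  shows "norm (grid_run k h m x - grid_run k h m y) = norm (x - y)"
  using assms(2)
proof (induction m)
  case (Suc m)
  interpret F: skew_flow "G (k m)" C "E (k m)" using Suc.prems by (intro flows) auto
  have "norm (grid_run k h m x - grid_run k h m y) = norm (x - y)" using Suc by auto
  then show ?case
    by (simp add: grid_run_Suc linear_diff[OF F.linear_E[OF \<open>0 \<le> h\<close>], symmetric] F.norm_E \<open>0 \<le> h\<close>)
qed simp

lemma norm_grid_run: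
  assumes "0 \<le> h" "\<And>j. j < m \<Longrightarrow> k j \<in> {1..Q}"
  shows "norm (grid_run k h m x) = norm x"
  using assms(2)
proof (induction m)
  case (Suc m)
  interpret F: skew_flow "G (k m)" C "E (k m)" using Suc.prems by (intro flows) auto
  show ?case using Suc F.norm_E[OF \<open>0 \<le> h\<close>] by (simp add: grid_run_Suc)
qed simp

lemma grid_run_const:
  assumes "0 \<le> h" "c \<in> {1..Q}"
  shows "grid_run (\<lambda>_. c) h m x = E c (real m * h) x"
proof -
  interpret F: skew_flow "G c" C "E c" using assms by (intro flows) auto
  have "grid_run (\<lambda>_. c) h m x = (E c h ^^ m) x"
    by (induction m) (auto simp: grid_run_Suc)
  then show ?thesis using F.E_funpow[OF assms(1)] by simp
qed

text \<open>On the grid each stay is rounded to a multiple of \<open>h\<close>, the node at the left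
  end of a step being kept throughout it. The rounding changes a duration by at most
  \<open>h\<close>, hence the state by at most \<open>C * h * norm x\<close>, and isometry prevents
  later evolutions from enlarging this, so the errors of the \<open>length l\<close> stays add up.
  The offset \<open>s\<close> is there for the induction: the tail of \<open>l\<close> need not
  begin at a grid point.\<close>

lemma run_grid_error:
  assumes "0 < h" "l \<noteq> []" "\<And>p. p \<in> set l \<Longrightarrow> fst p \<in> {1..Q} \<and> 0 < snd p"
    and "0 \<le> s" "s \<le> h" "s + real m * h = sum_list (map snd l)"
  shows "norm (run l x - grid_run (\<lambda>j. node_at l (s + real j * h)) h m x)
    \<le> C * h * real (length l) * norm x"
  using assms(2-)
proof (induction l arbitrary: s m x)
  case (Cons p l)
  obtain k \<tau> where p: "p = (k, \<tau>)" by (cases p)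
  have k: "k \<in> {1..Q}" and \<tau>: "0 < \<tau>" using Cons.prems(2)[of p] p by auto
  interpret F: skew_flow "G k" C "E k" using k by (intro flows) auto
  have l: "fst q \<in> {1..Q}" "0 < snd q" if "q \<in> set l" for q
    using Cons.prems(2)[of q] that by simp_all
  have "0 \<le> snd q" if "q \<in> set l" for q using l(2)[OF that] by simp
  then have nonneg: "0 \<le> sum_list (map snd l)" by (intro sum_list_nonneg) auto
  then have "\<tau> \<le> s + real m * h" using Cons.prems p by simp
  show ?case
  proof (cases "l = []")
    case True
    then have "node_at (p # l) t = k" for t by (simp add: p)
    moreover have "norm (E k \<tau> x - E k (real m * h) x) \<le> C * norm x * \<bar>\<tau> - real m * h\<bar>"
      using F.E_lipschitz[of "real m * h" \<tau> x] \<tau> assms(1) by simp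
    moreover have "\<bar>\<tau> - real m * h\<bar> \<le> h" using True Cons.prems p by simp
    then have "C * norm x * \<bar>\<tau> - real m * h\<bar> \<le> C * norm x * h"
      using F.C_pos by (intro mult_left_mono) auto
    ultimately show ?thesis
      using True p grid_run_const[OF less_imp_le[OF assms(1)] k] by (simp add: run_def mult_ac)
  next
    case False
    obtain m1 where m1: "m1 \<le> m" "\<And>j. j < m1 \<Longrightarrow> s + real j * h < \<tau>"
        "\<tau> \<le> s + real m1 * h" "s + real m1 * h - \<tau> \<le> h" "\<bar>real m1 * h - \<tau>\<bar> \<le> h"
      using grid_split[OF assms(1) Cons.prems(3,4) \<tau> \<open>\<tau> \<le> s + real m * h\<close>] by metis
    \<comment> \<open>Offset of the first grid point at or after the end of the first stay, measured
      from that end.\<close>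
    define s' where "s' = s + real m1 * h - \<tau>"
    define g where "g = grid_run (\<lambda>j. node_at l (s' + real j * h)) h (m - m1)"
    have "grid_run (\<lambda>j. node_at (p # l) (s + real j * h)) h m x =
      grid_run (\<lambda>j. node_at (p # l) (s + real (m1 + j) * h)) h (m - m1)
        (grid_run (\<lambda>j. node_at (p # l) (s + real j * h)) h m1 x)"
      using grid_run_add[of _ h m1 "m - m1"] m1(1) by simp
    also have "grid_run (\<lambda>j. node_at (p # l) (s + real j * h)) h m1 x = grid_run (\<lambda>_. k) h m1 x"
      using m1(2) by (intro grid_run_cong) (auto simp: p)
    also have "\<dots> = E k (real m1 * h) x" using k assms(1) by (intro grid_run_const) auto
    also have "grid_run (\<lambda>j. node_at (p # l) (s + real (m1 + j) * h)) h (m - m1) y = g y" for y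
      unfolding g_def
    proof (rule grid_run_cong)
      fix j
      have "s + real (m1 + j) * h = \<tau> + (s' + real j * h)" by (simp add: s'_def algebra_simps)
      moreover have "0 \<le> s' + real j * h" using m1(3) assms(1) by (simp add: s'_def)
      ultimately show "node_at (p # l) (s + real (m1 + j) * h) = node_at l (s' + real j * h)"
        using False by (simp add: p)
    qed
    finally have eq: "grid_run (\<lambda>j. node_at (p # l) (s + real j * h)) h m x = g (E k (real m1 * h) x)" .
    \<comment> \<open>The tail is compared on the exactly evolved vector
      \<open>E k \<tau> x\<close>; the discrepancy with the rounded vector then passes unchanged
      through the isometry \<open>g\<close>.\<close>
    have "norm (run l (E k \<tau> x) - g (E k \<tau> x)) \<le> C * h * real (length l) * norm (E k \<tau> x)"
      unfolding g_def
    proof (rule Cons.IH[OF False])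
      show "s' + real (m - m1) * h = sum_list (map snd l)"
        using Cons.prems(5) m1(1) p by (simp add: s'_def of_nat_diff algebra_simps)
    qed (use l m1 in \<open>auto simp: s'_def\<close>)
    moreover have "norm (g (E k \<tau> x) - g (E k (real m1 * h) x)) = norm (E k \<tau> x - E k (real m1 * h) x)"
      unfolding g_def
    proof (rule grid_run_isometry)
      show "node_at l (s' + real j * h) \<in> {1..Q}" for j
        using node_at_in_fst_set[OF False, of "s' + real j * h"] l(1) by auto
    qed (use assms in auto)
    moreover have "norm (E k \<tau> x - E k (real m1 * h) x) \<le> C * norm x * \<bar>\<tau> - real m1 * h\<bar>"
      using F.E_lipschitz[of "real m1 * h" \<tau> x] \<tau> assms(1) by simp
    moreover have "C * norm x * \<bar>\<tau> - real m1 * h\<bar> \<le> C * norm x * h"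
      using F.C_pos m1(5) by (intro mult_left_mono) auto
    moreover have "norm (E k \<tau> x) = norm x" using \<tau> by (intro F.norm_E) auto
    moreover have "norm (run l (E k \<tau> x) - g (E k (real m1 * h) x)) \<le>
        norm (run l (E k \<tau> x) - g (E k \<tau> x)) + norm (g (E k \<tau> x) - g (E k (real m1 * h) x))"
      using norm_triangle_ineq[of "run l (E k \<tau> x) - g (E k \<tau> x)" "g (E k \<tau> x) - g (E k (real m1 * h) x)"]
      by simp
    ultimately show ?thesis unfolding eq by (simp add: run_def p algebra_simps)
  qed
qed simp

text \<open>The probabilistic content is reduced to the recursion \<open>vS\<close> for vectors
  \<open>v m j\<close>, and \<open>u\<close> has to solve its equation only up to
  \<open>\<eta> * h\<close> per step. Per unit time the loss is \<open>2 * C\<^sup>2 / lam\<close>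
  from the deviations of \<open>v m j\<close> from \<open>w j\<close> times their sum,
  \<open>\<eta>\<close> from \<open>u\<close>, \<open>C\<^sup>2 * h\<close> from replacing
  \<open>E\<close> by its first-order part, and \<open>(C + \<eta>) * C * h\<close> from the product
  of the two increments.\<close>

lemma discrete_lower_bound:
  fixes w :: "nat \<Rightarrow> real \<Rightarrow> real" and u :: "real \<Rightarrow> 'a" and v :: "nat \<Rightarrow> nat \<Rightarrow> 'a"
  defines "\<Gamma> \<equiv> \<lambda>t x. \<Sum>k=1..Q. w k t *\<^sub>R G k x"
  assumes C: "0 < C" and h: "0 < h" and lam: "0 < lam" and \<eta>: "0 \<le> \<eta>"
    and w: "\<And>m j. m \<le> n \<Longrightarrow> j \<in> {1..Q} \<Longrightarrow> 0 \<le> w j (real m * h)"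
    and w1: "\<And>m. m \<le> n \<Longrightarrow> (\<Sum>j=1..Q. w j (real m * h)) = 1"
    and r: "\<And>m j. m < n \<Longrightarrow> j \<in> {1..Q} \<Longrightarrow>
      exp (- lam * h) * w j (real m * h) \<le> w j (real (Suc m) * h)"
    and v0: "\<And>j. j \<in> {1..Q} \<Longrightarrow> v 0 j = w j 0 *\<^sub>R \<psi>"
    and vS: "\<And>m j. m < n \<Longrightarrow> j \<in> {1..Q} \<Longrightarrow> v (Suc m) j = exp (- lam * h) *\<^sub>R E j h (v m j) +
      (w j (real (Suc m) * h) - exp (- lam * h) * w j (real m * h)) *\<^sub>R (\<Sum>i=1..Q. E i h (v m i))"
    and \<psi>: "norm \<psi> = 1" and u0: "u 0 = \<psi>"
    and u1: "\<And>m. m \<le> n \<Longrightarrow> norm (u (real m * h)) \<le> 1"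
    and du: "\<And>m. m < n \<Longrightarrow> norm (u (real (Suc m) * h) - u (real m * h) - h *\<^sub>R \<Gamma> (real m * h) (u (real m * h))) \<le> \<eta> * h"
  shows "inner (u (real n * h)) (\<Sum>j=1..Q. v n j)
    \<ge> 1 - real n * h * (2 * C\<^sup>2 / lam + \<eta> + C\<^sup>2 * h + (C + \<eta>) * C * h)"
proof -
  note [simp del] = One_nat_def
  define t where "t m = real m * h" for m :: nat
  define q where "q = exp (- lam * h)"
  define V where "V m = (\<Sum>j=1..Q. v m j)" for m
  define D where "D m = (\<Sum>j=1..Q. norm (v m j - w j (t m) *\<^sub>R V m))" for m
  have q: "0 < q" "q < 1" using lam h by (auto simp: q_def)
  note F = flows
  note vS = vS[folded q_def, folded t_def] and r = r[folded q_def, folded t_def]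
    and w = w[folded t_def] and w1 = w1[folded t_def] and u1 = u1[folded t_def] and du = du[folded t_def]
  have E_norm: "norm (E j h x) = norm x" if "j \<in> {1..Q}" for j x
    using skew_flow.norm_E[OF F[OF that]] h by simp
  have E_id: "norm (E j h x - x) \<le> C * h * norm x" if "j \<in> {1..Q}" for j x
    using skew_flow.E_minus_id[OF F[OF that]] h by simp
  have E_2: "norm (E j h x - x - h *\<^sub>R G j x) \<le> C\<^sup>2 * h\<^sup>2 * norm x" if "j \<in> {1..Q}" for j x
    using skew_flow.E_second_order[OF F[OF that]] h by simp
  \<comment> \<open>Resampling only redistributes: its weights sum to \<open>1 - q\<close>, so
    together with the kept part the total receives every \<open>E i h (v m i)\<close> exactly
    once.\<close>
  have VS: "V (Suc m) = (\<Sum>i=1..Q. E i h (v m i))" if "m < n" for m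
  proof -
    define S where "S = (\<Sum>i=1..Q. E i h (v m i))"
    have "V (Suc m) = (\<Sum>j=1..Q. q *\<^sub>R E j h (v m j) + (w j (t (Suc m)) - q * w j (t m)) *\<^sub>R S)"
      unfolding V_def S_def by (intro sum.cong refl vS that)
    also have "\<dots> = q *\<^sub>R (\<Sum>i=1..Q. E i h (v m i)) +
        ((\<Sum>j=1..Q. w j (t (Suc m))) - q * (\<Sum>j=1..Q. w j (t m))) *\<^sub>R S"
      by (simp add: sum.distrib scaleR_sum_right scaleR_sum_left[symmetric] sum_subtractf sum_distrib_left)
    also have "\<dots> = q *\<^sub>R S + (1 - q * 1) *\<^sub>R S"
      using that w1[of m] w1[of "Suc m"] by (simp only: S_def less_imp_le Suc_leI)
    finally show ?thesis by (simp add: S_def scaleR_left_diff_distrib)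
  qed
  \<comment> \<open>Nonnegative resampling weights, the discrete form of nonnegative rates, keep the
    sum of the norms from growing.\<close>
  have sum_le_1: "(\<Sum>j=1..Q. norm (v m j)) \<le> 1" if "m \<le> n" for m
    using that
  proof (induction m)
    case 0
    have "norm (v 0 j) = w j (t 0)" if "j \<in> {1..Q}" for j
      using w[OF _ that, of 0] v0[OF that] \<psi> by (simp add: t_def)
    then show ?case using w1[of 0] by (simp add: t_def)
  next
    case (Suc m)
    let ?s = "\<Sum>j=1..Q. norm (v m j)"
    have s: "?s \<le> 1" and m: "m < n" using Suc by simp_all
    have nV: "norm (\<Sum>i=1..Q. E i h (v m i)) \<le> ?s"
      by (rule order_trans[OF norm_sum]) (simp add: E_norm)
    have "norm (v (Suc m) j) \<le> q * norm (v m j) + (w j (t (Suc m)) - q * w j (t m)) * ?s"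
      if j: "j \<in> {1..Q}" for j
    proof -
      have r': "0 \<le> w j (t (Suc m)) - q * w j (t m)" using r[OF m j] by simp
      have "norm (v (Suc m) j) \<le> norm (q *\<^sub>R E j h (v m j)) +
          norm ((w j (t (Suc m)) - q * w j (t m)) *\<^sub>R (\<Sum>i=1..Q. E i h (v m i)))"
        unfolding vS[OF m j] by (rule norm_triangle_ineq)
      also have "\<dots> \<le> q * norm (v m j) + (w j (t (Suc m)) - q * w j (t m)) * ?s"
        using q r' nV E_norm[OF j] by (simp add: mult_left_mono)
      finally show ?thesis .
    qed
    then have "(\<Sum>j=1..Q. norm (v (Suc m) j)) \<le>
        (\<Sum>j=1..Q. q * norm (v m j) + (w j (t (Suc m)) - q * w j (t m)) * ?s)"
      by (rule sum_mono)
    also have "\<dots> = q * ?s + ((\<Sum>j=1..Q. w j (t (Suc m))) - q * (\<Sum>j=1..Q. w j (t m))) * ?s"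
      by (simp only: sum.distrib sum_distrib_right[symmetric] sum_subtractf sum_distrib_left[symmetric])
    also have "\<dots> = q * ?s + (1 - q * 1) * ?s"
      using m w1[of m] w1[of "Suc m"] by (simp only: less_imp_le Suc_leI)
    also have "\<dots> = ?s" by (simp add: algebra_simps)
    finally show ?case using s by simp
  qed
  have nV1: "norm (V m) \<le> 1" if "m \<le> n" for m
    using order_trans[OF norm_sum sum_le_1[OF that]] by (simp add: V_def)
  have dV: "norm (V (Suc m) - V m) \<le> C * h" if m: "m < n" for m
  proof -
    have "V (Suc m) - V m = (\<Sum>j=1..Q. E j h (v m j) - v m j)"
      unfolding VS[OF m] sum_subtractf by (simp add: V_def)
    also have "norm \<dots> \<le> (\<Sum>j=1..Q. C * h * norm (v m j))"
      by (rule order_trans[OF norm_sum]) (intro sum_mono E_id)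
    also have "\<dots> \<le> C * h * 1"
      using sum_le_1[of m] m C h unfolding sum_distrib_left[symmetric] by (intro mult_left_mono) auto
    finally show ?thesis by simp
  qed
  have D_step: "D (Suc m) \<le> q * (D m + 2 * C * h)" if m: "m < n" for m
  proof -
    have "norm (v (Suc m) j - w j (t (Suc m)) *\<^sub>R V (Suc m)) \<le>
        q * (norm (v m j - w j (t m) *\<^sub>R V m) + C * h * norm (v m j) + w j (t m) * (C * h))"
      if j: "j \<in> {1..Q}" for j
    proof -
      have wj: "0 \<le> w j (t m)" using w[of m j] m j by simp
      \<comment> \<open>The terms with \<open>w j (t (Suc m))\<close> cancel, so that everything
        left carries the factor \<open>q\<close>, however much the weights vary over a step.\<close>
      have "v (Suc m) j - w j (t (Suc m)) *\<^sub>R V (Suc m) = q *\<^sub>R ((v m j - w j (t m) *\<^sub>R V m) +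
          (E j h (v m j) - v m j) - w j (t m) *\<^sub>R (V (Suc m) - V m))"
        using vS[OF m j] VS[OF m] by (simp add: algebra_simps)
      also have "norm \<dots> \<le> q * (norm (v m j - w j (t m) *\<^sub>R V m) + norm (E j h (v m j) - v m j) +
          norm (w j (t m) *\<^sub>R (V (Suc m) - V m)))"
        using q norm_triangle_ineq4[of "(v m j - w j (t m) *\<^sub>R V m) + (E j h (v m j) - v m j)"
            "w j (t m) *\<^sub>R (V (Suc m) - V m)"]
          norm_triangle_ineq[of "v m j - w j (t m) *\<^sub>R V m" "E j h (v m j) - v m j"]
        unfolding norm_scaleR[of q] abs_of_pos[OF q(1)] by (intro mult_left_mono) auto
      also have "\<dots> \<le> q * (norm (v m j - w j (t m) *\<^sub>R V m) + C * h * norm (v m j) + w j (t m) * (C * h))"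
        using q wj E_id[OF j] dV[OF m] by (intro mult_left_mono add_mono) (auto intro: mult_left_mono)
      finally show ?thesis .
    qed
    then have "D (Suc m) \<le> (\<Sum>j=1..Q. q * (norm (v m j - w j (t m) *\<^sub>R V m) +
        C * h * norm (v m j) + w j (t m) * (C * h)))"
      unfolding D_def by (rule sum_mono)
    also have "\<dots> = q * (D m + C * h * (\<Sum>j=1..Q. norm (v m j)) + (\<Sum>j=1..Q. w j (t m)) * (C * h))"
      unfolding D_def by (simp only: sum.distrib sum_distrib_left[symmetric] sum_distrib_right[symmetric])
    also have "\<dots> \<le> q * (D m + C * h * 1 + 1 * (C * h))"
      using sum_le_1[of m] w1[of m] m C h q
      by (intro mult_left_mono add_mono) auto
    finally show ?thesis by (simp add: mult_2 algebra_simps)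
  qed
  \<comment> \<open>The bound \<open>2 * C / lam\<close> is preserved by a step:
    \<open>q * (2 * C / lam + 2 * C * h)\<close> equals \<open>q * (1 + lam * h)\<close> times it,
    and \<open>q * (1 + lam * h) <= 1\<close>.\<close>
  have D_bound: "D m \<le> 2 * C / lam" if "m \<le> n" for m
    using that
  proof (induction m)
    case 0
    have "V 0 = \<psi>" using w1[of 0] by (simp add: V_def v0 scaleR_left.sum[symmetric] t_def)
    then have "D 0 = 0" by (simp add: D_def v0 t_def)
    then show ?case using C lam by simp
  next
    case (Suc m)
    have "1 + lam * h \<le> exp (lam * h)" by (rule exp_ge_add_one_self)
    then have "q * (1 + lam * h) \<le> q * exp (lam * h)" using q by (intro mult_left_mono) auto
    then have q1: "q * (1 + lam * h) \<le> 1" by (simp add: q_def exp_minus)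
    have "D (Suc m) \<le> q * (D m + 2 * C * h)" using Suc by (intro D_step) auto
    also have "\<dots> \<le> q * (2 * C / lam + 2 * C * h)" using Suc q by simp
    also have "\<dots> = (q * (1 + lam * h)) * (2 * C / lam)" using lam by (simp add: field_simps)
    also have "\<dots> \<le> 1 * (2 * C / lam)" using q1 C lam by (intro mult_right_mono) auto
    finally show ?case by simp
  qed
  have G_skew: "inner (G k x) y = - inner x (G k y)" if "k \<in> {1..Q}" for k x y
    by (rule skew_flow.inner_G[OF F[OF that]])
  have G_bd: "norm (G k x) \<le> C * norm x" if "k \<in> {1..Q}" for k x
    by (rule skew_flow.bound_G[OF F[OF that]])
  have G_diff: "G k (x - c *\<^sub>R y) = G k x - c *\<^sub>R G k y" if "k \<in> {1..Q}" for k x y c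
    using linear_diff[OF skew_flow.linear_G[OF F[OF that]]] linear_scale[OF skew_flow.linear_G[OF F[OF that]]]
    by simp
  have \<Gamma>_skew: "inner (\<Gamma> s x) y = - inner x (\<Gamma> s y)" for s x y
    unfolding \<Gamma>_def inner_sum_left inner_sum_right sum_negf[symmetric]
    by (intro sum.cong refl) (simp only: inner_scaleR_left inner_scaleR_right G_skew mult_minus_right)
  have \<Gamma>_bd: "norm (\<Gamma> (t m) x) \<le> C * norm x" if "m \<le> n" for m x
  proof -
    have "norm (\<Gamma> (t m) x) \<le> (\<Sum>k=1..Q. w k (t m) * (C * norm x))"
      unfolding \<Gamma>_def
      using w[OF that] by (intro order_trans[OF norm_sum] sum_mono) (auto intro!: mult_left_mono G_bd)
    also have "\<dots> = C * norm x"
      using w1[OF that] by (simp only: sum_distrib_right[symmetric] mult_1)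
    finally show ?thesis .
  qed
  define R where "R = 2 * C\<^sup>2 / lam + \<eta> + C\<^sup>2 * h + (C + \<eta>) * C * h"
  have step: "inner (u (t (Suc m))) (V (Suc m)) \<ge> inner (u (t m)) (V m) - h * R" if m: "m < n" for m
  proof -
    define du where "du = u (t (Suc m)) - u (t m)"
    define e1 where "e1 = du - h *\<^sub>R \<Gamma> (t m) (u (t m))"
    define dv where "dv = V (Suc m) - V m"
    define e2 where "e2 = (\<Sum>j=1..Q. E j h (v m j) - v m j - h *\<^sub>R G j (v m j))"
    \<comment> \<open>Error of replacing each \<open>v m j\<close> by
      \<open>w j (t m) *\<^sub>R V m\<close>, which turns the sum of the \<open>G j\<close> into
      \<open>\<Gamma>\<close>; \<open>D m\<close> measures it.\<close>
    define e3 where "e3 = (\<Sum>j=1..Q. G j (v m j - w j (t m) *\<^sub>R V m))"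
    have u1m: "norm (u (t m)) \<le> 1" using u1[of m] m by simp
    have "dv = (\<Sum>j=1..Q. E j h (v m j)) - (\<Sum>j=1..Q. v m j)"
      unfolding dv_def VS[OF m] by (simp add: V_def)
    then have dv_eq: "dv = h *\<^sub>R (\<Sum>j=1..Q. G j (v m j)) + e2"
      unfolding e2_def by (simp add: sum_subtractf scaleR_sum_right)
    have e3_eq: "(\<Sum>j=1..Q. G j (v m j)) = \<Gamma> (t m) (V m) + e3"
      unfolding e3_def \<Gamma>_def by (simp add: G_diff sum_subtractf)
    have ne1: "norm e1 \<le> \<eta> * h" using du[OF m] by (simp add: e1_def du_def)
    have "norm e2 \<le> (\<Sum>j=1..Q. C\<^sup>2 * h\<^sup>2 * norm (v m j))"
      unfolding e2_def by (rule order_trans[OF norm_sum]) (intro sum_mono E_2)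
    also have "\<dots> \<le> C\<^sup>2 * h\<^sup>2 * 1"
      using sum_le_1[of m] m unfolding sum_distrib_left[symmetric] by (intro mult_left_mono) auto
    finally have ne2: "norm e2 \<le> C\<^sup>2 * h\<^sup>2" by simp
    have "norm e3 \<le> (\<Sum>j=1..Q. C * norm (v m j - w j (t m) *\<^sub>R V m))"
      unfolding e3_def by (rule order_trans[OF norm_sum]) (intro sum_mono G_bd)
    also have "\<dots> = C * D m" by (simp only: D_def sum_distrib_left)
    also have "\<dots> \<le> C * (2 * C / lam)" using D_bound[of m] m C by (intro mult_left_mono) auto
    finally have ne3: "norm e3 \<le> 2 * C\<^sup>2 / lam" by (simp add: power2_eq_square mult_ac)
    have "norm du \<le> norm e1 + norm (h *\<^sub>R \<Gamma> (t m) (u (t m)))"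
      using norm_triangle_ineq[of e1 "h *\<^sub>R \<Gamma> (t m) (u (t m))"] by (simp add: e1_def)
    moreover have "norm (h *\<^sub>R \<Gamma> (t m) (u (t m))) \<le> h * (C * 1)"
      using \<Gamma>_bd[of m "u (t m)"] m u1m h C
      by (auto intro!: mult_left_mono intro: order_trans[OF \<Gamma>_bd])
    ultimately have ndu: "norm du \<le> h * (C + \<eta>)" using ne1 by (simp add: algebra_simps)
    have ndv: "norm dv \<le> C * h" using dV[OF m] by (simp add: dv_def)
    have b1: "\<bar>inner e1 (V m)\<bar> \<le> \<eta> * h * 1"
      using Cauchy_Schwarz_ineq2[of e1 "V m"] ne1 nV1[of m] m \<eta> h
      by (intro order_trans[OF Cauchy_Schwarz_ineq2] mult_mono) auto
    have b2: "\<bar>inner (u (t m)) e2\<bar> \<le> 1 * (C\<^sup>2 * h\<^sup>2)"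
      using u1m ne2 by (intro order_trans[OF Cauchy_Schwarz_ineq2] mult_mono) auto
    have b3: "\<bar>inner (u (t m)) e3\<bar> \<le> 1 * (2 * C\<^sup>2 / lam)"
      using u1m ne3 by (intro order_trans[OF Cauchy_Schwarz_ineq2] mult_mono) auto
    have b4: "\<bar>inner du dv\<bar> \<le> (h * (C + \<eta>)) * (C * h)"
      using ndu ndv C h \<eta> by (intro order_trans[OF Cauchy_Schwarz_ineq2] mult_mono) auto
    have "inner (u (t (Suc m))) (V (Suc m)) = inner (u (t m) + du) (V m + dv)"
      by (simp add: du_def dv_def)
    also have "\<dots> = inner (u (t m)) (V m) + inner du (V m) + inner (u (t m)) dv + inner du dv"
      by (simp add: inner_add_left inner_add_right)
    also have "inner du (V m) = h * inner (\<Gamma> (t m) (u (t m))) (V m) + inner e1 (V m)"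
      by (simp add: e1_def inner_diff_left)
    also have "inner (u (t m)) dv = h * inner (u (t m)) (\<Gamma> (t m) (V m)) + h * inner (u (t m)) e3 + inner (u (t m)) e2"
      unfolding dv_eq e3_eq by (simp add: inner_add_right algebra_simps)
    \<comment> \<open>Skewness of \<open>\<Gamma>\<close> cancels the two first-order contributions,
      that of \<open>u\<close> and that of the sum of the mean states; only error terms
      remain.\<close>
    finally have eq: "inner (u (t (Suc m))) (V (Suc m)) = inner (u (t m)) (V m) + inner e1 (V m) +
        h * inner (u (t m)) e3 + inner (u (t m)) e2 + inner du dv"
      by (simp add: \<Gamma>_skew)
    have "h * inner (u (t m)) e3 \<ge> - (h * (2 * C\<^sup>2 / lam))"
      using b3 h mult_left_mono[of "- (2 * C\<^sup>2 / lam)" "inner (u (t m)) e3" h] by simp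
    then show ?thesis
      unfolding eq R_def using b1 b2 b4 by (simp add: algebra_simps power2_eq_square abs_le_iff)
  qed
  have "inner (u (t m)) (V m) \<ge> 1 - real m * h * R" if "m \<le> n" for m
    using that
  proof (induction m)
    case 0
    have "V 0 = \<psi>" using w1[of 0] by (simp add: V_def v0 scaleR_left.sum[symmetric] t_def)
    then show ?case using \<psi> by (simp add: t_def u0 power2_norm_eq_inner[symmetric])
  next
    case (Suc m)
    then show ?case using step[of m] by (simp add: algebra_simps)
  qed
  from this[of n] show ?thesis by (simp add: t_def V_def R_def)
qed

end

text \<open>A stay longer than \<open>h\<close> contains a grid point, so no jump is missed: the
  node changes between the last grid point of a stay and the first of the next, and successive nodes
  differ. The summand 1 is the initial stay, which no jump precedes.\<close>

lemma length_le_grid_changes: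
  assumes "0 < h" "l \<noteq> []" "\<And>p. p \<in> set l \<Longrightarrow> h < snd p" "distinct_adj (map fst l)"
    and "0 \<le> s" "s \<le> h" "s + real m * h = sum_list (map snd l)"
  shows "length l \<le> 1 + card {j. j < m \<and>
    node_at l (s + real j * h) \<noteq> node_at l (s + real (Suc j) * h)}"
  using assms(2-)
proof (induction l arbitrary: s m)
  case (Cons p l)
  obtain k \<tau> where p: "p = (k, \<tau>)" by (cases p)
  have \<tau>: "h < \<tau>" using Cons.prems(2)[of p] p by auto
  show ?case
  proof (cases "l = []")
    case True
    then show ?thesis by simp
  next
    case False
    obtain k2 \<tau>2 l2 where l: "l = (k2, \<tau>2) # l2" using False by (cases l) auto
    have \<tau>2: "h < \<tau>2" using Cons.prems(2)[of "(k2, \<tau>2)"] l by auto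
    have k2: "k \<noteq> k2" using Cons.prems(3) by (simp add: p l)
    have long: "h < snd q" if "q \<in> set l" for q using Cons.prems(2)[of q] that by simp
    have "0 \<le> snd q" if "q \<in> set l" for q using long[OF that] assms(1) by simp
    then have "0 \<le> sum_list (map snd l)"
      by (intro sum_list_nonneg) auto
    then have "\<tau> \<le> s + real m * h" using Cons.prems p by simp
    then obtain m1 where m1: "m1 \<le> m" "\<And>j. j < m1 \<Longrightarrow> s + real j * h < \<tau>"
        "\<tau> \<le> s + real m1 * h" "s + real m1 * h - \<tau> \<le> h" "\<bar>real m1 * h - \<tau>\<bar> \<le> h"
      using grid_split[OF assms(1) Cons.prems(4,5) order_less_trans[OF assms(1) \<tau>]] by metis
    \<comment> \<open>The first grid point lies in the first stay, since
      \<open>s <= h < \<tau>\<close>; hence there is a last one in it, with index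
      \<open>m0\<close>.\<close>
    have "m1 \<noteq> 0" using m1(3) \<tau> Cons.prems(5) by (cases m1) auto
    then obtain m0 where m0: "m1 = Suc m0" by (cases m1) auto
    define s' where "s' = s + real m1 * h - \<tau>"
    have shift: "node_at (p # l) (s + real (m1 + j) * h) = node_at l (s' + real j * h)" for j
    proof -
      have "s + real (m1 + j) * h = \<tau> + (s' + real j * h)" by (simp add: s'_def algebra_simps)
      moreover have "0 \<le> s' + real j * h" using m1(3) assms(1) by (simp add: s'_def)
      ultimately show ?thesis using False by (simp add: p)
    qed
    define A where "A = {j. j < m \<and>
      node_at (p # l) (s + real j * h) \<noteq> node_at (p # l) (s + real (Suc j) * h)}"
    define B where "B = {j. j < m - m1 \<and>
      node_at l (s' + real j * h) \<noteq> node_at l (s' + real (Suc j) * h)}"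
    have IH: "length l \<le> 1 + card B" unfolding B_def
    proof (rule Cons.IH[OF False])
      show "s' + real (m - m1) * h = sum_list (map snd l)"
        using Cons.prems(6) m1(1) p by (simp add: s'_def of_nat_diff algebra_simps)
      show "distinct_adj (map fst l)" using Cons.prems(3) by (cases l) (auto simp: p)
      show "0 \<le> s'" "s' \<le> h" using m1 by (simp_all add: s'_def)
    qed (rule long)
    \<comment> \<open>The jump out of the first stay shows between \<open>m0\<close> and
      \<open>Suc m0\<close>; those of the tail reappear shifted by \<open>m1 = Suc m0\<close>, hence
      at indices other than \<open>m0\<close>.\<close>
    have "insert m0 ((\<lambda>j. m1 + j) ` B) \<subseteq> A"
    proof -
      have "node_at (p # l) (s + real (Suc m0) * h) = k2"
      proof -
        have "s' < \<tau>2" using m1(4) \<tau>2 by (simp add: s'_def)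
        then have "node_at l s' = k2" by (simp add: l)
        then show ?thesis using shift[of 0] by (simp only: m0 add_0_right of_nat_0 mult_zero_left)
      qed
      moreover have "node_at (p # l) (s + real m0 * h) = k"
        using m1(2)[of m0] by (simp add: p m0)
      moreover have "m0 < m" using m0 m1(1) by simp
      ultimately have "m0 \<in> A" using k2 unfolding A_def by blast
      moreover have "m1 + j \<in> A" if j: "j \<in> B" for j
      proof -
        have jB: "j < m - m1" "node_at l (s' + real j * h) \<noteq> node_at l (s' + real (Suc j) * h)"
          using j unfolding B_def by blast+
        have "m1 + j < m" using jB(1) by linarith
        moreover have "node_at (p # l) (s + real (m1 + j) * h) \<noteq>
            node_at (p # l) (s + real (Suc (m1 + j)) * h)"
          using shift[of j] shift[of "Suc j"] jB(2) by (metis add_Suc_right)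
        ultimately show ?thesis unfolding A_def by blast
      qed
      ultimately show ?thesis by auto
    qed
    moreover have "finite A" "finite B"
      unfolding A_def B_def by simp_all
    ultimately have "card (insert m0 ((\<lambda>j. m1 + j) ` B)) \<le> card A"
      by (intro card_mono)
    moreover have "card (insert m0 ((\<lambda>j. m1 + j) ` B)) = Suc (card B)"
    proof -
      have "m0 \<notin> (\<lambda>j. m1 + j) ` B" using m0 by auto
      with \<open>finite B\<close> show ?thesis by (simp add: card_image)
    qed
    ultimately show ?thesis using IH unfolding A_def length_Cons by linarith
  qed
qed simp

section \<open>The law of the chain\<close>

lemma exp_mult_shift:
  fixes a :: real
  shows "exp (- a * t) * (exp (a * s) * y) = exp (- a * (t - s)) * y"
proof -
  have "- a * (t - s) = - a * t + a * s" by (simp add: algebra_simps)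
  then show ?thesis by (simp only: exp_add mult.assoc)
qed

locale chain_weights =
  fixes Q :: nat and T c :: real and w w' :: "nat \<Rightarrow> real \<Rightarrow> real" and lam :: real
  assumes weights: "slowly_varying_weights Q T c w w'"
    and T_pos: "0 < T" and lam_pos: "0 < lam" and c_le_lam: "c \<le> lam"
begin

lemma w_nonneg: "t \<in> {0..T} \<Longrightarrow> j \<in> {1..Q} \<Longrightarrow> 0 \<le> w j t"
  and w_sum: "t \<in> {0..T} \<Longrightarrow> (\<Sum>j=1..Q. w j t) = 1"
  and w_deriv: "t \<in> {0..T} \<Longrightarrow> j \<in> {1..Q} \<Longrightarrow> (w j has_real_derivative w' j t) (at t within {0..T})"
  and w'_ge: "t \<in> {0..T} \<Longrightarrow> j \<in> {1..Q} \<Longrightarrow> - w' j t \<le> c * w j t"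
  using weights unfolding slowly_varying_weights_def by blast+

lemma w_continuous: "j \<in> {1..Q} \<Longrightarrow> continuous_on {0..T} (w j)"
  by (rule DERIV_continuous_on[of _ _ "w' j"]) (rule w_deriv)

text \<open>The sum of the weights is constant, and derivatives within \<open>{0..T}\<close> are
  unique, also at the ends, because the interval is not degenerate.\<close>

lemma w'_sum: "t \<in> {0..T} \<Longrightarrow> (\<Sum>j=1..Q. w' j t) = 0"
proof -
  assume t: "t \<in> {0..T}"
  have "((\<lambda>t. \<Sum>j=1..Q. w j t) has_real_derivative (\<Sum>j=1..Q. w' j t)) (at t within {0..T})"
    by (intro DERIV_sum w_deriv t)
  moreover have "((\<lambda>t. \<Sum>j=1..Q. w j t) has_real_derivative 0) (at t within {0..T})"
  proof (rule has_field_derivative_transform_within[of "\<lambda>_. 1" 0 t "{0..T}" 1])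
    show "((\<lambda>_. 1) has_real_derivative 0) (at t within {0..T})" by (rule DERIV_const)
  qed (use t w_sum in auto)
  ultimately show ?thesis
    using vector_derivative_unique_within_closed_interval[of 0 T t] T_pos t
    by (simp add: has_real_derivative_iff_has_vector_derivative)
qed

lemma compiler_rate_nonneg:
  assumes "t \<in> {0..T}" "j \<in> {1..Q}"
  shows "0 \<le> compiler_rate lam w w' t i j"
  using w'_ge[OF assms] mult_right_mono[OF c_le_lam w_nonneg[OF assms]]
  by (simp add: compiler_rate_def)

text \<open>The derivative of \<open>exp (lam * x) * w j x\<close> is \<open>exp (lam * x)\<close>
  times a transition rate, so the function does not decrease; the mean value theorem copes with a
  derivative \<open>w'\<close> that may be discontinuous. The inequality says that the resampling
  weights of a finite step are nonnegative.\<close>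

lemma w_decay:
  assumes st: "0 \<le> s" "s \<le> t" "t \<le> T" and j: "j \<in> {1..Q}"
  shows "exp (- lam * (t - s)) * w j s \<le> w j t"
proof (cases "s = t")
  case False
  let ?f = "\<lambda>x. exp (lam * x) * w j x"
  let ?f' = "\<lambda>x. exp (lam * x) * (w' j x + lam * w j x)"
  have der: "(?f has_real_derivative ?f' x) (at x within {s..t})" if "x \<in> {s..t}" for x
  proof -
    have "(w j has_real_derivative w' j x) (at x within {s..t})"
      by (rule has_field_derivative_subset[OF w_deriv]) (use that st j in auto)
    then show ?thesis by (auto intro!: derivative_eq_intros simp: algebra_simps)
  qed
  have "\<exists>x\<in>{s<..<t}. ?f t - ?f s = ?f' x * (t - s)"
    by (rule mvt_simple[of s t ?f "\<lambda>x. (*) (?f' x)"]) (use False st der in \<open>simp_all add: has_field_derivative_def\<close>)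
  then obtain x where x: "x \<in> {s<..<t}" and eq: "?f t - ?f s = ?f' x * (t - s)" by blast
  have "0 \<le> w' j x + lam * w j x"
    using compiler_rate_nonneg[of x j] x st j by (simp add: compiler_rate_def)
  then have "0 \<le> ?f' x * (t - s)" using st by simp
  then have "?f s \<le> ?f t" using eq by simp
  then have "exp (- lam * t) * ?f s \<le> exp (- lam * t) * ?f t" by (rule mult_left_mono) simp
  then show ?thesis by (simp only: exp_mult_shift) simp
qed simp

text \<open>The coefficient of \<open>of_bool (i = j)\<close> is the chance that no resampling
  occurs; the rest, \<open>w j t - exp (- lam * (t - s)) * w j s\<close>, is the chance of being
  resampled to \<open>j\<close>, whatever \<open>i\<close> is.\<close>

definition chain_prob :: "real \<Rightarrow> real \<Rightarrow> nat \<Rightarrow> nat \<Rightarrow> real" where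
  "chain_prob s t i j = exp (- lam * (t - s)) * (of_bool (i = j) - w j s) + w j t"

text \<open>Because the probabilities sum to 1 and the rate into \<open>j\<close> is the same from
  all nodes, the forward equation decouples into \<open>p' = (w' + lam * w) - lam * p\<close>, so
  that \<open>p - w\<close> decays at rate \<open>lam\<close>. A solution is supplied by the law;
  only its value has to be found.\<close>

lemma chain_prob_unique:
  assumes p: "transition_function Q T (compiler_rate lam w w') p"
    and st: "0 \<le> s" "s \<le> t" "t \<le> T" and i: "i \<in> {1..Q}" and j: "j \<in> {1..Q}"
  shows "p s t i j = chain_prob s t i j"
proof -
  have s: "s \<in> {0..T}" using st by auto
  have p0: "p s s i j = of_bool (i = j)"
    and p1: "\<And>u. u \<in> {s..T} \<Longrightarrow> (\<Sum>j=1..Q. p s u i j) = 1"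
    and pd: "\<And>u. u \<in> {s..T} \<Longrightarrow> ((\<lambda>u. p s u i j) has_real_derivative
      (\<Sum>k=1..Q. p s u i k * generator Q (compiler_rate lam w w') u k j)) (at u within {s..T})"
    using p s i j unfolding transition_function_def by blast+
  let ?a = "\<lambda>u. w' j u + lam * w j u"
  let ?f = "\<lambda>u. exp (lam * u) * (p s u i j - w j u)"
  have der: "(?f has_real_derivative 0) (at u within {s..T})" if u: "u \<in> {s..T}" for u
  proof -
    have u0: "u \<in> {0..T}" using u st by auto
    have tot: "(\<Sum>k=1..Q. w' k u + lam * w k u) = lam"
      using w_sum[OF u0] w'_sum[OF u0] by (simp only: sum.distrib sum_distrib_left[symmetric])
    \<comment> \<open>All rates, including the fictitious one from a node to itself, sum to
      \<open>lam\<close>; hence the diagonal entry is that fictitious rate minus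
      \<open>lam\<close>.\<close>
    have gen: "generator Q (compiler_rate lam w w') u k j = ?a u - of_bool (k = j) * lam"
      if k: "k \<in> {1..Q}" for k
    proof (cases "k = j")
      case True
      have "(\<Sum>k'\<in>{1..Q} - {k}. w' k' u + lam * w k' u) = lam - ?a u"
        using sum_diff1[of "{1..Q}" "\<lambda>k. w' k u + lam * w k u" k] tot k True by (simp only: finite_atLeastAtMost if_True)
      then show ?thesis using True by (simp add: generator_def compiler_rate_def)
    qed (simp add: generator_def compiler_rate_def)
    have "(\<Sum>k=1..Q. p s u i k * generator Q (compiler_rate lam w w') u k j) =
        (\<Sum>k=1..Q. p s u i k * ?a u - (if k = j then p s u i k * lam else 0))"
      by (intro sum.cong refl) (auto simp: gen algebra_simps)
    also have "\<dots> = (\<Sum>k=1..Q. p s u i k) * ?a u - p s u i j * lam"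
      unfolding sum_subtractf using j by (simp only: sum_distrib_right[symmetric] sum.delta finite_atLeastAtMost if_True)
    also have "\<dots> = ?a u - lam * p s u i j" by (simp only: p1[OF u] mult_1 mult.commute)
    finally have d: "((\<lambda>u. p s u i j) has_real_derivative ?a u - lam * p s u i j) (at u within {s..T})"
      using pd[OF u] by simp
    have "(w j has_real_derivative w' j u) (at u within {s..T})"
      by (rule has_field_derivative_subset[OF w_deriv]) (use u st j in auto)
    with d show ?thesis by (auto intro!: derivative_eq_intros simp: algebra_simps)
  qed
  have "\<exists>c. \<forall>u\<in>{s..T}. ?f u = c"
    by (rule has_field_derivative_zero_constant) (use der in auto)
  then have "?f t = ?f s" using st by auto
  then have "exp (- lam * t) * ?f t = exp (- lam * t) * ?f s" by simp
  then have "p s t i j - w j t = exp (- lam * (t - s)) * (p s s i j - w j s)"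
    by (simp only: exp_mult_shift) simp
  then show ?thesis by (simp add: p0 chain_prob_def)
qed

lemma chain_prob_sum:
  assumes "0 \<le> s" "s \<le> t" "t \<le> T" and i: "i \<in> {1..Q}"
  shows "(\<Sum>j=1..Q. chain_prob s t i j) = 1"
proof -
  have "(\<Sum>j=1..Q. of_bool (i = j) - w j s) = 0"
    using assms w_sum[of s] by (simp add: sum_subtractf of_bool_def)
  then show ?thesis
    unfolding chain_prob_def using assms w_sum[of t]
    by (simp add: sum.distrib sum_distrib_left[symmetric])
qed

lemma chain_prob_self: "0 \<le> s \<Longrightarrow> s \<le> t \<Longrightarrow> t \<le> T \<Longrightarrow> i \<in> {1..Q} \<Longrightarrow> exp (- lam * (t - s)) \<le> chain_prob s t i i"
  using w_decay[of s t i] by (simp add: chain_prob_def algebra_simps)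

end

section \<open>Measurability on the space of realizations\<close>

lemma member_le_sum_list_real:
  fixes xs :: "real list"
  assumes "\<And>x. x \<in> set xs \<Longrightarrow> 0 \<le> x" "x \<in> set xs"
  shows "x \<le> sum_list xs"
  using assms
proof (induction xs)
  case (Cons y xs)
  have "0 \<le> sum_list xs" using Cons.prems(1) by (intro sum_list_nonneg) auto
  then show ?case using Cons by (cases "x = y") (auto intro: add_increasing)
qed simp

text \<open>With the node sequence fixed, the durations become ordinary random variables
  \<open>f\<close>. The time \<open>t\<close> must be random as well, since the recursion of
  \<open>node_at\<close> subtracts durations from it.\<close>

lemma measurable_node_at_map:
  fixes kfs :: "(nat \<times> ('b \<Rightarrow> real)) list"
  assumes "\<And>k f. (k, f) \<in> set kfs \<Longrightarrow> f \<in> borel_measurable N" "t \<in> borel_measurable N"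
  shows "(\<lambda>\<omega>. node_at (map (\<lambda>(k, f). (k, f \<omega>)) kfs) (t \<omega>)) \<in> measurable N (count_space UNIV)"
  using assms
proof (induction kfs arbitrary: t)
  case (Cons kf kfs)
  obtain k f where kf: "kf = (k, f)" by (cases kf)
  have [measurable]: "f \<in> borel_measurable N" "t \<in> borel_measurable N"
    using Cons.prems kf by auto
  have [measurable]: "(\<lambda>\<omega>. node_at (map (\<lambda>(k, f). (k, f \<omega>)) kfs) (t \<omega> - f \<omega>)) \<in> measurable N (count_space UNIV)"
    by (rule Cons.IH) (use Cons.prems in auto)
  show ?case
    by (cases "kfs = []") (simp_all add: kf)
qed simp

locale realization_measure =
  fixes Q :: nat and T :: real and M :: "(nat \<times> real) list measure"
  assumes space_M: "space M = realizations Q T"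
    and sets_M: "sets M = sets (realization_space Q T)"
begin

text \<open>There are countably many node sequences, so measurability can be checked on each piece
  \<open>shape ks\<close>, where the durations serve as real coordinates.\<close>

definition shape :: "nat list \<Rightarrow> (nat \<times> real) list set" where
  "shape ks = {l \<in> space M. map fst l = ks}"

lemma realization_le: "l \<in> space M \<Longrightarrow> m < length l \<Longrightarrow> snd (l ! m) \<le> T"
  using member_le_sum_list_real[of "map snd l" "snd (l ! m)"]
  unfolding space_M realizations_def by (fastforce simp: less_imp_le)

lemma duration_event:
  "{l \<in> space M. map fst l = ks \<and> (\<forall>m<length ks. snd (l ! m) \<le> a m)} \<in> sets M"
  unfolding sets_M space_M realization_space_def
  by (subst sets_measure_of) (auto intro!: sigma_sets.Basic)

lemma shape_sets [measurable]: "shape ks \<in> sets M"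
proof -
  have "shape ks = {l \<in> space M. map fst l = ks \<and> (\<forall>m<length ks. snd (l ! m) \<le> T)}"
    unfolding shape_def using realization_le by auto
  then show ?thesis using duration_event[of ks "\<lambda>_. T"] by simp
qed

text \<open>The generating events bound all durations at once; taking \<open>T\<close>, which no
  duration exceeds, as the bound for the others isolates one coordinate.\<close>

lemma duration_measurable:
  assumes "m < length ks"
  shows "(\<lambda>l. snd (l ! m)) \<in> borel_measurable (restrict_space M (shape ks))"
proof (subst borel_measurable_iff_le, intro allI)
  fix b
  have "{l \<in> space (restrict_space M (shape ks)). snd (l ! m) \<le> b} =
      {l \<in> space M. map fst l = ks \<and> (\<forall>i<length ks. snd (l ! i) \<le> (if i = m then b else T))}"
    using realization_le assms by (auto simp: space_restrict_space shape_def)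
  also have "\<dots> \<in> sets M" by (rule duration_event)
  finally show "{l \<in> space (restrict_space M (shape ks)). snd (l ! m) \<le> b} \<in> sets (restrict_space M (shape ks))"
    by (subst sets_restrict_space_iff) (auto simp: space_restrict_space)
qed

lemma measurable_by_shape:
  assumes "\<And>ks. set ks \<subseteq> {1..Q} \<Longrightarrow> f \<in> measurable (restrict_space M (shape ks)) N"
  shows "f \<in> measurable M N"
proof (rule measurable_piecewise_restrict[of "range (\<lambda>ks. shape (map (\<lambda>k. k) ks))"])
  show "space M \<subseteq> \<Union> (range (\<lambda>ks. shape (map (\<lambda>k. k) ks)))"
    by (auto simp: shape_def)
  fix A assume "A \<in> range (\<lambda>ks. shape (map (\<lambda>k. k) ks))"
  then obtain ks where A: "A = shape ks" by auto
  show "f \<in> measurable (restrict_space M A) N"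
  proof (cases "set ks \<subseteq> {1..Q}")
    \<comment> \<open>No realization visits a node outside \<open>{1..Q}\<close>, so this piece is
      empty.\<close>
    case False
    then have "shape ks = {}"
      unfolding shape_def space_M realizations_def by fastforce
    then show ?thesis by (auto simp: A measurable_def space_restrict_space sets_restrict_space)
  qed (simp add: A assms)
qed (auto simp: shape_sets)

text \<open>The node sequence with coordinate functions in place of durations, in the form taken by
  \<open>measurable_node_at_map\<close> and \<open>measurable_run_realization_map\<close>.\<close>

definition shape_durations :: "nat list \<Rightarrow> (nat \<times> ((nat \<times> real) list \<Rightarrow> real)) list" where
  "shape_durations ks = zip ks (map (\<lambda>m l. snd (l ! m)) [0..<length ks])"

lemma shape_durations_eq: "l \<in> shape ks \<Longrightarrow> map (\<lambda>(k, f). (k, f l)) (shape_durations ks) = l"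
  by (auto simp: shape_def shape_durations_def intro!: nth_equalityI prod_eqI)

lemma shape_durations_member:
  assumes "(k, f) \<in> set (shape_durations ks)"
  obtains m where "m < length ks" "k = ks ! m" "f = (\<lambda>l. snd (l ! m))"
  using assms by (auto simp: shape_durations_def in_set_zip)

lemma node_at_measurable [measurable]: "(\<lambda>l. node_at l t) \<in> measurable M (count_space UNIV)"
proof (rule measurable_by_shape)
  fix ks
  have "(\<lambda>l. node_at (map (\<lambda>(k, f). (k, f l)) (shape_durations ks)) t)
      \<in> measurable (restrict_space M (shape ks)) (count_space UNIV)"
    by (rule measurable_node_at_map) (auto elim!: shape_durations_member intro: duration_measurable)
  then show "(\<lambda>l. node_at l t) \<in> measurable (restrict_space M (shape ks)) (count_space UNIV)"
    by (rule measurable_cong[THEN iffD1, rotated]) (simp add: space_restrict_space shape_durations_eq)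
qed

lemma length_measurable [measurable]: "length \<in> measurable M (count_space UNIV)"
proof (rule measurable_by_shape)
  fix ks
  show "length \<in> measurable (restrict_space M (shape ks)) (count_space UNIV)"
    by (subst measurable_cong[where g = "\<lambda>_. length ks"])
      (auto simp: space_restrict_space shape_def)
qed

lemma realization_props:
  assumes "l \<in> space M"
  shows "l \<noteq> []" "distinct_adj (map fst l)" "p \<in> set l \<Longrightarrow> fst p \<in> {1..Q} \<and> 0 < snd p"
    "sum_list (map snd l) = T"
  using assms unfolding space_M realizations_def by auto

lemma node_at_range: "l \<in> space M \<Longrightarrow> node_at l t \<in> {1..Q}"
  using node_at_in_fst_set[of l t] realization_props[of l] by auto

end

text \<open>Subtracting \<open>r *\<^sub>R F s\<close> leaves a curve with derivative
  \<open>F r - F s\<close>, small by uniform continuity of \<open>F\<close> on the compact interval.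
  Uniformity in \<open>s\<close> is what lets one step size serve the whole grid.\<close>

lemma derivative_uniform_approx:
  fixes u :: "real \<Rightarrow> 'a::real_normed_vector"
  assumes der: "\<And>t. t \<in> {0..T} \<Longrightarrow> (u has_vector_derivative F t) (at t within {0..T})"
    and cont: "continuous_on {0..T} F" and \<eta>: "0 < \<eta>"
  obtains \<delta> where "0 < \<delta>"
    "\<And>s t. 0 \<le> s \<Longrightarrow> s \<le> t \<Longrightarrow> t \<le> T \<Longrightarrow> t - s < \<delta> \<Longrightarrow> norm (u t - u s - (t - s) *\<^sub>R F s) \<le> \<eta> * (t - s)"
proof -
  have "uniformly_continuous_on {0..T} F"
    by (rule compact_uniformly_continuous[OF cont]) simp
  then obtain \<delta> where \<delta>: "0 < \<delta>"
    "\<And>s t. s \<in> {0..T} \<Longrightarrow> t \<in> {0..T} \<Longrightarrow> dist t s < \<delta> \<Longrightarrow> dist (F t) (F s) < \<eta>"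
    unfolding uniformly_continuous_on_def using \<eta> by metis
  show ?thesis
  proof (rule that[OF \<delta>(1)])
    fix s t assume st: "0 \<le> s" "s \<le> t" "t \<le> T" "t - s < \<delta>"
    have "norm ((u t - t *\<^sub>R F s) - (u s - s *\<^sub>R F s)) \<le> \<eta> * (t - s)"
    proof (rule vector_differentiable_bound[of s t "\<lambda>r. u r - r *\<^sub>R F s" "\<lambda>r. F r - F s"])
      fix r assume r: "r \<in> {s..t}"
      have "((\<lambda>r. r *\<^sub>R F s) has_vector_derivative F s) (at r within {s..t})"
        by (auto intro!: derivative_eq_intros)
      moreover have "(u has_vector_derivative F r) (at r within {s..t})"
        by (rule has_vector_derivative_within_subset[OF der]) (use r st in auto)
      ultimately show "((\<lambda>r. u r - r *\<^sub>R F s) has_vector_derivative F r - F s) (at r within {s..t})"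
        by (intro has_vector_derivative_diff)
      have "dist (F r) (F s) < \<eta>" by (rule \<delta>(2)) (use r st in \<open>auto simp: dist_real_def\<close>)
      then show "norm (F r - F s) \<le> \<eta>" by (simp add: dist_norm)
    qed (use st in auto)
    then show "norm (u t - u s - (t - s) *\<^sub>R F s) \<le> \<eta> * (t - s)" by (simp add: algebra_simps)
  qed
qed

text \<open>Extensional functions, so that a path is determined by its nodes at the indices
  \<open>0\<close> to \<open>n\<close> and the set is finite.\<close>

definition paths :: "nat \<Rightarrow> nat \<Rightarrow> (nat \<Rightarrow> nat) set" where
  "paths Q n = PiE {..n} (\<lambda>_. {1..Q})"

lemma finite_paths [simp]: "finite (paths Q n)"
  by (simp add: paths_def finite_PiE)

lemma paths_range: "k \<in> paths Q n \<Longrightarrow> m \<le> n \<Longrightarrow> k m \<in> {1..Q}"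
  unfolding paths_def by (drule PiE_mem[of _ _ _ m]) auto

lemma sum_paths_Suc:
  "(\<Sum>k\<in>paths Q (Suc n). g k) = (\<Sum>k\<in>paths Q n. \<Sum>j=1..Q. g (k(Suc n := j)))"
proof -
  have "paths Q (Suc n) = (\<lambda>(j, k). k(Suc n := j)) ` ({1..Q} \<times> paths Q n)"
    by (simp add: paths_def atMost_Suc PiE_insert_eq)
  moreover have "inj_on (\<lambda>(j, k). k(Suc n := j)) ({1..Q} \<times> paths Q n)"
    unfolding paths_def by (rule inj_combinator) simp
  ultimately have "(\<Sum>k\<in>paths Q (Suc n). g k) =
      (\<Sum>(j, k)\<in>{1..Q} \<times> paths Q n. g (k(Suc n := j)))"
    by (simp add: sum.reindex case_prod_beta' comp_def)
  also have "\<dots> = (\<Sum>j=1..Q. \<Sum>k\<in>paths Q n. g (k(Suc n := j)))"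
    by (simp only: sum.cartesian_product)
  also have "\<dots> = (\<Sum>k\<in>paths Q n. \<Sum>j=1..Q. g (k(Suc n := j)))"
    by (rule sum.swap)
  finally show ?thesis .
qed

lemma sum_paths_0:
  "(\<Sum>k\<in>paths Q 0. g k) = (\<Sum>j=1..Q. g ((\<lambda>_. undefined)(0 := j)))"
proof -
  have "paths Q 0 = (\<lambda>j. (\<lambda>_. undefined)(0 := j)) ` {1..Q}"
    by (auto simp: paths_def PiE_def extensional_def fun_eq_iff image_iff)
  moreover have "inj_on (\<lambda>j. (\<lambda>_::nat. undefined)(0 := j)) {1..Q}"
    by (auto simp: inj_on_def fun_eq_iff split: if_splits)
  ultimately show ?thesis by (simp only: sum.reindex o_def)
qed

locale compiler_chain = chain_weights Q T c w w' lam
  for Q T c w w' lam +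
  fixes M :: "(nat \<times> real) list measure"
  assumes law: "markov_chain_law Q T (\<lambda>i. w i 0) (compiler_rate lam w w') M"
begin

sublocale prob_space M
  using law by (simp add: markov_chain_law_def)

sublocale realization_measure Q T M
  using law by unfold_locales (simp_all add: markov_chain_law_def)

section \<open>Finite-dimensional distributions as sums over paths\<close>

definition times :: "(nat \<Rightarrow> real) \<Rightarrow> nat \<Rightarrow> bool" where
  "times t n \<longleftrightarrow> t 0 = 0 \<and> (\<forall>m<n. t m \<le> t (Suc m)) \<and> t n \<le> T"

definition path_prob :: "(nat \<Rightarrow> real) \<Rightarrow> (nat \<Rightarrow> nat) \<Rightarrow> nat \<Rightarrow> real" where
  "path_prob t k n = w (k 0) 0 * (\<Prod>m<n. chain_prob (t m) (t (Suc m)) (k m) (k (Suc m)))"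

lemma times_mono: "times t n \<Longrightarrow> i \<le> j \<Longrightarrow> j \<le> n \<Longrightarrow> t i \<le> t j"
proof (induction j)
  case (Suc j)
  show ?case
  proof (cases "i = Suc j")
    case False
    then have "t i \<le> t j" using Suc by auto
    moreover have "t j \<le> t (Suc j)" using Suc.prems by (simp add: times_def)
    ultimately show ?thesis by simp
  qed simp
qed simp

lemma times_range: "times t n \<Longrightarrow> m \<le> n \<Longrightarrow> 0 \<le> t m \<and> t m \<le> T"
  using times_mono[of t n 0 m] times_mono[of t n m n] by (auto simp: times_def)

lemma times_step: "times t n \<Longrightarrow> m < n \<Longrightarrow> t m \<le> t (Suc m)"
  by (auto simp: times_def)

lemma times_Suc: "times t (Suc n) \<Longrightarrow> times t n"
  using times_range[of t "Suc n" n] by (auto simp: times_def)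

lemma path_event_prob:
  assumes t: "times t n" and k: "k \<in> paths Q n"
  shows "measure M {l \<in> space M. \<forall>m\<le>n. node_at l (t m) = k m} = path_prob t k n"
proof -
  obtain p where p: "transition_function Q T (compiler_rate lam w w') p"
    and fdd: "\<And>n t k. t 0 = 0 \<and> (\<forall>m<n. t m \<le> t (Suc m)) \<and> t n \<le> T \<and> (\<forall>m\<le>n. k m \<in> {1..Q}) \<Longrightarrow>
      measure M {l \<in> space M. \<forall>m\<le>n. node_at l (t m) = k m} =
      w (k 0) 0 * (\<Prod>m<n. p (t m) (t (Suc m)) (k m) (k (Suc m)))"
    using law unfolding markov_chain_law_def by blast
  have "measure M {l \<in> space M. \<forall>m\<le>n. node_at l (t m) = k m} =
      w (k 0) 0 * (\<Prod>m<n. p (t m) (t (Suc m)) (k m) (k (Suc m)))"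
    by (rule fdd) (use t paths_range[OF k] in \<open>auto simp: times_def\<close>)
  also have "(\<Prod>m<n. p (t m) (t (Suc m)) (k m) (k (Suc m))) =
      (\<Prod>m<n. chain_prob (t m) (t (Suc m)) (k m) (k (Suc m)))"
  proof (rule prod.cong[OF refl])
    fix m assume "m \<in> {..<n}"
    then have m: "m < n" "m \<le> n" "Suc m \<le> n" by auto
    show "p (t m) (t (Suc m)) (k m) (k (Suc m)) = chain_prob (t m) (t (Suc m)) (k m) (k (Suc m))"
      using times_range[OF t m(2)] times_range[OF t m(3)] times_step[OF t m(1)]
        paths_range[OF k m(2)] paths_range[OF k m(3)]
      by (intro chain_prob_unique[OF p]) auto
  qed
  finally show ?thesis by (simp add: path_prob_def)
qed

lemma path_prob_update:
  assumes "k \<in> paths Q n"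
  shows "path_prob t (k(Suc n := j)) (Suc n) = path_prob t k n * chain_prob (t n) (t (Suc n)) (k n) j"
proof -
  define k' where "k' = k(Suc n := j)"
  have k': "k' m = k m" if "m \<le> n" for m using that by (simp add: k'_def)
  have k'n: "k' (Suc n) = j" by (simp add: k'_def)
  have "path_prob t k' (Suc n) = w (k' 0) 0 * ((\<Prod>m<n. chain_prob (t m) (t (Suc m)) (k' m) (k' (Suc m))) *
      chain_prob (t n) (t (Suc n)) (k' n) (k' (Suc n)))"
    unfolding path_prob_def prod.lessThan_Suc by (rule refl)
  also have "(\<Prod>m<n. chain_prob (t m) (t (Suc m)) (k' m) (k' (Suc m))) =
      (\<Prod>m<n. chain_prob (t m) (t (Suc m)) (k m) (k (Suc m)))"
    by (rule prod.cong) (auto simp: k')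
  finally show ?thesis
    unfolding path_prob_def k'_def[symmetric] k'n using k'[of 0] k'[of n] by simp
qed

text \<open>Read off from the probability of an event, without inspecting the sign of the
  factors.\<close>

lemma path_prob_nonneg:
  assumes "times t n" "k \<in> paths Q n"
  shows "0 \<le> path_prob t k n"
  unfolding path_event_prob[OF assms, symmetric] by (rule measure_nonneg)

lemma path_prob_sum: "times t n \<Longrightarrow> (\<Sum>k\<in>paths Q n. path_prob t k n) = 1"
proof (induction n)
  case 0
  show ?case using w_sum[of 0] T_pos by (simp add: sum_paths_0 path_prob_def)
next
  case (Suc n)
  have "(\<Sum>j=1..Q. path_prob t (k(Suc n := j)) (Suc n)) = path_prob t k n"
    if k: "k \<in> paths Q n" for k
  proof -
    have "(\<Sum>j=1..Q. chain_prob (t n) (t (Suc n)) (k n) j) = 1"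
      using times_range[OF Suc.prems, of n] times_range[OF Suc.prems, of "Suc n"]
        times_step[OF Suc.prems, of n] paths_range[OF k, of n]
      by (intro chain_prob_sum) auto
    then show ?thesis using k by (simp only: path_prob_update sum_distrib_left[symmetric] mult_1_right)
  qed
  then show ?case
    using Suc.IH[OF times_Suc[OF Suc.prems]] by (simp only: sum_paths_Suc cong: sum.cong)
qed

text \<open>A function of the nodes at finitely many times is a finite linear combination of
  indicators of path events, whose probabilities the law prescribes. Both the changes of node and
  the overlap on the grid are averaged in this way.\<close>

lemma expectation_paths:
  fixes F :: "(nat \<Rightarrow> nat) \<Rightarrow> real"
  assumes t: "times t n" and F: "\<And>k k'. (\<And>m. m \<le> n \<Longrightarrow> k m = k' m) \<Longrightarrow> F k = F k'"
  shows "integral\<^sup>L M (\<lambda>l. F (\<lambda>m. node_at l (t m))) = (\<Sum>k\<in>paths Q n. path_prob t k n * F k)"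
    and "integrable M (\<lambda>l. F (\<lambda>m. node_at l (t m)))"
proof -
  define Ev where "Ev k = {l \<in> space M. \<forall>m\<le>n. node_at l (t m) = k m}" for k
  have [measurable]: "Ev k \<in> sets M" for k unfolding Ev_def by measurable
  have eq: "F (\<lambda>m. node_at l (t m)) = (\<Sum>k\<in>paths Q n. indicator (Ev k) l * F k)"
    if l: "l \<in> space M" for l
  proof -
    \<comment> \<open>The observed path, cut off after index \<open>n\<close> so as to be a member
      of \<open>paths Q n\<close>; its indicator is the only one in the sum that does not vanish at
      \<open>l\<close>.\<close>
    define k0 where "k0 = restrict (\<lambda>m. node_at l (t m)) {..n}"
    have k0: "k0 \<in> paths Q n"
      unfolding k0_def paths_def using node_at_range[OF l] by auto
    have "indicator (Ev k) l * F k = (if k = k0 then F k0 else 0)" if k: "k \<in> paths Q n" for k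
    proof (cases "l \<in> Ev k")
      case True
      then have "k m = k0 m" for m
        using k k0 by (cases "m \<le> n") (auto simp: Ev_def k0_def paths_def PiE_def extensional_def)
      then have "k = k0" by auto
      then show ?thesis using True by simp
    next
      case False
      then have "k \<noteq> k0" using l by (auto simp: Ev_def k0_def)
      then show ?thesis using False by simp
    qed
    then have "(\<Sum>k\<in>paths Q n. indicator (Ev k) l * F k) = (\<Sum>k\<in>paths Q n. if k = k0 then F k0 else 0)"
      by (intro sum.cong refl)
    also have "\<dots> = F k0" using k0 by simp
    also have "\<dots> = F (\<lambda>m. node_at l (t m))" by (rule F) (simp add: k0_def)
    finally show ?thesis by simp
  qed
  have int: "integrable M (\<lambda>l. indicator (Ev k) l * F k)" for k
    by (intro integrable_mult_left integrable_real_indicator) (auto simp: emeasure_eq_measure)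
  have "integral\<^sup>L M (\<lambda>l. F (\<lambda>m. node_at l (t m))) =
      integral\<^sup>L M (\<lambda>l. \<Sum>k\<in>paths Q n. indicator (Ev k) l * F k)"
    by (intro Bochner_Integration.integral_cong refl eq)
  also have "\<dots> = (\<Sum>k\<in>paths Q n. integral\<^sup>L M (\<lambda>l. indicator (Ev k) l * F k))"
    by (intro Bochner_Integration.integral_sum int)
  also have "\<dots> = (\<Sum>k\<in>paths Q n. path_prob t k n * F k)"
    by (intro sum.cong refl) (simp add: path_event_prob[OF t, folded Ev_def] Int_absorb2 sets.sets_into_space)
  finally show "integral\<^sup>L M (\<lambda>l. F (\<lambda>m. node_at l (t m))) = (\<Sum>k\<in>paths Q n. path_prob t k n * F k)" .
  have "integrable M (\<lambda>l. \<Sum>k\<in>paths Q n. indicator (Ev k) l * F k)"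
    by (intro Bochner_Integration.integrable_sum int)
  then show "integrable M (\<lambda>l. F (\<lambda>m. node_at l (t m)))"
    by (rule Bochner_Integration.integrable_cong[THEN iffD1, rotated -1]) (simp_all add: eq)
qed

section \<open>Expected number of jumps\<close>

definition grid_time :: "nat \<Rightarrow> nat \<Rightarrow> real" where
  "grid_time n m = real m * (T / real n)"

lemma grid_times: "0 < n \<Longrightarrow> m \<le> n \<Longrightarrow> times (grid_time n) m"
  using T_pos by (auto simp: times_def grid_time_def intro!: divide_right_mono mult_right_mono simp: field_simps)

lemma grid_time_Suc: "grid_time n (Suc m) - grid_time n m = T / real n"
  by (simp add: grid_time_def distrib_right add_divide_distrib)

text \<open>Given the node at the left end, the chance to see the same node at the right end is at
  least \<open>exp (- lam * h)\<close> with \<open>h = T / n\<close>, and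
  \<open>1 - exp (- y) <= y\<close>.\<close>

lemma change_prob:
  assumes n: "0 < n" and m: "m < n"
  shows "measure M {l \<in> space M. node_at l (grid_time n m) \<noteq> node_at l (grid_time n (Suc m))} \<le> lam * (T / real n)"
proof -
  let ?t = "grid_time n"
  let ?F = "\<lambda>k. of_bool (k m \<noteq> k (Suc m)) :: real"
  have t: "times ?t (Suc m)" "times ?t m" using grid_times[OF n] m by auto
  have "measure M {l \<in> space M. node_at l (?t m) \<noteq> node_at l (?t (Suc m))} =
      integral\<^sup>L M (indicator {l \<in> space M. node_at l (?t m) \<noteq> node_at l (?t (Suc m))})"
    by (simp add: Int_def conj_commute)
  also have "\<dots> = integral\<^sup>L M (\<lambda>l. ?F (\<lambda>m. node_at l (?t m)))"
    by (intro Bochner_Integration.integral_cong) (auto simp: indicator_def)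
  also have "\<dots> = (\<Sum>k\<in>paths Q (Suc m). path_prob ?t k (Suc m) * ?F k)"
    by (rule expectation_paths(1)[OF t(1)]) auto
  also have "\<dots> = (\<Sum>k\<in>paths Q m. \<Sum>j=1..Q. path_prob ?t (k(Suc m := j)) (Suc m) * of_bool (k m \<noteq> j))"
    by (simp add: sum_paths_Suc)
  also have "\<dots> \<le> (\<Sum>k\<in>paths Q m. path_prob ?t k m * (lam * (T / real n)))"
  proof (rule sum_mono)
    fix k assume k: "k \<in> paths Q m"
    have km: "k m \<in> {1..Q}" using paths_range[OF k] by simp
    let ?p = "\<lambda>j. chain_prob (?t m) (?t (Suc m)) (k m) j"
    have ran: "0 \<le> ?t m" "?t m \<le> ?t (Suc m)" "?t (Suc m) \<le> T"
      using times_range[OF t(1), of m] times_range[OF t(1), of "Suc m"] times_step[OF t(1), of m] by auto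
    have "(\<Sum>j=1..Q. path_prob ?t (k(Suc m := j)) (Suc m) * of_bool (k m \<noteq> j)) =
        path_prob ?t k m * (\<Sum>j=1..Q. ?p j * of_bool (k m \<noteq> j))"
      by (simp only: path_prob_update[OF k] sum_distrib_left mult.assoc)
    also have "(\<Sum>j=1..Q. ?p j * of_bool (k m \<noteq> j)) = (\<Sum>j=1..Q. ?p j - (if j = k m then ?p j else 0))"
      by (intro sum.cong refl) auto
    also have "\<dots> = 1 - ?p (k m)"
      unfolding sum_subtractf using km chain_prob_sum[OF ran km] by (simp only: sum.delta finite_atLeastAtMost if_True)
    also have "path_prob ?t k m * (1 - ?p (k m)) \<le> path_prob ?t k m * (lam * (T / real n))"
    proof (rule mult_left_mono[OF _ path_prob_nonneg[OF t(2) k]])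
      have "exp (- lam * (?t (Suc m) - ?t m)) \<le> ?p (k m)" by (rule chain_prob_self[OF ran km])
      moreover have "1 + (- lam * (T / real n)) \<le> exp (- lam * (T / real n))" by (rule exp_ge_add_one_self)
      ultimately show "1 - ?p (k m) \<le> lam * (T / real n)" unfolding grid_time_Suc by linarith
    qed
    finally show "(\<Sum>j=1..Q. path_prob ?t (k(Suc m := j)) (Suc m) * of_bool (k m \<noteq> j)) \<le>
        path_prob ?t k m * (lam * (T / real n))" .
  qed
  also have "\<dots> = lam * (T / real n)"
    using path_prob_sum[OF t(2)] by (simp only: sum_distrib_right[symmetric] mult_1)
  finally show ?thesis .
qed

lemma eventually_grid_fine:
  assumes l: "l \<in> space M"
  shows "eventually (\<lambda>n. 0 < n \<and> (\<forall>p\<in>set l. T / real n < snd p)) sequentially"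
proof -
  have "eventually (\<lambda>n. T / real n < snd p) sequentially" if "p \<in> set l" for p
  proof -
    have "(\<lambda>n. T / real n) \<longlonglongrightarrow> 0" by (rule lim_const_over_n)
    then show ?thesis using realization_props(3)[OF l that] by (intro order_tendstoD) auto
  qed
  then show ?thesis
    by (intro eventually_conj eventually_gt_at_top eventually_ball_finite) auto
qed

text \<open>\<open>f n\<close> is one more than the number of changes seen on the grid with
  \<open>n\<close> steps. It dominates the length once the step is below the shortest stay; how
  large \<open>n\<close> must be depends on \<open>l\<close>, so no single grid serves all
  realizations and a lower limit is taken. Each integral is at most
  \<open>1 + n * (lam * (T / n))\<close>.\<close>

theorem expected_length:
  "(\<integral>\<^sup>+l. ennreal (real (length l)) \<partial>M) \<le> ennreal (1 + lam * T)"
proof -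
  define Ch where "Ch n m = {l \<in> space M. node_at l (grid_time n m) \<noteq> node_at l (grid_time n (Suc m))}" for n m
  have [measurable]: "Ch n m \<in> sets M" for n m
  proof -
    have "Ch n m = (\<Union>k. {l \<in> space M. node_at l (grid_time n m) = k} - {l \<in> space M. node_at l (grid_time n (Suc m)) = k})"
      by (auto simp: Ch_def)
    also have "\<dots> \<in> sets M" by (intro sets.countable_UN) (auto intro!: sets.Diff)
    finally show ?thesis .
  qed
  define f where "f n l = 1 + (\<Sum>m<n. indicator (Ch n m) l :: ennreal)" for n l
  have [measurable]: "f n \<in> borel_measurable M" for n
    unfolding f_def by (intro borel_measurable_add borel_measurable_const borel_measurable_sum borel_measurable_indicator) simp
  have "ennreal (real (length l)) \<le> liminf (\<lambda>n. f n l)" if l: "l \<in> space M" for l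
  proof (rule Liminf_bounded)
    show "\<forall>\<^sub>F n in sequentially. ennreal (real (length l)) \<le> f n l"
      using eventually_grid_fine[OF l]
    proof eventually_elim
      case (elim n)
      let ?S = "{m. m < n \<and> node_at l (0 + real m * (T / real n)) \<noteq> node_at l (0 + real (Suc m) * (T / real n))}"
      have "length l \<le> 1 + card ?S"
        by (rule length_le_grid_changes) (use elim T_pos realization_props[OF l] in auto)
      moreover have "(\<Sum>m<n. indicator (Ch n m) l :: ennreal) = of_nat (card ?S)"
      proof -
        have "(\<Sum>m<n. indicator (Ch n m) l :: ennreal) = (\<Sum>m<n. if m \<in> ?S then 1 else 0)"
          using l by (intro sum.cong) (auto simp: Ch_def grid_time_def indicator_def)
        also have "\<dots> = (\<Sum>m\<in>{..<n} \<inter> ?S. 1)" by (rule sum.inter_restrict[symmetric]) simp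
        also have "{..<n} \<inter> ?S = ?S" by auto
        finally show ?thesis by simp
      qed
      ultimately show ?case
        by (simp add: f_def ennreal_of_nat_eq_real_of_nat[symmetric] flip: of_nat_Suc)
    qed
  qed
  then have "(\<integral>\<^sup>+l. ennreal (real (length l)) \<partial>M) \<le> (\<integral>\<^sup>+l. liminf (\<lambda>n. f n l) \<partial>M)"
    by (rule nn_integral_mono)
  also have "\<dots> \<le> liminf (\<lambda>n. integral\<^sup>N M (f n))"
    by (rule nn_integral_liminf) measurable
  also have "\<dots> \<le> limsup (\<lambda>n. integral\<^sup>N M (f n))" by (rule Liminf_le_Limsup) simp
  also have "\<dots> \<le> ennreal (1 + lam * T)"
  proof (rule Limsup_bounded)
    show "\<forall>\<^sub>F n in sequentially. integral\<^sup>N M (f n) \<le> ennreal (1 + lam * T)"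
      using eventually_gt_at_top[of 0]
    proof eventually_elim
      case (elim n)
      have "integral\<^sup>N M (f n) = 1 + (\<Sum>m<n. emeasure M (Ch n m))"
        unfolding f_def by (subst nn_integral_add) (auto simp: nn_integral_sum emeasure_space_1)
      also have "\<dots> \<le> 1 + (\<Sum>m<n. ennreal (lam * (T / real n)))"
        using change_prob[OF elim]
        by (intro add_left_mono sum_mono) (auto simp: Ch_def emeasure_eq_measure intro!: ennreal_leI)
      also have "\<dots> = ennreal 1 + ennreal (\<Sum>m<n. lam * (T / real n))"
        using lam_pos T_pos by (subst sum_ennreal) auto
      also have "\<dots> = ennreal (1 + lam * T)"
        using elim lam_pos T_pos by (subst ennreal_plus[symmetric]) auto
      finally show ?case .
    qed
  qed
  finally show ?thesis .
qed

end

section \<open>From the grid to the realization itself\<close>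

locale compiled_flow = compiler_chain Q T c w w' lam M + skew_flows Q G C E
  for Q T c w w' lam M and G :: "nat \<Rightarrow> 'a::real_inner \<Rightarrow> 'a" and C E +
  fixes u :: "real \<Rightarrow> 'a"
  assumes u_deriv: "t \<in> {0..T} \<Longrightarrow>
      (u has_vector_derivative (\<Sum>k=1..Q. w k t *\<^sub>R G k (u t))) (at t within {0..T})"
    and u_0: "norm (u 0) = 1"
begin

lemma Q_nonempty: "1 \<in> {1..Q}"
  using w_sum[of 0] T_pos by (cases Q) auto

lemma C_positive: "0 < C"
  using skew_flow.C_pos[OF flows[OF Q_nonempty]] .

lemma norm_u:
  assumes "t \<in> {0..T}"
  shows "norm (u t) = 1"
proof -
  have "norm (u t) = norm (u 0)"
  proof (rule norm_constant_of_orthogonal_derivative[OF u_deriv _ assms])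
    fix t
    show "inner (\<Sum>k=1..Q. w k t *\<^sub>R G k (u t)) (u t) = 0"
      unfolding inner_sum_left
      by (rule sum.neutral) (metis flows skew_flow.skew_G inner_scaleR_left mult_zero_right)
  qed auto
  then show ?thesis using u_0 by simp
qed

text \<open>Makes the Euler steps of \<open>u\<close> uniformly accurate through
  \<open>derivative_uniform_approx\<close>.\<close>

lemma generator_continuous: "continuous_on {0..T} (\<lambda>t. \<Sum>k=1..Q. w k t *\<^sub>R G k (u t))"
proof (intro continuous_intros w_continuous)
  fix k assume k: "k \<in> {1..Q}"
  have lin: "linear (G k)" by (rule skew_flow.linear_G[OF flows[OF k]])
  have "bounded_linear (G k)"
    by (rule bounded_linear_intro[of _ C])
      (use skew_flow.bound_G[OF flows[OF k]] in \<open>simp_all add: linear_add[OF lin] linear_scale[OF lin] mult.commute\<close>)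
  moreover have "continuous_on {0..T} u"
    by (rule continuous_on_vector_derivative) (rule u_deriv)
  ultimately show "continuous_on {0..T} (\<lambda>t. G k (u t))" by (rule bounded_linear.continuous_on)
qed

text \<open>The mean over the grid evolutions of the chain on the event that it is at \<open>j\<close> at grid time \<open>m\<close>.\<close>

definition mean_state :: "nat \<Rightarrow> nat \<Rightarrow> nat \<Rightarrow> 'a" where
  "mean_state n m j = (\<Sum>k\<in>paths Q m.
     (path_prob (grid_time n) k m * of_bool (k m = j)) *\<^sub>R grid_run k (T / real n) m (u 0))"

lemma mean_state_0: "j \<in> {1..Q} \<Longrightarrow> mean_state n 0 j = w j 0 *\<^sub>R u 0"
proof -
  assume j: "j \<in> {1..Q}"
  have "mean_state n 0 j = (\<Sum>i=1..Q. if i = j then w j 0 *\<^sub>R u 0 else 0)"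
    unfolding mean_state_def sum_paths_0 by (intro sum.cong) (auto simp: path_prob_def)
  then show ?thesis using j by simp
qed

text \<open>\<open>chain_prob\<close> is \<open>q\<close> times the identity plus a term
  \<open>r\<close> that does not depend on the old node, so the mean at \<open>j\<close> receives
  its own kept part and a share of the sum over all nodes.\<close>

lemma mean_state_Suc:
  assumes n: "0 < n" and j: "j \<in> {1..Q}"
  defines "h \<equiv> T / real n"
  shows "mean_state n (Suc m) j = exp (- lam * h) *\<^sub>R E j h (mean_state n m j) +
    (w j (real (Suc m) * h) - exp (- lam * h) * w j (real m * h)) *\<^sub>R (\<Sum>i=1..Q. E i h (mean_state n m i))"
proof -
  note [simp del] = One_nat_def
  define t where "t = grid_time n"
  define q where "q = exp (- lam * h)"
  define r where "r = w j (t (Suc m)) - q * w j (t m)"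
  define g where "g k = E (k m) h (grid_run k h m (u 0))" for k
  define pp where "pp k = path_prob t k m" for k
  have t: "t m = real m * h" for m by (simp add: t_def grid_time_def h_def)
  have h0: "0 \<le> h" using T_pos by (simp add: h_def)
  have cp: "chain_prob (t m) (t (Suc m)) i j = q * of_bool (i = j) + r" for i
  proof -
    have "t (Suc m) - t m = h" by (simp add: t algebra_simps)
    then show ?thesis by (simp add: chain_prob_def q_def r_def algebra_simps)
  qed
  have E_mean: "E i h (mean_state n m i) = (\<Sum>k\<in>paths Q m. (pp k * of_bool (k m = i)) *\<^sub>R g k)"
    if i: "i \<in> {1..Q}" for i
  proof -
    have lin: "linear (E i h)" by (rule skew_flow.linear_E[OF flows[OF i] h0])
    have "E i h (mean_state n m i) =
        (\<Sum>k\<in>paths Q m. (pp k * of_bool (k m = i)) *\<^sub>R E i h (grid_run k h m (u 0)))"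
      unfolding mean_state_def h_def[symmetric] t_def[symmetric] pp_def
      by (simp only: linear_sum[OF lin] linear_scale[OF lin])
    also have "\<dots> = (\<Sum>k\<in>paths Q m. (pp k * of_bool (k m = i)) *\<^sub>R g k)"
      by (intro sum.cong refl) (auto simp: g_def)
    finally show ?thesis .
  qed
  have tot: "(\<Sum>i=1..Q. E i h (mean_state n m i)) = (\<Sum>k\<in>paths Q m. pp k *\<^sub>R g k)"
  proof -
    have "(\<Sum>i=1..Q. E i h (mean_state n m i)) =
        (\<Sum>i=1..Q. \<Sum>k\<in>paths Q m. (pp k * of_bool (k m = i)) *\<^sub>R g k)"
      by (intro sum.cong refl E_mean)
    also have "\<dots> = (\<Sum>k\<in>paths Q m. \<Sum>i=1..Q. (pp k * of_bool (k m = i)) *\<^sub>R g k)"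
      by (rule sum.swap)
    also have "\<dots> = (\<Sum>k\<in>paths Q m. pp k *\<^sub>R g k)"
    proof (intro sum.cong refl)
      fix k assume k: "k \<in> paths Q m"
      have "(\<Sum>i=1..Q. (pp k * of_bool (k m = i)) *\<^sub>R g k) =
          (\<Sum>i=1..Q. if i = k m then pp k *\<^sub>R g k else 0)"
        by (intro sum.cong) auto
      then show "(\<Sum>i=1..Q. (pp k * of_bool (k m = i)) *\<^sub>R g k) = pp k *\<^sub>R g k"
        using paths_range[OF k, of m] by simp
    qed
    finally show ?thesis .
  qed
  have "mean_state n (Suc m) j = (\<Sum>k\<in>paths Q m. \<Sum>i=1..Q.
      (path_prob t (k(Suc m := i)) (Suc m) * of_bool (i = j)) *\<^sub>R grid_run (k(Suc m := i)) h (Suc m) (u 0))"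
    unfolding mean_state_def sum_paths_Suc t_def h_def by (simp only: fun_upd_same)
  also have "\<dots> = (\<Sum>k\<in>paths Q m. (pp k * (q * of_bool (k m = j) + r)) *\<^sub>R g k)"
  proof (intro sum.cong refl)
    fix k assume k: "k \<in> paths Q m"
    \<comment> \<open>A run of \<open>Suc m\<close> steps reads the nodes with indices
      \<open>0\<close> to \<open>m\<close> only, so the node newly drawn at index
      \<open>Suc m\<close> does not act on the state yet.\<close>
    have gr: "grid_run (k(Suc m := i)) h (Suc m) (u 0) = g k" for i
      unfolding g_def grid_run_Suc
      by (subst grid_run_cong[where k' = k]) auto
    have "(\<Sum>i=1..Q. (path_prob t (k(Suc m := i)) (Suc m) * of_bool (i = j)) *\<^sub>R grid_run (k(Suc m := i)) h (Suc m) (u 0)) =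
        (\<Sum>i=1..Q. if i = j then (pp k * (q * of_bool (k m = j) + r)) *\<^sub>R g k else 0)"
      by (intro sum.cong refl) (auto simp only: gr path_prob_update[OF k] pp_def cp of_bool_eq mult_1_right mult_zero_right scaleR_zero_left if_True if_False simp_thms split: if_splits)
    then show "(\<Sum>i=1..Q. (path_prob t (k(Suc m := i)) (Suc m) * of_bool (i = j)) *\<^sub>R grid_run (k(Suc m := i)) h (Suc m) (u 0)) =
        (pp k * (q * of_bool (k m = j) + r)) *\<^sub>R g k"
      using j by simp
  qed
  also have "\<dots> = (\<Sum>k\<in>paths Q m. q *\<^sub>R ((pp k * of_bool (k m = j)) *\<^sub>R g k) + r *\<^sub>R (pp k *\<^sub>R g k))"
    by (intro sum.cong refl) (simp add: algebra_simps)
  also have "\<dots> = q *\<^sub>R E j h (mean_state n m j) + r *\<^sub>R (\<Sum>i=1..Q. E i h (mean_state n m i))"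
    unfolding tot E_mean[OF j] by (simp only: sum.distrib scaleR_sum_right)
  finally show ?thesis unfolding r_def q_def t .
qed

definition grid_overlap :: "nat \<Rightarrow> (nat \<times> real) list \<Rightarrow> real" where
  "grid_overlap n l = inner (u T) (grid_run (\<lambda>m. node_at l (grid_time n m)) (T / real n) n (u 0))"

lemma grid_overlap_expectation:
  assumes n: "0 < n"
  shows "integral\<^sup>L M (grid_overlap n) = inner (u T) (\<Sum>j=1..Q. mean_state n n j)"
    and "integrable M (grid_overlap n)"
proof -
  note [simp del] = One_nat_def
  let ?F = "\<lambda>k. inner (u T) (grid_run k (T / real n) n (u 0))"
  have t: "times (grid_time n) n" by (rule grid_times[OF n order_refl])
  have F: "?F k = ?F k'" if "\<And>m. m \<le> n \<Longrightarrow> k m = k' m" for k k'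
    using grid_run_cong[of n k k'] that by simp
  have "integral\<^sup>L M (grid_overlap n) = (\<Sum>k\<in>paths Q n. path_prob (grid_time n) k n * ?F k)"
    unfolding grid_overlap_def by (rule expectation_paths(1)[OF t F])
  also have "\<dots> = inner (u T) (\<Sum>k\<in>paths Q n. path_prob (grid_time n) k n *\<^sub>R grid_run k (T / real n) n (u 0))"
    by (simp add: inner_sum_right)
  also have "(\<Sum>k\<in>paths Q n. path_prob (grid_time n) k n *\<^sub>R grid_run k (T / real n) n (u 0)) =
      (\<Sum>k\<in>paths Q n. \<Sum>j=1..Q. (path_prob (grid_time n) k n * of_bool (k n = j)) *\<^sub>R grid_run k (T / real n) n (u 0))"
  proof (intro sum.cong refl)
    fix k assume k: "k \<in> paths Q n"
    let ?y = "path_prob (grid_time n) k n *\<^sub>R grid_run k (T / real n) n (u 0)"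
    have "(\<Sum>j=1..Q. (path_prob (grid_time n) k n * of_bool (k n = j)) *\<^sub>R grid_run k (T / real n) n (u 0)) =
        (\<Sum>j=1..Q. if j = k n then ?y else 0)"
      by (intro sum.cong) auto
    then show "?y = (\<Sum>j=1..Q. (path_prob (grid_time n) k n * of_bool (k n = j)) *\<^sub>R grid_run k (T / real n) n (u 0))"
      using paths_range[OF k, of n] by simp
  qed
  also have "\<dots> = (\<Sum>j=1..Q. mean_state n n j)"
    unfolding mean_state_def by (rule sum.swap)
  finally show "integral\<^sup>L M (grid_overlap n) = inner (u T) (\<Sum>j=1..Q. mean_state n n j)" .
  show "integrable M (grid_overlap n)"
    unfolding grid_overlap_def by (rule expectation_paths(2)[OF t F])
qed

text \<open>Pathwise a realization has finitely many stays, so the rounding error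
  \<open>C * (T / n) * length l\<close> vanishes. The index \<open>Suc n\<close> avoids the
  degenerate grid \<open>n = 0\<close>.\<close>

lemma grid_overlap_tendsto:
  assumes l: "l \<in> space M"
  shows "(\<lambda>n. grid_overlap (Suc n) l) \<longlonglongrightarrow> inner (u T) (run l (u 0))"
proof (rule LIMSEQ_Suc, rule LIM_zero_cancel, rule Lim_null_comparison)
  show "(\<lambda>n. C * (T / real n) * real (length l)) \<longlonglongrightarrow> 0"
    by (intro tendsto_mult_left_zero tendsto_mult_right_zero lim_const_over_n)
  show "\<forall>\<^sub>F n in sequentially. norm (grid_overlap n l - inner (u T) (run l (u 0))) \<le> C * (T / real n) * real (length l)"
    using eventually_gt_at_top[of 0]
  proof eventually_elim
    case (elim n)
    have "norm (run l (u 0) - grid_run (\<lambda>m. node_at l (0 + real m * (T / real n))) (T / real n) n (u 0)) \<le>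
        C * (T / real n) * real (length l) * norm (u 0)"
      by (rule run_grid_error) (use elim T_pos realization_props[OF l] in auto)
    then have "norm (grid_run (\<lambda>m. node_at l (grid_time n m)) (T / real n) n (u 0) - run l (u 0)) \<le>
        C * (T / real n) * real (length l)"
      by (simp add: grid_time_def u_0 norm_minus_commute)
    moreover have "\<bar>inner (u T) y\<bar> \<le> norm y" for y
      using Cauchy_Schwarz_ineq2[of "u T" y] norm_u[of T] T_pos by simp
    ultimately show ?case
      unfolding grid_overlap_def inner_diff_right[symmetric] real_norm_def by (rule order_trans[rotated])
  qed
qed

lemma grid_overlap_bound:
  assumes l: "l \<in> space M"
  shows "\<bar>grid_overlap n l\<bar> \<le> 1"
proof -
  have "norm (grid_run (\<lambda>m. node_at l (grid_time n m)) (T / real n) n (u 0)) = 1"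
    using norm_grid_run[of "T / real n" n] node_at_range[OF l] T_pos u_0 by simp
  then show ?thesis
    using Cauchy_Schwarz_ineq2[of "u T"] norm_u[of T] T_pos
    unfolding grid_overlap_def by (metis atLeastAtMost_iff less_imp_le mult_1 order_refl)
qed

text \<open>A pointwise limit of grid overlaps, each of which depends on finitely many nodes and is
  therefore measurable.\<close>

lemma overlap_measurable: "(\<lambda>l. inner (u T) (run l (u 0))) \<in> borel_measurable M"
  by (rule borel_measurable_LIMSEQ_real[OF grid_overlap_tendsto])
    (auto intro: borel_measurable_integrable[OF grid_overlap_expectation(2)])

lemma overlap_bound:
  assumes l: "l \<in> space M"
  shows "\<bar>inner (u T) (run l (u 0))\<bar> \<le> 1"
proof (rule LIMSEQ_le_const2)
  show "(\<lambda>n. \<bar>grid_overlap (Suc n) l\<bar>) \<longlonglongrightarrow> \<bar>inner (u T) (run l (u 0))\<bar>"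
    by (intro tendsto_rabs grid_overlap_tendsto l)
qed (use grid_overlap_bound[OF l] in auto)

lemma overlap_integrable: "integrable M (\<lambda>l. inner (u T) (run l (u 0)))"
  by (rule integrable_const_bound[of _ 1]) (auto intro!: AE_I2 overlap_bound overlap_measurable)

text \<open>The \<open>n\<close> steps of length \<open>h\<close> make up the time \<open>T\<close>,
  so the loss is \<open>T\<close> times the rate of loss in \<open>discrete_lower_bound\<close>. The
  terms containing \<open>h\<close> vanish in the limit, and \<open>\<eta> = e / T\<close>
  contributes the arbitrary slack \<open>e\<close>.\<close>

theorem expected_overlap:
  "1 - 2 * C\<^sup>2 * T / lam \<le> integral\<^sup>L M (\<lambda>l. inner (u T) (run l (u 0)))"
proof (rule field_le_epsilon)
  fix e :: real assume e: "0 < e"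
  define \<eta> where "\<eta> = e / T"
  have \<eta>: "0 < \<eta>" using e T_pos by (simp add: \<eta>_def)
  obtain \<delta> where \<delta>: "0 < \<delta>" "\<And>s t. 0 \<le> s \<Longrightarrow> s \<le> t \<Longrightarrow> t \<le> T \<Longrightarrow> t - s < \<delta> \<Longrightarrow>
      norm (u t - u s - (t - s) *\<^sub>R (\<Sum>k=1..Q. w k s *\<^sub>R G k (u s))) \<le> \<eta> * (t - s)"
    using derivative_uniform_approx[OF u_deriv generator_continuous \<eta>] by blast
  let ?L = "\<lambda>n. 1 - T * (2 * C\<^sup>2 / lam + \<eta> + C\<^sup>2 * (T / real n) + (C + \<eta>) * C * (T / real n))"
  have lim: "(\<lambda>n. integral\<^sup>L M (grid_overlap (Suc n))) \<longlonglongrightarrow> integral\<^sup>L M (\<lambda>l. inner (u T) (run l (u 0)))"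
  proof (rule integral_dominated_convergence[where w = "\<lambda>_. 1"])
    show "grid_overlap (Suc n) \<in> borel_measurable M" for n
      by (rule borel_measurable_integrable[OF grid_overlap_expectation(2)]) simp
    show "AE l in M. (\<lambda>n. grid_overlap (Suc n) l) \<longlonglongrightarrow> inner (u T) (run l (u 0))"
      by (rule AE_I2) (rule grid_overlap_tendsto)
    show "AE l in M. norm (grid_overlap (Suc n) l) \<le> 1" for n
      by (rule AE_I2) (simp add: grid_overlap_bound)
  qed (rule overlap_measurable, simp)
  have ev: "eventually (\<lambda>n. ?L n \<le> integral\<^sup>L M (grid_overlap n)) sequentially"
  proof -
    have "eventually (\<lambda>n. T / real n < \<delta>) sequentially"
      using \<delta>(1) by (intro order_tendstoD(2)[OF lim_const_over_n])
    then show ?thesis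
      using eventually_gt_at_top[of 0]
    proof eventually_elim
      case (elim n)
      define h where "h = T / real n"
      have h: "0 < h" "h < \<delta>" "real n * h = T" using elim T_pos by (auto simp: h_def)
      have ran: "0 \<le> real m * h" "real m * h \<le> T" if "m \<le> n" for m
        using h that T_pos by (auto simp: h(3)[symmetric] intro!: mult_right_mono)
      have "1 - real n * h * (2 * C\<^sup>2 / lam + \<eta> + C\<^sup>2 * h + (C + \<eta>) * C * h) \<le>
          inner (u (real n * h)) (\<Sum>j=1..Q. mean_state n n j)"
      proof (rule discrete_lower_bound[where w = w and \<psi> = "u 0" and v = "mean_state n"])
        show "exp (- lam * h) * w j (real m * h) \<le> w j (real (Suc m) * h)" if "m < n" "j \<in> {1..Q}" for m j
          using w_decay[of "real m * h" "real (Suc m) * h" j] ran[of m] ran[of "Suc m"] that h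
          by (simp add: algebra_simps)
        show "mean_state n (Suc m) j = exp (- lam * h) *\<^sub>R E j h (mean_state n m j) +
            (w j (real (Suc m) * h) - exp (- lam * h) * w j (real m * h)) *\<^sub>R (\<Sum>i=1..Q. E i h (mean_state n m i))"
          if "m < n" "j \<in> {1..Q}" for m j
          unfolding h_def by (rule mean_state_Suc[OF elim(2) that(2)])
        show "norm (u (real (Suc m) * h) - u (real m * h) - h *\<^sub>R
            (\<Sum>k=1..Q. w k (real m * h) *\<^sub>R G k (u (real m * h)))) \<le> \<eta> * h" if "m < n" for m
        proof -
          have d: "real (Suc m) * h - real m * h = h" by (simp add: algebra_simps)
          show ?thesis
            using \<delta>(2)[of "real m * h" "real (Suc m) * h"] ran[of m] ran[of "Suc m"] that h
            unfolding d by (simp add: mult_right_mono)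
        qed
        show "norm (u (real m * h)) \<le> 1" if "m \<le> n" for m
          using norm_u ran[OF that] by simp
      qed (use C_positive h lam_pos \<eta> w_nonneg w_sum ran mean_state_0 u_0 in auto)
      then show ?case
        unfolding h(3) grid_overlap_expectation(1)[OF elim(2)] by (simp add: h_def)
    qed
  qed
  have "(\<lambda>n. ?L n) \<longlonglongrightarrow> 1 - T * (2 * C\<^sup>2 / lam + \<eta> + C\<^sup>2 * 0 + (C + \<eta>) * C * 0)"
    by (intro tendsto_intros lim_const_over_n)
  then have "1 - T * (2 * C\<^sup>2 / lam + \<eta> + C\<^sup>2 * 0 + (C + \<eta>) * C * 0) \<le> integral\<^sup>L M (\<lambda>l. inner (u T) (run l (u 0)))"
  proof (rule tendsto_le[OF trivial_limit_sequentially _ _ ev, rotated])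
    show "(\<lambda>n. integral\<^sup>L M (grid_overlap n)) \<longlonglongrightarrow> integral\<^sup>L M (\<lambda>l. inner (u T) (run l (u 0)))"
      using lim by (rule LIMSEQ_imp_Suc)
  qed
  then show "1 - 2 * C\<^sup>2 * T / lam \<le> integral\<^sup>L M (\<lambda>l. inner (u T) (run l (u 0))) + e"
    using T_pos by (simp add: \<eta>_def algebra_simps)
qed

end

section \<open>Finitely supported functions as a real inner product space\<close>

instantiation poly_mapping :: (type, real_vector) real_vector
begin


definition scaleR_poly_mapping :: "real \<Rightarrow> ('a \<Rightarrow>\<^sub>0 'b) \<Rightarrow> 'a \<Rightarrow>\<^sub>0 'b" where
  "scaleR_poly_mapping r f = Poly_Mapping.map (scaleR r) f"

lemma lookup_scaleR: "Poly_Mapping.lookup (r *\<^sub>R f) i = r *\<^sub>R Poly_Mapping.lookup f i" for f :: "'a \<Rightarrow>\<^sub>0 'b"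
  by (simp add: scaleR_poly_mapping_def Poly_Mapping.map.rep_eq when_def)

instance
  by standard (auto intro!: poly_mapping_eqI simp: lookup_scaleR lookup_add algebra_simps)

end

instantiation poly_mapping :: (type, real_inner) real_inner
begin


definition inner_poly_mapping :: "('a \<Rightarrow>\<^sub>0 'b) \<Rightarrow> ('a \<Rightarrow>\<^sub>0 'b) \<Rightarrow> real" where
  "inner_poly_mapping f g = (\<Sum>i\<in>Poly_Mapping.keys f. inner (Poly_Mapping.lookup f i) (Poly_Mapping.lookup g i))"

definition norm_poly_mapping :: "('a \<Rightarrow>\<^sub>0 'b) \<Rightarrow> real" where
  "norm_poly_mapping f = sqrt (inner f f)"

definition sgn_poly_mapping :: "('a \<Rightarrow>\<^sub>0 'b) \<Rightarrow> 'a \<Rightarrow>\<^sub>0 'b" where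
  "sgn_poly_mapping f = f /\<^sub>R norm f"

definition dist_poly_mapping :: "('a \<Rightarrow>\<^sub>0 'b) \<Rightarrow> ('a \<Rightarrow>\<^sub>0 'b) \<Rightarrow> real" where
  "dist_poly_mapping f g = norm (f - g)"

definition uniformity_poly_mapping :: "(('a \<Rightarrow>\<^sub>0 'b) \<times> ('a \<Rightarrow>\<^sub>0 'b)) filter" where
  "uniformity_poly_mapping = (INF e\<in>{0<..}. principal {(x, y). dist x y < e})"

definition open_poly_mapping :: "('a \<Rightarrow>\<^sub>0 'b) set \<Rightarrow> bool" where
  "open_poly_mapping U \<longleftrightarrow> (\<forall>x\<in>U. eventually (\<lambda>(x', y). x' = x \<longrightarrow> y \<in> U) uniformity)"

text \<open>Outside the support of \<open>f\<close> the summands vanish. A common finite index set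
  turns symmetry and additivity into identities between sums.\<close>

lemma inner_poly_mapping_superset:
  fixes f g :: "'a \<Rightarrow>\<^sub>0 'b"
  assumes "finite A" "Poly_Mapping.keys f \<subseteq> A"
  shows "inner f g = (\<Sum>i\<in>A. inner (Poly_Mapping.lookup f i) (Poly_Mapping.lookup g i))"
  unfolding inner_poly_mapping_def
  by (rule sum.mono_neutral_left) (use assms in \<open>auto simp: in_keys_iff\<close>)

instance
proof
  fix x y z :: "'a \<Rightarrow>\<^sub>0 'b" and r :: real
  show "sgn x = x /\<^sub>R norm x" by (simp add: sgn_poly_mapping_def)
  show "dist x y = norm (x - y)" by (simp add: dist_poly_mapping_def)
  show "(uniformity :: (('a \<Rightarrow>\<^sub>0 'b) \<times> ('a \<Rightarrow>\<^sub>0 'b)) filter) = (INF e\<in>{0<..}. principal {(x, y). dist x y < e})"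
    by (simp add: uniformity_poly_mapping_def)
  show "open U = (\<forall>x\<in>U. eventually (\<lambda>(x', y). x' = x \<longrightarrow> y \<in> U) uniformity)" for U :: "('a \<Rightarrow>\<^sub>0 'b) set"
    by (simp add: open_poly_mapping_def)
  let ?A = "Poly_Mapping.keys x \<union> Poly_Mapping.keys y \<union> Poly_Mapping.keys (x + y) \<union> Poly_Mapping.keys (r *\<^sub>R x)"
  have sup: "inner f g = (\<Sum>i\<in>?A. inner (Poly_Mapping.lookup f i) (Poly_Mapping.lookup g i))"
    if "Poly_Mapping.keys f \<subseteq> ?A" for f g :: "'a \<Rightarrow>\<^sub>0 'b"
    by (rule inner_poly_mapping_superset[OF _ that]) simp
  have "inner x y = (\<Sum>i\<in>?A. inner (Poly_Mapping.lookup x i) (Poly_Mapping.lookup y i))" by (rule sup) auto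
  also have "\<dots> = (\<Sum>i\<in>?A. inner (Poly_Mapping.lookup y i) (Poly_Mapping.lookup x i))"
    by (simp only: inner_commute)
  also have "\<dots> = inner y x" by (rule sup[symmetric]) auto
  finally show "inner x y = inner y x" .
  have "inner (x + y) z = (\<Sum>i\<in>?A. inner (Poly_Mapping.lookup (x + y) i) (Poly_Mapping.lookup z i))" by (rule sup) auto
  also have "\<dots> = (\<Sum>i\<in>?A. inner (Poly_Mapping.lookup x i) (Poly_Mapping.lookup z i)) + (\<Sum>i\<in>?A. inner (Poly_Mapping.lookup y i) (Poly_Mapping.lookup z i))"
    by (simp add: lookup_add inner_add_left sum.distrib)
  also have "\<dots> = inner x z + inner y z" by (intro arg_cong2[of _ _ _ _ "(+)"] sup[symmetric]) auto
  finally show "inner (x + y) z = inner x z + inner y z" .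
  have "inner (r *\<^sub>R x) y = (\<Sum>i\<in>?A. inner (Poly_Mapping.lookup (r *\<^sub>R x) i) (Poly_Mapping.lookup y i))" by (rule sup) auto
  also have "\<dots> = r * (\<Sum>i\<in>?A. inner (Poly_Mapping.lookup x i) (Poly_Mapping.lookup y i))"
    by (simp add: lookup_scaleR sum_distrib_left)
  also have "\<dots> = r * inner x y" by (intro arg_cong2[of _ _ _ _ "(*)"] refl sup[symmetric]) auto
  finally show "inner (r *\<^sub>R x) y = r * inner x y" .
  show "0 \<le> inner x x" unfolding inner_poly_mapping_def by (intro sum_nonneg) simp
  show "inner x x = 0 \<longleftrightarrow> x = 0"
    unfolding inner_poly_mapping_def by (subst sum_nonneg_eq_0_iff) (auto simp: in_keys_iff intro!: poly_mapping_eqI)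
  show "norm x = sqrt (inner x x)" by (simp add: norm_poly_mapping_def)
qed

end

section \<open>Embedding complex vectors of every dimension\<close>

text \<open>The dimension \<open>d\<close> is a term and not a type, so vectors of all dimensions are embedded in the single
  real inner product space of finitely supported functions.\<close>

definition embed_vec :: "complex vec \<Rightarrow> nat \<Rightarrow>\<^sub>0 complex" where
  "embed_vec v = (\<Sum>i<dim_vec v. Poly_Mapping.single i (v $ i))"

text \<open>Truncation to the first \<open>d\<close> coordinates: on dimension \<open>d\<close> a
  left inverse of \<open>embed_vec\<close>, and its adjoint in view of
  \<open>inner_embed_coord_vec\<close>.\<close>

definition coord_vec :: "nat \<Rightarrow> (nat \<Rightarrow>\<^sub>0 complex) \<Rightarrow> complex vec" where
  "coord_vec d x = vec d (Poly_Mapping.lookup x)"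

lemma lookup_embed_vec: "Poly_Mapping.lookup (embed_vec v) i = (if i < dim_vec v then v $ i else 0)"
  by (simp add: embed_vec_def lookup_sum lookup_single when_def)

lemma coord_vec_carrier [simp]: "coord_vec d x \<in> carrier_vec d"
  by (simp add: coord_vec_def)

lemma dim_coord_vec [simp]: "dim_vec (coord_vec d x) = d"
  by (simp add: coord_vec_def)

lemma coord_embed_vec [simp]: "v \<in> carrier_vec d \<Longrightarrow> coord_vec d (embed_vec v) = v"
  by (auto simp: coord_vec_def lookup_embed_vec)

lemma coord_vec_add: "coord_vec d (x + y) = coord_vec d x + coord_vec d y"
  by (auto simp: coord_vec_def lookup_add)

lemma coord_vec_scaleR: "coord_vec d (r *\<^sub>R x) = complex_of_real r \<cdot>\<^sub>v coord_vec d x"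
  by (auto simp: coord_vec_def lookup_scaleR scaleR_conv_of_real)

lemma embed_vec_add: "v \<in> carrier_vec d \<Longrightarrow> w \<in> carrier_vec d \<Longrightarrow> embed_vec (v + w) = embed_vec v + embed_vec w"
  by (auto intro!: poly_mapping_eqI simp: lookup_embed_vec lookup_add)

lemma embed_vec_scaleR: "embed_vec (complex_of_real r \<cdot>\<^sub>v v) = r *\<^sub>R embed_vec v"
  by (auto intro!: poly_mapping_eqI simp: lookup_embed_vec lookup_scaleR scaleR_conv_of_real)

lemma inner_embed_vec_left:
  "inner (embed_vec v) x = (\<Sum>i<dim_vec v. inner (v $ i) (Poly_Mapping.lookup x i))"
proof -
  have "inner (embed_vec v) x = (\<Sum>i<dim_vec v. inner (Poly_Mapping.lookup (embed_vec v) i) (Poly_Mapping.lookup x i))"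
    by (rule inner_poly_mapping_superset) (auto simp: in_keys_iff lookup_embed_vec split: if_splits)
  then show ?thesis by (simp add: lookup_embed_vec)
qed

lemma inner_embed_vec:
  assumes "v \<in> carrier_vec d" "w \<in> carrier_vec d"
  shows "inner (embed_vec v) (embed_vec w) = Re (v \<bullet>c w)"
proof -
  have "inner (embed_vec v) (embed_vec w) = (\<Sum>i<d. inner (v $ i) (w $ i))"
    using assms by (simp add: inner_embed_vec_left lookup_embed_vec)
  also have "\<dots> = Re (v \<bullet>c w)"
    using assms by (simp add: scalar_prod_def inner_complex_def lessThan_atLeast0)
  finally show ?thesis .
qed

lemma norm_embed_vec: "norm (embed_vec v) = hilbert_norm v"
  unfolding norm_eq_sqrt_inner hilbert_norm_def inner_embed_vec[OF carrier_vecI[OF refl] carrier_vecI[OF refl]]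
  by (rule refl)

lemma inner_embed_coord_vec:
  "v \<in> carrier_vec d \<Longrightarrow> inner (embed_vec v) x = inner (embed_vec v) (embed_vec (coord_vec d x))"
  by (simp add: inner_embed_vec_left lookup_embed_vec coord_vec_def)

text \<open>Truncation is an orthogonal projection: the truncated vector \<open>y\<close> satisfies
  \<open>inner y y = inner y x\<close>, and Cauchy-Schwarz concludes.\<close>

lemma norm_embed_coord_vec_le: "norm (embed_vec (coord_vec d x)) \<le> norm x"
proof -
  let ?y = "embed_vec (coord_vec d x)"
  have "norm ?y * norm ?y = inner ?y ?y" by (simp add: norm_eq_sqrt_inner)
  also have "\<dots> = inner ?y x" by (rule inner_embed_coord_vec[OF coord_vec_carrier, symmetric])
  also have "\<dots> \<le> norm ?y * norm x" by (rule norm_cauchy_schwarz)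
  finally show ?thesis by (cases "norm ?y = 0") (auto simp: mult_le_cancel_left)
qed

lemma has_vector_derivative_embed_vec:
  assumes "\<And>t. f t \<in> carrier_vec d" "f' \<in> carrier_vec d"
    and "\<And>i. i < d \<Longrightarrow> ((\<lambda>t. f t $ i) has_vector_derivative f' $ i) (at t within S)"
  shows "((\<lambda>t. embed_vec (f t)) has_vector_derivative embed_vec f') (at t within S)"
proof -
  have bl: "bounded_linear (\<lambda>z::complex. Poly_Mapping.single i z)" for i :: nat
  proof (rule bounded_linear_intro[of _ 1])
    fix x y :: complex and r :: real
    show "Poly_Mapping.single i (x + y) = Poly_Mapping.single i x + Poly_Mapping.single i y"
      by (rule single_add)
    show "Poly_Mapping.single i (r *\<^sub>R x) = r *\<^sub>R Poly_Mapping.single i x"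
      by (auto intro!: poly_mapping_eqI simp: lookup_scaleR lookup_single when_def)
    have "inner (Poly_Mapping.single i x) (Poly_Mapping.single i x) = inner x x"
      by (subst inner_poly_mapping_superset[of "{i}"]) (auto simp: in_keys_iff lookup_single when_def)
    then show "norm (Poly_Mapping.single i x) \<le> norm x * 1" by (simp add: norm_eq_sqrt_inner)
  qed
  have dim: "dim_vec (f t) = d" "dim_vec f' = d" for t using assms(1)[of t] assms(2) by auto
  show ?thesis
    unfolding embed_vec_def dim
    by (intro has_vector_derivative_sum bounded_linear.has_vector_derivative[OF bl] assms(3)) auto
qed

section \<open>Time-ordered exponentials\<close>

lemma mult_mat_index:
  assumes "A \<in> carrier_mat n m" "B \<in> carrier_mat m p" "i < n" "j < p"
  shows "(A * B) $$ (i, j) = (\<Sum>k<m. A $$ (i, k) * B $$ (k, j))"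
  using assms by (simp add: scalar_prod_def lessThan_atLeast0)

lemma mult_mat_vec_index:
  assumes "A \<in> carrier_mat n m" "v \<in> carrier_vec m" "i < n"
  shows "(A *\<^sub>v v) $ i = (\<Sum>k<m. A $$ (i, k) * v $ k)"
  using assms by (simp add: scalar_prod_def lessThan_atLeast0)

locale dyson =
  fixes d :: nat and H :: "real \<Rightarrow> complex mat" and T :: real
  assumes carrier_H: "H s \<in> carrier_mat d d"
    and continuous_H: "i < d \<Longrightarrow> j < d \<Longrightarrow> continuous_on {0..T} (\<lambda>s. H s $$ (i, j))"
    and T_nonneg: "0 \<le> T"
begin

lemma dyson_carrier [simp]: "dyson_term d H n t \<in> carrier_mat d d"
  by (cases n) auto

text \<open>The integrand in the recursion for \<open>dyson_term\<close>; up to the factor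
  \<open>- \<i>\<close> it is the derivative of the entry of order \<open>Suc n\<close>.\<close>

definition rate :: "nat \<Rightarrow> nat \<Rightarrow> nat \<Rightarrow> real \<Rightarrow> complex" where
  "rate i j n t = (H t * dyson_term d H n t) $$ (i, j)"

lemma rate_eq: "i < d \<Longrightarrow> j < d \<Longrightarrow> rate i j n t = (\<Sum>k<d. H t $$ (i, k) * dyson_term d H n t $$ (k, j))"
  unfolding rate_def by (rule mult_mat_index[OF carrier_H]) auto

lemma dyson_continuous:
  "i < d \<Longrightarrow> j < d \<Longrightarrow> continuous_on {0..T} (\<lambda>t. dyson_term d H n t $$ (i, j))"
  "i < d \<Longrightarrow> j < d \<Longrightarrow> continuous_on {0..T} (rate i j n)"
proof (induction n arbitrary: i j)
  have rate: "continuous_on {0..T} (rate i j n)"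
    if "\<And>i j. i < d \<Longrightarrow> j < d \<Longrightarrow> continuous_on {0..T} (\<lambda>t. dyson_term d H n t $$ (i, j))" "i < d" "j < d" for i j n
    unfolding rate_eq[OF that(2,3), abs_def] using that continuous_H by (intro continuous_intros) auto
  {
    case 0
    { case 1 then show ?case by simp }
    { case 2 then show ?case by (intro rate) auto }
  next
    case (Suc n)
    have D: "continuous_on {0..T} (\<lambda>t. dyson_term d H (Suc n) t $$ (i, j))" if "i < d" "j < d" for i j
    proof -
      have "continuous_on {0..T} (\<lambda>t. integral {0..t} (rate i j n))"
        by (intro indefinite_integral_continuous_1 integrable_continuous_real Suc.IH(2) that)
      then have "continuous_on {0..T} (\<lambda>t. - \<i> * integral {0..t} (rate i j n))"
        by (rule continuous_on_mult_left)
      then show ?thesis using that by (simp add: rate_def[abs_def])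
    qed
    { case 1 then show ?case by (rule D) }
    { case 2 then show ?case by (intro rate D) }
  }
qed

lemma dyson_deriv:
  assumes "i < d" "j < d" "t \<in> {0..T}"
  shows "((\<lambda>t. dyson_term d H (Suc n) t $$ (i, j)) has_vector_derivative - \<i> * rate i j n t) (at t within {0..T})"
proof -
  have "((\<lambda>t. integral {0..t} (rate i j n)) has_vector_derivative rate i j n t) (at t within {0..T})"
    by (rule integral_has_vector_derivative) (use assms dyson_continuous(2) in auto)
  from has_vector_derivative_mult_right[OF this, of "- \<i>"]
  show ?thesis using assms by (simp add: rate_def[abs_def])
qed

lemma dyson_0: "i < d \<Longrightarrow> j < d \<Longrightarrow> dyson_term d H (Suc n) 0 $$ (i, j) = 0"
  by simp

lemma H_bound: obtains B where "0 \<le> B" "\<And>s i j. s \<in> {0..T} \<Longrightarrow> i < d \<Longrightarrow> j < d \<Longrightarrow> norm (H s $$ (i, j)) \<le> B"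
proof -
  have "\<exists>B. \<forall>s\<in>{0..T}. norm (H s $$ ij) \<le> B" if mem: "ij \<in> {..<d} \<times> {..<d}" for ij
  proof -
    obtain i j where ij: "ij = (i, j)" "i < d" "j < d" using mem by auto
    have "compact ((\<lambda>s. H s $$ (i, j)) ` {0..T})"
      by (intro compact_continuous_image continuous_H ij) simp
    then have "bounded ((\<lambda>s. H s $$ (i, j)) ` {0..T})" by (rule compact_imp_bounded)
    then show ?thesis unfolding bounded_iff ij by auto
  qed
  then obtain B where B: "\<And>ij s. ij \<in> {..<d} \<times> {..<d} \<Longrightarrow> s \<in> {0..T} \<Longrightarrow> norm (H s $$ ij) \<le> B ij"
    by metis
  show ?thesis
  proof (rule that[of "\<Sum>ij\<in>{..<d} \<times> {..<d}. \<bar>B ij\<bar>"])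
    fix s i j assume a: "s \<in> {0..T}" "i < d" "j < d"
    have "norm (H s $$ (i, j)) \<le> \<bar>B (i, j)\<bar>" using B[of "(i, j)" s] a by auto
    also have "\<dots> \<le> (\<Sum>ij\<in>{..<d} \<times> {..<d}. \<bar>B ij\<bar>)"
      by (rule member_le_sum) (use a in auto)
    finally show "norm (H s $$ (i, j)) \<le> (\<Sum>ij\<in>{..<d} \<times> {..<d}. \<bar>B ij\<bar>)" .
  qed (auto intro: sum_nonneg)
qed

text \<open>Each matrix product costs a factor \<open>d * B\<close> entrywise, and the nested
  integrals supply \<open>t ^ n / fact n\<close>. The bound serves to sum and differentiate the
  series, so its dependence on \<open>d\<close> does not reach the final constants.\<close>

lemma dyson_bound:
  assumes B: "0 \<le> B" "\<And>s i j. s \<in> {0..T} \<Longrightarrow> i < d \<Longrightarrow> j < d \<Longrightarrow> norm (H s $$ (i, j)) \<le> B"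
    and ij: "i < d" "j < d" and t: "t \<in> {0..T}"
  shows "norm (dyson_term d H n t $$ (i, j)) \<le> (real d * B * t) ^ n / fact n"
    and "norm (rate i j n t) \<le> real d * B * ((real d * B * t) ^ n / fact n)"
  using ij t
proof (induction n arbitrary: i j t)
  have rate: "norm (rate i j n t) \<le> real d * B * ((real d * B * t) ^ n / fact n)"
    if IH: "\<And>i j. i < d \<Longrightarrow> j < d \<Longrightarrow> norm (dyson_term d H n t $$ (i, j)) \<le> (real d * B * t) ^ n / fact n"
      and "i < d" "j < d" "t \<in> {0..T}" for i j t n
  proof -
    have "norm (rate i j n t) \<le> (\<Sum>k<d. B * ((real d * B * t) ^ n / fact n))"
      unfolding rate_eq[OF that(2,3)]
      by (intro order_trans[OF norm_sum] sum_mono) (auto simp only: norm_mult lessThan_iff intro!: mult_mono B(2) IH that B(1) norm_ge_zero)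
    then show ?thesis by simp
  qed
  {
    case 0
    { case 1 then show ?case by simp }
    { case 2 then show ?case by (intro rate) auto }
  next
    case (Suc n)
    have D: "norm (dyson_term d H (Suc n) t $$ (i, j)) \<le> (real d * B * t) ^ Suc n / fact (Suc n)"
      if ij: "i < d" "j < d" and t: "t \<in> {0..T}" for i j t
    proof -
      let ?g = "\<lambda>s. (real d * B * s) ^ Suc n / fact (Suc n)"
      have "((\<lambda>s. real d * B * ((real d * B * s) ^ n / fact n)) has_integral ?g t - ?g 0) {0..t}"
      proof (rule fundamental_theorem_of_calculus)
        fix s
        have "(?g has_real_derivative (1 + real n) * (real d * B * (real d * B * s) ^ n) / fact (Suc n)) (at s within {0..t})"
          by (intro DERIV_cdivide DERIV_power_Suc) (auto intro!: derivative_eq_intros)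
        also have "(1 + real n) * (real d * B * (real d * B * s) ^ n) / fact (Suc n) =
            real d * B * ((real d * B * s) ^ n / fact n)"
          by (simp add: divide_simps)
        finally show "(?g has_vector_derivative real d * B * ((real d * B * s) ^ n / fact n)) (at s within {0..t})"
          unfolding has_real_derivative_iff_has_vector_derivative .
      qed (use t in auto)
      then have g: "((\<lambda>s. real d * B * ((real d * B * s) ^ n / fact n)) has_integral ?g t) {0..t}" by simp
      have "norm (integral {0..t} (rate i j n)) \<le> integral {0..t} (\<lambda>s. real d * B * ((real d * B * s) ^ n / fact n))"
      proof (rule integral_norm_bound_integral)
        show "rate i j n integrable_on {0..t}"
          by (intro integrable_continuous_real continuous_on_subset[OF dyson_continuous(2)] ij) (use t in auto)
        show "(\<lambda>s. real d * B * ((real d * B * s) ^ n / fact n)) integrable_on {0..t}"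
          using g by (rule has_integral_integrable)
        show "norm (rate i j n s) \<le> real d * B * ((real d * B * s) ^ n / fact n)" if "s \<in> {0..t}" for s
          by (rule Suc.IH(2)) (use ij t that in auto)
      qed
      also have "\<dots> = ?g t" using g by (rule integral_unique)
      finally show ?thesis using ij by (simp add: rate_def[abs_def] norm_mult)
    qed
    { case 1 then show ?case by (rule D) }
    { case 2 then show ?case by (intro rate D) auto }
  }
qed

abbreviation U :: "real \<Rightarrow> complex mat" where "U \<equiv> time_ordered_exp d H"

lemma U_carrier [simp]: "U t \<in> carrier_mat d d"
  by (simp add: time_ordered_exp_def)

text \<open>The series may be differentiated term by term, as the derivatives are dominated,
  uniformly on \<open>{0..T}\<close>, by the terms of a convergent exponential series.\<close>

lemma U_deriv:
  assumes ij: "i < d" "j < d" and t: "t \<in> {0..T}"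
  shows "((\<lambda>t. U t $$ (i, j)) has_vector_derivative - \<i> * (H t * U t) $$ (i, j)) (at t within {0..T})"
proof -
  obtain B where B: "0 \<le> B" "\<And>s i j. s \<in> {0..T} \<Longrightarrow> i < d \<Longrightarrow> j < d \<Longrightarrow> norm (H s $$ (i, j)) \<le> B"
    using H_bound by blast
  define K where "K = real d * B"
  have K: "0 \<le> K" using B by (simp add: K_def)
  have mono: "(K * t) ^ n / fact n \<le> (K * T) ^ n / fact n" if "t \<in> {0..T}" for t n
    using K that by (intro divide_right_mono power_mono mult_left_mono mult_nonneg_nonneg) auto
  have exp_summable: "summable (\<lambda>n. (K * T) ^ n / fact n)"
    using summable_exp[of "K * T"] by (simp add: field_simps)
  have D_summable: "summable (\<lambda>n. dyson_term d H n t $$ (k, j))" if "k < d" "t \<in> {0..T}" for k t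
    by (rule summable_comparison_test'[OF exp_summable])
      (use dyson_bound(1)[OF B that(1) ij(2) that(2)] mono[OF that(2)] in \<open>auto simp: K_def[symmetric] intro: order_trans\<close>)
  \<comment> \<open>Derivative of the term of order \<open>n\<close>: differentiation lowers the
    order by one and kills the constant term of order \<open>0\<close>.\<close>
  define F where "F n t = (case n of 0 \<Rightarrow> 0 | Suc m \<Rightarrow> - \<i> * rate i j m t)" for n t
  define M where "M n = (case n of 0 \<Rightarrow> 0 | Suc m \<Rightarrow> K * ((K * T) ^ m / fact m))" for n
  have M: "summable M"
    by (subst summable_Suc_iff[symmetric]) (use summable_mult[OF exp_summable, of K] in \<open>simp add: M_def\<close>)
  have FM: "norm (F n t) \<le> M n" if "t \<in> {0..T}" for n t
  proof (cases n)
    case (Suc m)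
    have "norm (rate i j m t) \<le> K * ((K * t) ^ m / fact m)"
      using dyson_bound(2)[OF B ij that] by (simp add: K_def)
    also have "\<dots> \<le> K * ((K * T) ^ m / fact m)" by (intro mult_left_mono mono that K)
    finally show ?thesis by (simp add: F_def M_def Suc norm_mult)
  qed (simp add: F_def M_def)
  have unif: "uniform_limit {0..T} (\<lambda>n t. \<Sum>i<n. F i t) (\<lambda>t. suminf (\<lambda>i. F i t)) sequentially"
    by (rule Weierstrass_m_test[OF _ M]) (rule FM)
  have F_sum: "suminf (\<lambda>n. F n t) = - \<i> * (H t * U t) $$ (i, j)" if t: "t \<in> {0..T}" for t
  proof -
    have "(\<lambda>n. F (Suc n) t) sums (- \<i> * (\<Sum>k<d. H t $$ (i, k) * (suminf (\<lambda>n. dyson_term d H n t $$ (k, j)))))"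
      unfolding F_def nat.case rate_eq[OF ij]
      by (intro sums_mult sums_sum summable_sums D_summable t) auto
    then have "(\<lambda>n. F n t) sums (- \<i> * (\<Sum>k<d. H t $$ (i, k) * (suminf (\<lambda>n. dyson_term d H n t $$ (k, j)))))"
      by (subst (asm) sums_Suc_iff) (simp add: F_def)
    moreover have "(\<Sum>k<d. H t $$ (i, k) * (suminf (\<lambda>n. dyson_term d H n t $$ (k, j)))) = (H t * U t) $$ (i, j)"
      unfolding mult_mat_index[OF carrier_H U_carrier ij] using ij by (simp add: time_ordered_exp_def)
    ultimately show ?thesis by (simp add: sums_iff)
  qed
  have "\<exists>g. \<forall>x\<in>{0..T}. (\<lambda>n. dyson_term d H n x $$ (i, j)) sums (g x) \<and>
      (g has_derivative (\<lambda>h. h *\<^sub>R (suminf (\<lambda>n. F n x)))) (at x within {0..T})"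
  proof (rule has_derivative_series[where f' = "\<lambda>n x h. h *\<^sub>R F n x"])
    show "((\<lambda>t. dyson_term d H n t $$ (i, j)) has_derivative (\<lambda>h. h *\<^sub>R F n x)) (at x within {0..T})"
      if "x \<in> {0..T}" for n x
    proof (cases n)
      case (Suc m)
      then show ?thesis
        using dyson_deriv[OF ij that, of m] by (simp only: F_def has_vector_derivative_def nat.case)
    qed (simp add: F_def)
    show "(\<lambda>n. dyson_term d H n t $$ (i, j)) sums suminf (\<lambda>n. dyson_term d H n t $$ (i, j))"
      by (rule summable_sums[OF D_summable[OF ij(1) t]])
    fix e :: real assume e: "0 < e"
    show "\<forall>\<^sub>F n in sequentially. \<forall>x\<in>{0..T}. \<forall>h. norm ((\<Sum>i<n. h *\<^sub>R F i x) - h *\<^sub>R (suminf (\<lambda>n. F n x))) \<le> e * norm h"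
      using uniform_limitD[OF unif e]
    proof eventually_elim
      case (elim n)
      show ?case
      proof (intro ballI allI)
        fix x h assume x: "x \<in> {0..T}"
        have "norm ((\<Sum>i<n. h *\<^sub>R F i x) - h *\<^sub>R (suminf (\<lambda>n. F n x))) = \<bar>h\<bar> * dist (\<Sum>i<n. F i x) (suminf (\<lambda>n. F n x))"
          by (simp add: dist_norm scaleR_sum_right[symmetric] scaleR_diff_right[symmetric] del: scaleR_conv_of_real)
        also have "\<dots> \<le> \<bar>h\<bar> * e" using elim x by (intro mult_left_mono) (auto simp: less_imp_le)
        finally show "norm ((\<Sum>i<n. h *\<^sub>R F i x) - h *\<^sub>R (suminf (\<lambda>n. F n x))) \<le> e * norm h" by (simp add: mult.commute)
      qed
    qed
  qed (use t in auto)
  then obtain g where g: "\<And>x. x \<in> {0..T} \<Longrightarrow> (\<lambda>n. dyson_term d H n x $$ (i, j)) sums g x"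
      "\<And>x. x \<in> {0..T} \<Longrightarrow> (g has_derivative (\<lambda>h. h *\<^sub>R (suminf (\<lambda>n. F n x)))) (at x within {0..T})"
    by blast
  have gU: "g x = U x $$ (i, j)" if "x \<in> {0..T}" for x
    using g(1)[OF that] ij by (simp add: time_ordered_exp_def sums_iff)
  have "(g has_vector_derivative - \<i> * (H t * U t) $$ (i, j)) (at t within {0..T})"
    using g(2)[OF t] by (simp only: has_vector_derivative_def F_sum[OF t])
  then show ?thesis
    by (rule has_vector_derivative_transform[OF t, rotated]) (simp add: gU)
qed

lemma U_0: "U 0 = 1\<^sub>m d"
proof (rule eq_matI)
  fix i j assume ij: "i < dim_row (1\<^sub>m d)" "j < dim_col (1\<^sub>m d)"
  have "suminf (\<lambda>n. dyson_term d H n 0 $$ (i, j)) = (\<Sum>n\<in>{0}. dyson_term d H n 0 $$ (i, j))"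
  proof (rule suminf_finite)
    fix n :: nat assume "n \<notin> {0}"
    then obtain m where "n = Suc m" by (cases n) auto
    then show "dyson_term d H n 0 $$ (i, j) = 0" using ij dyson_0 by simp
  qed simp
  then show "U 0 $$ (i, j) = 1\<^sub>m d $$ (i, j)" using ij by (simp add: time_ordered_exp_def)
qed (simp_all add: time_ordered_exp_def)

end

section \<open>Constant Hamiltonians\<close>

lemma smult_pow_mat:
  fixes A :: "'a::comm_ring_1 mat"
  assumes A: "A \<in> carrier_mat d d"
  shows "(c \<cdot>\<^sub>m A) ^\<^sub>m n = c ^ n \<cdot>\<^sub>m (A ^\<^sub>m n)"
proof (induction n)
  case (Suc n)
  have P: "A ^\<^sub>m n \<in> carrier_mat d d" using A by simp
  have "(c \<cdot>\<^sub>m A) ^\<^sub>m Suc n = (c ^ n \<cdot>\<^sub>m (A ^\<^sub>m n)) * (c \<cdot>\<^sub>m A)" by (simp add: Suc)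
  also have "\<dots> = (c * c ^ n) \<cdot>\<^sub>m ((A ^\<^sub>m n) * A)"
    using A P by (intro eq_matI) (auto simp: scalar_prod_def sum_distrib_left mult_ac)
  finally show ?case by simp
qed (use A in auto)

lemma pow_mat_commute:
  fixes A :: "'a::comm_ring_1 mat"
  assumes A: "A \<in> carrier_mat d d"
  shows "A * A ^\<^sub>m n = A ^\<^sub>m Suc n"
proof (induction n)
  case (Suc n)
  have "A * A ^\<^sub>m Suc n = (A * A ^\<^sub>m n) * A" using A by (simp add: assoc_mult_mat[of _ d d _ d _ d])
  then show ?case by (simp add: Suc)
qed (use A in auto)

lemma dyson_term_const:
  assumes A: "A \<in> carrier_mat d d" and t: "0 \<le> t" and ij: "i < d" "j < d"
  shows "dyson_term d (\<lambda>_. A) n t $$ (i, j) = (- \<i> * of_real t) ^ n / fact n * (A ^\<^sub>m n) $$ (i, j)"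
  using t ij
proof (induction n arbitrary: t i j)
  case (Suc n)
  let ?g = "\<lambda>s::real. (- \<i> * of_real s) ^ Suc n / fact (Suc n) :: complex"
  interpret D: dyson d "\<lambda>_. A" t using A Suc.prems by unfold_locales auto
  have eq: "(A * dyson_term d (\<lambda>_. A) n s) $$ (i, j) = (- \<i> * of_real s) ^ n / fact n * (A ^\<^sub>m Suc n) $$ (i, j)"
    if s: "0 \<le> s" for s
  proof -
    have "(A * dyson_term d (\<lambda>_. A) n s) $$ (i, j) =
        (\<Sum>k<d. A $$ (i, k) * ((- \<i> * of_real s) ^ n / fact n * (A ^\<^sub>m n) $$ (k, j)))"
      using Suc.IH[OF s] Suc.prems by (subst mult_mat_index[OF A D.dyson_carrier]) (auto intro!: sum.cong)
    also have "\<dots> = (- \<i> * of_real s) ^ n / fact n * (A * A ^\<^sub>m n) $$ (i, j)"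
      using A Suc.prems by (subst mult_mat_index[OF A, of _ d]) (auto simp: sum_distrib_left mult_ac)
    finally show ?thesis using pow_mat_commute[OF A] by simp
  qed
  have "((\<lambda>s. - \<i> * ((- \<i> * of_real s) ^ n / fact n)) has_integral ?g t - ?g 0) {0..t}"
  proof (rule fundamental_theorem_of_calculus)
    fix s
    have "((\<lambda>z. (- \<i> * z) ^ Suc n / fact (Suc n)) has_field_derivative
        (1 + of_nat n) * (- \<i> * (- \<i> * of_real s) ^ n) / fact (Suc n)) (at (of_real s))"
      by (intro DERIV_cdivide DERIV_power_Suc) (auto intro!: derivative_eq_intros)
    also have "(1 + of_nat n) * (- \<i> * (- \<i> * of_real s) ^ n) / fact (Suc n) = - \<i> * ((- \<i> * of_real s) ^ n / fact n)"
    proof -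
      have "(1 + of_nat n :: complex) \<noteq> 0" by (metis of_nat_Suc of_nat_neq_0)
      then show ?thesis by (simp add: divide_simps)
    qed
    finally show "(?g has_vector_derivative - \<i> * ((- \<i> * of_real s) ^ n / fact n)) (at s within {0..t})"
      by (rule has_vector_derivative_real_field)
  qed (use Suc.prems in auto)
  then have "((\<lambda>s. - \<i> * ((- \<i> * of_real s) ^ n / fact n)) has_integral ?g t) {0..t}" by simp
  then have "((\<lambda>s. - \<i> * ((- \<i> * of_real s) ^ n / fact n) * (A ^\<^sub>m Suc n) $$ (i, j)) has_integral ?g t * (A ^\<^sub>m Suc n) $$ (i, j)) {0..t}"
    by (rule has_integral_mult_left)
  then have "((\<lambda>s. - \<i> * (A * dyson_term d (\<lambda>_. A) n s) $$ (i, j)) has_integral ?g t * (A ^\<^sub>m Suc n) $$ (i, j)) {0..t}"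
    by (rule has_integral_eq[rotated]) (simp add: eq mult.assoc del: pow_mat.simps)
  then have "integral {0..t} (\<lambda>s. - \<i> * (A * dyson_term d (\<lambda>_. A) n s) $$ (i, j)) = ?g t * (A ^\<^sub>m Suc n) $$ (i, j)"
    by (rule integral_unique)
  then show ?case using Suc.prems by (simp del: pow_mat.simps fact_Suc power_Suc)
qed (use A in \<open>auto simp: one_mat_def\<close>)

text \<open>For a constant Hamiltonian the nested integrals give powers of \<open>t\<close> over
  factorials, so the Dyson series is the exponential series. The differential equation for matrix
  exponentials thereby becomes a case of \<open>U_deriv\<close>.\<close>

lemma mat_exp_eq_time_ordered_exp:
  assumes A: "A \<in> carrier_mat d d" and t: "0 \<le> t"
  shows "mat_exp d ((- \<i> * complex_of_real t) \<cdot>\<^sub>m A) = time_ordered_exp d (\<lambda>_. A) t"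
proof -
  have "(((- \<i> * complex_of_real t) \<cdot>\<^sub>m A) ^\<^sub>m n) $$ (i, j) / fact n = dyson_term d (\<lambda>_. A) n t $$ (i, j)"
    if "i < d" "j < d" for i j n
    unfolding dyson_term_const[OF A t that] smult_pow_mat[OF A] using A that by simp
  then show ?thesis
    unfolding mat_exp_def time_ordered_exp_def by (intro cong_mat) auto
qed

section \<open>Hermitian matrices as generators of skew flows\<close>

lemma dim_mat_adjoint [simp]: "dim_row (mat_adjoint A) = dim_col A" "dim_col (mat_adjoint A) = dim_row A"
  by (simp_all add: mat_adjoint_def)

lemma mat_adjoint_carrier [simp]: "A \<in> carrier_mat n m \<Longrightarrow> mat_adjoint A \<in> carrier_mat m n"
  by (auto intro: carrier_matI)

lemma mat_adjoint_index [simp]: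
  "i < dim_col A \<Longrightarrow> j < dim_row A \<Longrightarrow> mat_adjoint A $$ (i, j) = conjugate (A $$ (j, i))"
  by (simp add: mat_adjoint_def mat_of_rows_def)

lemma cscalar_prod_sum:
  fixes v w :: "complex vec"
  shows "v \<in> carrier_vec d \<Longrightarrow> w \<in> carrier_vec d \<Longrightarrow> v \<bullet>c w = (\<Sum>i<d. v $ i * cnj (w $ i))"
  by (simp add: scalar_prod_def lessThan_atLeast0)

lemma cscalar_prod_commute:
  fixes v w :: "complex vec"
  assumes "v \<in> carrier_vec d" "w \<in> carrier_vec d"
  shows "v \<bullet>c w = cnj (w \<bullet>c v)"
  unfolding cscalar_prod_sum[OF assms] cscalar_prod_sum[OF assms(2,1)] by (simp add: mult.commute)

lemma cscalar_prod_adjoint: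
  fixes A :: "complex mat"
  assumes A: "A \<in> carrier_mat n m" and v: "v \<in> carrier_vec m" and w: "w \<in> carrier_vec n"
  shows "(A *\<^sub>v v) \<bullet>c w = v \<bullet>c (mat_adjoint A *\<^sub>v w)"
proof -
  have "(A *\<^sub>v v) \<bullet>c w = (\<Sum>i<n. (\<Sum>j<m. A $$ (i, j) * v $ j) * cnj (w $ i))"
    unfolding cscalar_prod_sum[OF mult_mat_vec_carrier[OF A v] w]
    by (intro sum.cong refl) (simp only: mult_mat_vec_index[OF A v] lessThan_iff)
  also have "\<dots> = (\<Sum>i<n. \<Sum>j<m. v $ j * cnj (cnj (A $$ (i, j)) * w $ i))"
    by (simp add: sum_distrib_right sum_distrib_left mult_ac)
  also have "\<dots> = (\<Sum>j<m. \<Sum>i<n. v $ j * cnj (cnj (A $$ (i, j)) * w $ i))" by (rule sum.swap)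
  also have "\<dots> = (\<Sum>j<m. v $ j * cnj ((mat_adjoint A *\<^sub>v w) $ j))"
    using A w by (intro sum.cong refl, subst mult_mat_vec_index[of _ m n]) (auto simp: sum_distrib_left)
  also have "\<dots> = v \<bullet>c (mat_adjoint A *\<^sub>v w)"
    by (rule cscalar_prod_sum[OF v mult_mat_vec_carrier[OF mat_adjoint_carrier[OF A] w], symmetric])
  finally show ?thesis .
qed

lemma hilbert_norm_square: "(hilbert_norm v)\<^sup>2 = (\<Sum>i<dim_vec v. (cmod (v $ i))\<^sup>2)"
proof -
  have "v \<bullet>c v = (\<Sum>i<dim_vec v. complex_of_real ((cmod (v $ i))\<^sup>2))"
    unfolding cscalar_prod_sum[OF carrier_vecI[OF refl] carrier_vecI[OF refl]]
    by (intro sum.cong refl) (rule complex_norm_square[symmetric])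
  then have "Re (v \<bullet>c v) = (\<Sum>i<dim_vec v. (cmod (v $ i))\<^sup>2)" by simp
  then show ?thesis unfolding hilbert_norm_def by (simp add: sum_nonneg)
qed

lemma hilbert_norm_nonneg [simp]: "0 \<le> hilbert_norm v"
  by (simp add: norm_embed_vec[symmetric])

lemma hilbert_norm_smult: "hilbert_norm (c \<cdot>\<^sub>v v) = cmod c * hilbert_norm v"
proof -
  have "(hilbert_norm (c \<cdot>\<^sub>v v))\<^sup>2 = (cmod c * hilbert_norm v)\<^sup>2"
    by (simp add: hilbert_norm_square norm_mult power_mult_distrib sum_distrib_left)
  then show ?thesis by (rule power2_eq_imp_eq) simp_all
qed

lemma hilbert_norm_zero_iff: "v \<in> carrier_vec d \<Longrightarrow> hilbert_norm v = 0 \<longleftrightarrow> v = 0\<^sub>v d"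
proof
  assume v: "v \<in> carrier_vec d" and "hilbert_norm v = 0"
  then have "embed_vec v = 0" by (simp add: norm_embed_vec[symmetric])
  then have "v = coord_vec d 0" using coord_embed_vec[OF v] by simp
  then show "v = 0\<^sub>v d" by (auto simp: coord_vec_def)
next
  assume "v = 0\<^sub>v d"
  then have "(hilbert_norm v)\<^sup>2 = 0" by (simp add: hilbert_norm_square)
  then show "hilbert_norm v = 0" by simp
qed

text \<open>The supremum runs over unit vectors, so a nonzero vector is normalised and the zero
  vector is treated apart.\<close>

lemma operator_norm_bound:
  assumes A: "A \<in> carrier_mat d d" and C: "operator_norm d A \<le> ennreal C" "0 \<le> C" and v: "v \<in> carrier_vec d"
  shows "hilbert_norm (A *\<^sub>v v) \<le> C * hilbert_norm v"
proof (cases "hilbert_norm v = 0")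
  case True
  then have "v = 0\<^sub>v d" using hilbert_norm_zero_iff[OF v] by simp
  then have "A *\<^sub>v v = 0\<^sub>v d" using A by (intro eq_vecI) auto
  then show ?thesis using hilbert_norm_zero_iff[of "0\<^sub>v d" d] True by simp
next
  case False
  define r where "r = hilbert_norm v"
  have r: "0 < r" using False hilbert_norm_nonneg[of v] unfolding r_def by linarith
  define u where "u = complex_of_real (1 / r) \<cdot>\<^sub>v v"
  have u: "u \<in> carrier_vec d" "hilbert_norm u = 1"
    using v r by (simp_all add: u_def hilbert_norm_smult norm_divide r_def)
  have "ennreal (hilbert_norm (A *\<^sub>v u)) \<le> operator_norm d A"
    unfolding operator_norm_def using u by (intro SUP_upper) auto
  then have "ennreal (hilbert_norm (A *\<^sub>v u)) \<le> ennreal C" using C(1) by (rule order_trans)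
  then have "hilbert_norm (A *\<^sub>v u) \<le> C" using C(2) by simp
  moreover have "A *\<^sub>v u = complex_of_real (1 / r) \<cdot>\<^sub>v (A *\<^sub>v v)"
    unfolding u_def using A v by (rule mult_mat_vec)
  ultimately have "hilbert_norm (A *\<^sub>v v) / r \<le> C" using r by (simp add: hilbert_norm_smult norm_divide)
  then show ?thesis using r by (simp add: r_def[symmetric] divide_le_eq)
qed

definition mat_act :: "nat \<Rightarrow> complex mat \<Rightarrow> (nat \<Rightarrow>\<^sub>0 complex) \<Rightarrow> nat \<Rightarrow>\<^sub>0 complex" where
  "mat_act d A x = embed_vec (A *\<^sub>v coord_vec d x)"

lemma linear_mat_act:
  assumes A: "A \<in> carrier_mat d d"
  shows "linear (mat_act d A)"
proof (rule linearI)
  fix x y r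
  have c: "A *\<^sub>v coord_vec d x \<in> carrier_vec d" "A *\<^sub>v coord_vec d y \<in> carrier_vec d" using A by auto
  show "mat_act d A (x + y) = mat_act d A x + mat_act d A y"
    using A by (simp add: mat_act_def coord_vec_add mult_add_distrib_mat_vec[of _ d d] embed_vec_add[OF c])
  show "mat_act d A (r *\<^sub>R x) = r *\<^sub>R mat_act d A x"
    using A by (simp add: mat_act_def coord_vec_scaleR mult_mat_vec[of _ d d] embed_vec_scaleR)
qed

text \<open>By self-adjointness the quadratic form equals its own conjugate.\<close>

lemma hermitian_real_quadratic_form:
  assumes H: "hermitian_op d H" and v: "v \<in> carrier_vec d"
  shows "Im ((H *\<^sub>v v) \<bullet>c v) = 0"
proof -
  have A: "H \<in> carrier_mat d d" "mat_adjoint H = H" using H by (simp_all add: hermitian_op_def)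
  have Hv: "H *\<^sub>v v \<in> carrier_vec d" using A v by simp
  have "(H *\<^sub>v v) \<bullet>c v = v \<bullet>c (H *\<^sub>v v)" using cscalar_prod_adjoint[OF A(1) v v] A(2) by simp
  also have "\<dots> = cnj ((H *\<^sub>v v) \<bullet>c v)" by (rule cscalar_prod_commute[OF v Hv])
  finally have "Im ((H *\<^sub>v v) \<bullet>c v) = Im (cnj ((H *\<^sub>v v) \<bullet>c v))" by simp
  then show ?thesis by simp
qed

lemma smult_mat_mult_vec:
  fixes A :: "'a::comm_ring_1 mat"
  shows "A \<in> carrier_mat n m \<Longrightarrow> v \<in> carrier_vec m \<Longrightarrow> (c \<cdot>\<^sub>m A) *\<^sub>v v = c \<cdot>\<^sub>v (A *\<^sub>v v)"
  by (intro eq_vecI) (auto simp: scalar_prod_def sum_distrib_left mult_ac)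

lemma (in dyson) U_vec_deriv:
  assumes y: "y \<in> carrier_vec d" and t: "t \<in> {0..T}"
  shows "((\<lambda>t. embed_vec (U t *\<^sub>v y)) has_vector_derivative mat_act d (- \<i> \<cdot>\<^sub>m H t) (embed_vec (U t *\<^sub>v y)))
    (at t within {0..T})"
proof -
  have Uy: "U s *\<^sub>v y \<in> carrier_vec d" for s using y mult_mat_vec_carrier[OF U_carrier] by blast
  show ?thesis
    unfolding mat_act_def coord_embed_vec[OF Uy]
  proof (rule has_vector_derivative_embed_vec)
    show "U t *\<^sub>v y \<in> carrier_vec d" for t by (rule Uy)
    show "- \<i> \<cdot>\<^sub>m H t *\<^sub>v (U t *\<^sub>v y) \<in> carrier_vec d"
      by (rule mult_mat_vec_carrier[OF _ Uy]) (simp add: carrier_H)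
    fix i assume i: "i < d"
    have "(- \<i> \<cdot>\<^sub>m H t *\<^sub>v (U t *\<^sub>v y)) $ i = - \<i> * ((H t * U t) *\<^sub>v y) $ i"
      using carrier_H[of t] Uy[of t] i y
      by (simp add: smult_mat_mult_vec[of _ d d] assoc_mult_mat_vec[of _ d d _ d] del: index_mult_mat_vec)
    also have "\<dots> = (\<Sum>k<d. - \<i> * (H t * U t) $$ (i, k) * y $ k)"
      using carrier_H[of t] y i by (subst mult_mat_vec_index[of _ d d]) (auto simp: sum_distrib_left mult.assoc simp del: index_mult_mat)
    finally have eq: "(- \<i> \<cdot>\<^sub>m H t *\<^sub>v (U t *\<^sub>v y)) $ i = (\<Sum>k<d. - \<i> * (H t * U t) $$ (i, k) * y $ k)" .
    have "((\<lambda>t. \<Sum>k<d. U t $$ (i, k) * y $ k) has_vector_derivative (\<Sum>k<d. - \<i> * (H t * U t) $$ (i, k) * y $ k))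
        (at t within {0..T})"
      by (intro has_vector_derivative_sum has_vector_derivative_mult_left U_deriv i t) auto
    then show "((\<lambda>t. (U t *\<^sub>v y) $ i) has_vector_derivative (- \<i> \<cdot>\<^sub>m H t *\<^sub>v (U t *\<^sub>v y)) $ i) (at t within {0..T})"
      unfolding eq mult_mat_vec_index[OF U_carrier y i] .
  qed
qed

text \<open>Coordinates from \<open>d\<close> on are left fixed, so that the flow is isometric on the whole space.\<close>

definition hamiltonian_flow :: "nat \<Rightarrow> complex mat \<Rightarrow> real \<Rightarrow> (nat \<Rightarrow>\<^sub>0 complex) \<Rightarrow> nat \<Rightarrow>\<^sub>0 complex" where
  "hamiltonian_flow d H t x =
     x - embed_vec (coord_vec d x) + mat_act d (mat_exp d ((- \<i> * complex_of_real t) \<cdot>\<^sub>m H)) x"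

lemma mat_exp_carrier [simp]: "mat_exp d A \<in> carrier_mat d d"
  by (simp add: mat_exp_def)

lemma hamiltonian_flow_embed:
  "v \<in> carrier_vec d \<Longrightarrow> hamiltonian_flow d H t (embed_vec v) =
    embed_vec (mat_exp d ((- \<i> * complex_of_real t) \<cdot>\<^sub>m H) *\<^sub>v v)"
  by (simp add: hamiltonian_flow_def mat_act_def)

text \<open>Since \<open>Re (- \<i> * z) = Im z\<close>, skewness amounts to the quadratic form of a
  Hermitian matrix being real. The flow is a constant vector plus a solution of the Dyson equation
  for the constant Hamiltonian.\<close>

lemma skew_flow_hamiltonian:
  assumes H: "hermitian_op d H" and C: "operator_norm d H \<le> ennreal C" "0 < C"
  shows "skew_flow (mat_act d (- \<i> \<cdot>\<^sub>m H)) C (hamiltonian_flow d H)"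
proof (rule skew_flow.intro)
  have A: "H \<in> carrier_mat d d" using H by (simp add: hermitian_op_def)
  have A': "- \<i> \<cdot>\<^sub>m H \<in> carrier_mat d d" using A by simp
  show "linear (mat_act d (- \<i> \<cdot>\<^sub>m H))" by (rule linear_mat_act[OF A'])
  fix x
  let ?y = "coord_vec d x"
  have Hy: "H *\<^sub>v ?y \<in> carrier_vec d" by (rule mult_mat_vec_carrier[OF A]) simp
  have eq: "mat_act d (- \<i> \<cdot>\<^sub>m H) x = embed_vec (- \<i> \<cdot>\<^sub>v (H *\<^sub>v ?y))"
    unfolding mat_act_def by (subst smult_mat_mult_vec[OF A]) simp_all
  have c: "- \<i> \<cdot>\<^sub>v (H *\<^sub>v ?y) \<in> carrier_vec d" using Hy by simp
  have "inner (mat_act d (- \<i> \<cdot>\<^sub>m H) x) x = Re ((- \<i> \<cdot>\<^sub>v (H *\<^sub>v ?y)) \<bullet>c ?y)"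
    unfolding eq inner_embed_coord_vec[OF c, of x] by (rule inner_embed_vec[OF c]) simp
  also have "(- \<i> \<cdot>\<^sub>v (H *\<^sub>v ?y)) \<bullet>c ?y = - \<i> * ((H *\<^sub>v ?y) \<bullet>c ?y)"
    using Hy A by (intro scalar_prod_smult_left) simp
  also have "Re (- \<i> * ((H *\<^sub>v ?y) \<bullet>c ?y)) = Im ((H *\<^sub>v ?y) \<bullet>c ?y)" by simp
  also have "\<dots> = 0" by (rule hermitian_real_quadratic_form[OF H]) simp
  finally show "inner (mat_act d (- \<i> \<cdot>\<^sub>m H) x) x = 0" .
  have "norm (mat_act d (- \<i> \<cdot>\<^sub>m H) x) = hilbert_norm (H *\<^sub>v ?y)"
    by (simp add: eq norm_embed_vec hilbert_norm_smult)
  also have "\<dots> \<le> C * norm (embed_vec ?y)"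
    unfolding norm_embed_vec by (rule operator_norm_bound[OF A C(1)]) (use C in auto)
  also have "\<dots> \<le> C * norm x" using C by (intro mult_left_mono norm_embed_coord_vec_le) simp
  finally show "norm (mat_act d (- \<i> \<cdot>\<^sub>m H) x) \<le> C * norm x" .
  show "0 < C" by fact
  interpret D0: dyson d "\<lambda>_. H" 0 using A by unfold_locales auto
  show "hamiltonian_flow d H 0 x = x"
    unfolding hamiltonian_flow_def mat_act_def mat_exp_eq_time_ordered_exp[OF A order_refl] D0.U_0 by simp
  fix t :: real assume t: "0 \<le> t"
  \<comment> \<open>The Dyson series is treated on a bounded interval. Ending it at
    \<open>t + 1\<close> leaves room to the right of \<open>t\<close>, so that the derivative within
    it is the one within the half-line.\<close>
  interpret D: dyson d "\<lambda>_. H" "t + 1" using A t by unfold_locales auto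
  have Uy: "D.U t *\<^sub>v ?y \<in> carrier_vec d" by (rule mult_mat_vec_carrier[OF D.U_carrier]) simp
  have flow: "hamiltonian_flow d H s x = x - embed_vec ?y + embed_vec (D.U s *\<^sub>v ?y)" if "0 \<le> s" for s
    unfolding hamiltonian_flow_def mat_act_def mat_exp_eq_time_ordered_exp[OF A that] ..
  have coord: "coord_vec d (hamiltonian_flow d H t x) = D.U t *\<^sub>v ?y"
  proof -
    have "coord_vec d (hamiltonian_flow d H t x) = coord_vec d (x - embed_vec ?y) + coord_vec d (embed_vec (D.U t *\<^sub>v ?y))"
      unfolding hamiltonian_flow_def mat_act_def mat_exp_eq_time_ordered_exp[OF A t] by (rule coord_vec_add)
    also have "coord_vec d (x - embed_vec ?y) = 0\<^sub>v d"
      by (intro eq_vecI) (auto simp: coord_vec_def lookup_minus lookup_embed_vec)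
    finally show ?thesis using Uy by simp
  qed
  have "((\<lambda>s. x - embed_vec ?y + embed_vec (D.U s *\<^sub>v ?y)) has_vector_derivative
      0 + mat_act d (- \<i> \<cdot>\<^sub>m H) (embed_vec (D.U t *\<^sub>v ?y))) (at t within {0..t + 1})"
    by (intro has_vector_derivative_add has_vector_derivative_const D.U_vec_deriv) (use t in auto)
  then have "((\<lambda>s. x - embed_vec ?y + embed_vec (D.U s *\<^sub>v ?y)) has_vector_derivative
      mat_act d (- \<i> \<cdot>\<^sub>m H) (hamiltonian_flow d H t x)) (at t within {0..t + 1})"
    by (simp add: mat_act_def coord coord_embed_vec[OF Uy])
  then have "((\<lambda>s. hamiltonian_flow d H s x) has_vector_derivative
      mat_act d (- \<i> \<cdot>\<^sub>m H) (hamiltonian_flow d H t x)) (at t within {0..t + 1})"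
    by (rule has_vector_derivative_transform[rotated 2]) (use t flow in auto)
  moreover have "at t within {0..t + 1} = at t within {0..}"
    by (rule at_within_nhd[of _ "{..<t + 1}"]) auto
  ultimately show "((\<lambda>s. hamiltonian_flow d H s x) has_vector_derivative
      mat_act d (- \<i> \<cdot>\<^sub>m H) (hamiltonian_flow d H t x)) (at t within {0..})" by simp
qed

lemma total_hamiltonian_carrier [simp]: "total_hamiltonian d Q Hs w t \<in> carrier_mat d d"
  by (simp add: total_hamiltonian_def)

lemma mat_act_total_hamiltonian:
  assumes Hs: "\<And>k. k \<in> {1..Q} \<Longrightarrow> Hs k \<in> carrier_mat d d"
  shows "mat_act d (- \<i> \<cdot>\<^sub>m total_hamiltonian d Q Hs w t) x =
    (\<Sum>k=1..Q. w k t *\<^sub>R mat_act d (- \<i> \<cdot>\<^sub>m Hs k) x)"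
proof (rule poly_mapping_eqI)
  note [simp del] = One_nat_def
  fix i
  let ?y = "coord_vec d x" and ?A = "total_hamiltonian d Q Hs w t"
  have lk: "Poly_Mapping.lookup (mat_act d (- \<i> \<cdot>\<^sub>m B) x) i =
      (if i < d then \<Sum>j<d. - \<i> * B $$ (i, j) * ?y $ j else 0)" if B: "B \<in> carrier_mat d d" for B
    using B unfolding mat_act_def lookup_embed_vec
    by (simp add: mult_mat_vec_index[of _ d d] del: index_mult_mat_vec)
  show "Poly_Mapping.lookup (mat_act d (- \<i> \<cdot>\<^sub>m ?A) x) i =
      Poly_Mapping.lookup (\<Sum>k=1..Q. w k t *\<^sub>R mat_act d (- \<i> \<cdot>\<^sub>m Hs k) x) i"
  proof (cases "i < d")
    case True
    have "(\<Sum>j<d. - \<i> * ?A $$ (i, j) * ?y $ j) = (\<Sum>j<d. \<Sum>k=1..Q. w k t *\<^sub>R (- \<i> * Hs k $$ (i, j) * ?y $ j))"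
      using True by (intro sum.cong refl) (simp add: total_hamiltonian_def sum_distrib_left sum_distrib_right scaleR_conv_of_real mult_ac)
    also have "\<dots> = (\<Sum>k=1..Q. \<Sum>j<d. w k t *\<^sub>R (- \<i> * Hs k $$ (i, j) * ?y $ j))" by (rule sum.swap)
    also have "\<dots> = (\<Sum>k=1..Q. w k t *\<^sub>R Poly_Mapping.lookup (mat_act d (- \<i> \<cdot>\<^sub>m Hs k) x) i)"
      using True Hs by (intro sum.cong refl) (simp only: lk if_True scaleR_sum_right)
    finally show ?thesis using True by (simp only: lk[OF total_hamiltonian_carrier] if_True lookup_sum lookup_scaleR)
  next
    case False
    then have "w k t *\<^sub>R Poly_Mapping.lookup (mat_act d (- \<i> \<cdot>\<^sub>m Hs k) x) i = 0" if "k \<in> {1..Q}" for k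
      using lk[OF Hs[OF that]] by simp
    then have "(\<Sum>k=1..Q. w k t *\<^sub>R Poly_Mapping.lookup (mat_act d (- \<i> \<cdot>\<^sub>m Hs k) x) i) = 0"
      by (rule sum.neutral[rule_format])
    then show ?thesis using False by (simp only: lk[OF total_hamiltonian_carrier] if_False lookup_sum lookup_scaleR)
  qed
qed

section \<open>Trace norm, channels and fidelity\<close>

definition mat_trace :: "complex mat \<Rightarrow> complex" where
  "mat_trace A = (\<Sum>i<dim_row A. A $$ (i, i))"

lemma mat_trace_comm:
  assumes "A \<in> carrier_mat n m" "B \<in> carrier_mat m n"
  shows "mat_trace (A * B) = mat_trace (B * A)"
proof -
  have "mat_trace (A * B) = (\<Sum>i<n. \<Sum>k<m. A $$ (i, k) * B $$ (k, i))"
    unfolding mat_trace_def using assms by (intro sum.cong) (auto simp: mult_mat_index[OF assms] simp del: index_mult_mat(1))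
  also have "\<dots> = (\<Sum>k<m. \<Sum>i<n. A $$ (i, k) * B $$ (k, i))" by (rule sum.swap)
  also have "\<dots> = mat_trace (B * A)"
    unfolding mat_trace_def using assms
    by (intro sum.cong) (auto simp: mult_mat_index[OF assms(2,1)] mult.commute simp del: index_mult_mat(1))
  finally show ?thesis .
qed

text \<open>The trace is invariant under similarity, and the Schur form carries the eigenvalues,
  with multiplicity, on its diagonal.\<close>

lemma mat_trace_eq_sum_eigenvalues:
  assumes A: "A \<in> carrier_mat d d"
  obtains es where "char_poly A = (\<Prod>a\<leftarrow>es. [:- a, 1:])" "mat_trace A = sum_list es"
proof -
  obtain es where es: "char_poly A = (\<Prod>a\<leftarrow>es. [:- a, 1:])"
    using char_poly_factorized[OF A] by blast
  obtain B P R where sd: "schur_decomposition A es = (B, P, R)" by (cases "schur_decomposition A es") auto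
  from schur_decomposition[OF A es sd]
  have sim: "similar_mat_wit A B P R" and diag: "diag_mat B = es" by auto
  note w = similar_mat_witD2[OF A sim]
  have "mat_trace A = mat_trace (P * (B * R))"
    using w by (simp add: assoc_mult_mat[of _ d d _ d _ d])
  also have "\<dots> = mat_trace ((B * R) * P)" by (rule mat_trace_comm) (use w in auto)
  also have "(B * R) * P = B"
    using w by (simp add: assoc_mult_mat[of _ d d _ d _ d])
  also have "mat_trace B = sum_list (diag_mat B)"
    using w by (simp add: mat_trace_def diag_mat_def interv_sum_list_conv_sum_set_nat lessThan_atLeast0)
  finally show ?thesis using that[OF es] diag by simp
qed

lemma order_linear_factors:
  fixes es :: "complex list"
  shows "Polynomial.order x (\<Prod>a\<leftarrow>es. [:- a, 1:]) = count_list es x"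
proof (induction es)
  case (Cons a es)
  have nz: "(\<Prod>a\<leftarrow>es. [:- a, 1:]) \<noteq> 0" by (auto simp: prod_list_zero_iff)
  have nz': "[:- a, 1:] * (\<Prod>a\<leftarrow>es. [:- a, 1:]) \<noteq> 0" using nz by (intro no_zero_divisors) auto
  have "Polynomial.order x ([:- a, 1:] * (\<Prod>a\<leftarrow>es. [:- a, 1:])) =
      Polynomial.order x [:- a, 1:] + count_list es x"
    by (simp only: order_mult[OF nz'] Cons.IH)
  moreover have "Polynomial.order x [:- a, 1:] = (if a = x then 1 else 0)"
  proof (cases "a = x")
    case True
    then show ?thesis using order_power_n_n[of x 1] by simp
  next
    case False
    then show ?thesis by (simp add: order_0I)
  qed
  ultimately show ?case by simp
qed simp

text \<open>Turns a sum over distinct eigenvalues weighted by multiplicity, as in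
  \<open>trace_norm\<close>, into a sum over a list with repetitions.\<close>

lemma sum_eigenvalues:
  fixes f :: "complex \<Rightarrow> real"
  assumes A: "A \<in> carrier_mat d d" and es: "char_poly A = (\<Prod>a\<leftarrow>es. [:- a, 1:])"
  shows "(\<Sum>x | eigenvalue A x. real (Polynomial.order x (char_poly A)) * f x) = (\<Sum>a\<leftarrow>es. f a)"
    and "eigenvalue A x \<longleftrightarrow> x \<in> set es"
proof -
  have ev: "eigenvalue A x \<longleftrightarrow> x \<in> set es" for x
    unfolding eigenvalue_root_char_poly[OF A] es by (simp add: poly_prod_list prod_list_zero_iff o_def image_iff)
  have "(\<Sum>x | eigenvalue A x. real (Polynomial.order x (char_poly A)) * f x) =
      (\<Sum>x\<in>set es. real (count_list es x) * f x)"
    unfolding es order_linear_factors ev by simp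
  also have "\<dots> = (\<Sum>a\<leftarrow>es. f a)"
  proof (induction es)
    case (Cons a es)
    have "(\<Sum>x\<in>set (a # es). real (count_list (a # es) x) * f x) =
        (\<Sum>x\<in>insert a (set es). real (count_list es x) * f x + (if x = a then f a else 0))"
      by (intro sum.cong) (auto simp: algebra_simps)
    also have "\<dots> = (\<Sum>x\<in>insert a (set es). real (count_list es x) * f x) + f a"
      by (simp add: sum.distrib)
    also have "(\<Sum>x\<in>insert a (set es). real (count_list es x) * f x) = (\<Sum>x\<in>set es. real (count_list es x) * f x)"
      by (rule sum.mono_neutral_right) (auto simp: count_list_0_iff)
    finally show ?case using Cons.IH by simp
  qed simp
  finally show "(\<Sum>x | eigenvalue A x. real (Polynomial.order x (char_poly A)) * f x) = (\<Sum>a\<leftarrow>es. f a)" .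
  show "eigenvalue A x \<longleftrightarrow> x \<in> set es" by (rule ev)
qed

text \<open>For an eigenvector \<open>v\<close> the number \<open>a\<close> is the quotient of the
  squared norms of \<open>D *\<^sub>v v\<close> and \<open>v\<close>.\<close>

lemma eigenvalue_gram_nonneg:
  assumes D: "D \<in> carrier_mat d d" and ev: "eigenvalue (mat_adjoint D * D) a"
  shows "0 \<le> Re a" "Im a = 0"
proof -
  obtain v where v: "v \<in> carrier_vec d" "v \<noteq> 0\<^sub>v d" "(mat_adjoint D * D) *\<^sub>v v = a \<cdot>\<^sub>v v"
    using ev D unfolding eigenvalue_def eigenvector_def by auto
  have Dv: "D *\<^sub>v v \<in> carrier_vec d" using D v by auto
  have "a * (v \<bullet>c v) = (a \<cdot>\<^sub>v v) \<bullet>c v" using v by simp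
  also have "\<dots> = (mat_adjoint D *\<^sub>v (D *\<^sub>v v)) \<bullet>c v"
    using D v by (simp add: assoc_mult_mat_vec[of _ d d _ d] flip: v(3))
  also have "\<dots> = cnj (v \<bullet>c (mat_adjoint D *\<^sub>v (D *\<^sub>v v)))"
    by (rule cscalar_prod_commute[OF mult_mat_vec_carrier[OF mat_adjoint_carrier[OF D] Dv] v(1)])
  also have "v \<bullet>c (mat_adjoint D *\<^sub>v (D *\<^sub>v v)) = (D *\<^sub>v v) \<bullet>c (D *\<^sub>v v)"
    by (rule cscalar_prod_adjoint[OF D v(1) Dv, symmetric])
  finally have eq: "a * (v \<bullet>c v) = cnj ((D *\<^sub>v v) \<bullet>c (D *\<^sub>v v))" .
  have self: "y \<bullet>c y = complex_of_real ((hilbert_norm y)\<^sup>2)" if "y \<in> carrier_vec d" for y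
  proof -
    have "Im (y \<bullet>c y) = 0" using cscalar_prod_commute[OF that that] by (metis cnj.simps(2) neg_equal_zero)
    moreover have "Re (y \<bullet>c y) = (hilbert_norm y)\<^sup>2"
      using inner_ge_zero[of "embed_vec y"] unfolding inner_embed_vec[OF that that] hilbert_norm_def by simp
    ultimately show ?thesis by (simp add: complex_eq_iff)
  qed
  have pos: "0 < (hilbert_norm v)\<^sup>2" using hilbert_norm_zero_iff[OF v(1)] v(2) by simp
  have "a * complex_of_real ((hilbert_norm v)\<^sup>2) = complex_of_real ((hilbert_norm (D *\<^sub>v v))\<^sup>2)"
    using eq self[OF v(1)] self[OF Dv] by simp
  then have "a = complex_of_real ((hilbert_norm (D *\<^sub>v v))\<^sup>2 / (hilbert_norm v)\<^sup>2)"
    using pos by (simp add: field_simps del: of_real_power)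
  then show "0 \<le> Re a" "Im a = 0" using Re_complex_of_real Im_complex_of_real by (auto simp del: of_real_power of_real_divide)
qed

text \<open>The cross terms of the square are nonnegative. With squared singular values as
  \<open>xs\<close> this compares their Euclidean norm with their sum.\<close>

lemma sum_list_le_square_sum_sqrt:
  "(\<And>x. x \<in> set xs \<Longrightarrow> 0 \<le> x) \<Longrightarrow> sum_list xs \<le> (\<Sum>x\<leftarrow>xs. sqrt x)\<^sup>2"
proof (induction xs)
  case (Cons x xs)
  have "0 \<le> (\<Sum>x\<leftarrow>xs. sqrt x)" using Cons.prems by (intro sum_list_nonneg) auto
  moreover have "0 \<le> sqrt x" using Cons.prems by simp
  ultimately have "0 \<le> 2 * sqrt x * (\<Sum>x\<leftarrow>xs. sqrt x)" by simp
  moreover have "(sqrt x)\<^sup>2 = x" using Cons.prems by simp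
  ultimately show ?case using Cons by (simp add: power2_sum)
qed simp

lemma mat_trace_gram:
  assumes D: "D \<in> carrier_mat d d"
  shows "mat_trace (mat_adjoint D * D) = complex_of_real (\<Sum>i<d. \<Sum>k<d. (cmod (D $$ (k, i)))\<^sup>2)"
proof -
  have "mat_trace (mat_adjoint D * D) = (\<Sum>i<d. \<Sum>k<d. complex_of_real ((cmod (D $$ (k, i)))\<^sup>2))"
    unfolding mat_trace_def using D
    by (intro sum.cong) (auto simp: mult_mat_index[OF mat_adjoint_carrier[OF D] D] complex_norm_square mult.commute
        simp del: index_mult_mat(1) of_real_power intro!: sum.cong)
  then show ?thesis by simp
qed

text \<open>The trace of \<open>mat_adjoint D * D\<close> is both the sum of the squared moduli of
  the entries and the sum of the squared singular values.\<close>

lemma frobenius_le_trace_norm: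
  assumes D: "D \<in> carrier_mat d d"
  shows "(\<Sum>i<d. \<Sum>k<d. (cmod (D $$ (k, i)))\<^sup>2) \<le> (trace_norm D)\<^sup>2" "0 \<le> trace_norm D"
proof -
  let ?B = "mat_adjoint D * D"
  have B: "?B \<in> carrier_mat d d" using D by (intro mult_carrier_mat[of _ d d]) auto
  obtain es where es: "char_poly ?B = (\<Prod>a\<leftarrow>es. [:- a, 1:])" "mat_trace ?B = sum_list es"
    using mat_trace_eq_sum_eigenvalues[OF B] by blast
  have tn: "trace_norm D = (\<Sum>a\<leftarrow>es. sqrt (Re a))"
    unfolding trace_norm_def Let_def by (rule sum_eigenvalues(1)[OF B es(1)])
  have nn: "0 \<le> Re a" if "a \<in> set es" for a
    using eigenvalue_gram_nonneg(1)[OF D] sum_eigenvalues(2)[OF B es(1)] that by blast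
  show "0 \<le> trace_norm D" unfolding tn using nn by (intro sum_list_nonneg) auto
  have "(\<Sum>i<d. \<Sum>k<d. (cmod (D $$ (k, i)))\<^sup>2) = Re (sum_list es)"
    using mat_trace_gram[OF D] es(2) by simp
  also have "\<dots> = sum_list (map Re es)" by (induction es) auto
  also have "\<dots> \<le> (\<Sum>x\<leftarrow>map Re es. sqrt x)\<^sup>2"
    using nn by (intro sum_list_le_square_sum_sqrt) auto
  finally show "(\<Sum>i<d. \<Sum>k<d. (cmod (D $$ (k, i)))\<^sup>2) \<le> (trace_norm D)\<^sup>2"
    unfolding tn by (simp add: o_def)
qed

text \<open>The operator norm is at most the Frobenius norm, by Cauchy-Schwarz in each row, and the
  latter at most the trace norm.\<close>

lemma hilbert_norm_mult_le_trace_norm: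
  assumes D: "D \<in> carrier_mat d d" and v: "v \<in> carrier_vec d"
  shows "hilbert_norm (D *\<^sub>v v) \<le> trace_norm D * hilbert_norm v"
proof (rule power2_le_imp_le)
  have "(hilbert_norm (D *\<^sub>v v))\<^sup>2 = (\<Sum>i<d. (cmod (\<Sum>k<d. D $$ (i, k) * v $ k))\<^sup>2)"
    unfolding hilbert_norm_square using D by (intro sum.cong) (auto simp: mult_mat_vec_index[OF D v] simp del: index_mult_mat_vec)
  also have "\<dots> \<le> (\<Sum>i<d. (\<Sum>k<d. (cmod (D $$ (i, k)))\<^sup>2) * (\<Sum>k<d. (cmod (v $ k))\<^sup>2))"
  proof (rule sum_mono)
    fix i
    have "cmod (\<Sum>k<d. D $$ (i, k) * v $ k) \<le> (\<Sum>k<d. cmod (D $$ (i, k)) * cmod (v $ k))"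
      by (rule order_trans[OF norm_sum]) (simp add: norm_mult)
    then have "(cmod (\<Sum>k<d. D $$ (i, k) * v $ k))\<^sup>2 \<le> (\<Sum>k<d. cmod (D $$ (i, k)) * cmod (v $ k))\<^sup>2"
      by (intro power_mono) auto
    also have "\<dots> \<le> (\<Sum>k<d. (cmod (D $$ (i, k)))\<^sup>2) * (\<Sum>k<d. (cmod (v $ k))\<^sup>2)"
      by (rule Cauchy_Schwarz_ineq_sum)
    finally show "(cmod (\<Sum>k<d. D $$ (i, k) * v $ k))\<^sup>2 \<le> (\<Sum>k<d. (cmod (D $$ (i, k)))\<^sup>2) * (\<Sum>k<d. (cmod (v $ k))\<^sup>2)" .
  qed
  also have "\<dots> = (\<Sum>i<d. \<Sum>k<d. (cmod (D $$ (k, i)))\<^sup>2) * (hilbert_norm v)\<^sup>2"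
    using v unfolding hilbert_norm_square by (subst sum.swap) (simp add: sum_distrib_right)
  also have "\<dots> \<le> (trace_norm D)\<^sup>2 * (hilbert_norm v)\<^sup>2"
    by (intro mult_right_mono frobenius_le_trace_norm(1)[OF D]) simp
  finally show "(hilbert_norm (D *\<^sub>v v))\<^sup>2 \<le> (trace_norm D * hilbert_norm v)\<^sup>2" by (simp add: power_mult_distrib)
  show "0 \<le> trace_norm D * hilbert_norm v" using frobenius_le_trace_norm(2)[OF D] by simp
qed

lemma Re_cscalar_prod_le:
  assumes "v \<in> carrier_vec d" "w \<in> carrier_vec d"
  shows "\<bar>Re (v \<bullet>c w)\<bar> \<le> hilbert_norm v * hilbert_norm w"
  using Cauchy_Schwarz_ineq2[of "embed_vec v" "embed_vec w"]
  unfolding inner_embed_vec[OF assms] norm_embed_vec .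

lemma fidelity_ge_trace_norm:
  assumes D: "D \<in> carrier_mat d d" and v: "v \<in> carrier_vec d" "hilbert_norm v \<le> 1"
  shows "- trace_norm D \<le> fidelity v D"
proof -
  have tn: "0 \<le> trace_norm D" by (rule frobenius_le_trace_norm(2)[OF D])
  have "\<bar>fidelity v D\<bar> \<le> hilbert_norm (D *\<^sub>v v) * hilbert_norm v"
    unfolding fidelity_def by (rule Re_cscalar_prod_le[OF mult_mat_vec_carrier[OF D v(1)] v(1)])
  also have "\<dots> \<le> (trace_norm D * hilbert_norm v) * hilbert_norm v"
    by (intro mult_right_mono hilbert_norm_mult_le_trace_norm[OF D v(1)] hilbert_norm_nonneg)
  also have "\<dots> \<le> trace_norm D * 1"
    unfolding mult.assoc using tn v(2) mult_mono[of "hilbert_norm v" 1 "hilbert_norm v" 1]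
    by (intro mult_left_mono) auto
  finally show ?thesis by simp
qed

section \<open>Rank-one projections and fidelity\<close>

lemma proj_carrier [simp]: "proj d v \<in> carrier_mat d d"
  by (simp add: proj_def)

text \<open>A unit projection is its own Gram matrix and has no eigenvalues besides 0 and 1, which
  are their own square roots; so the trace norm is the trace. This makes the projection an
  admissible test operator for the induced norm.\<close>

lemma trace_norm_proj:
  assumes v: "v \<in> carrier_vec d" "hilbert_norm v = 1"
  shows "trace_norm (proj d v) = 1"
proof -
  let ?P = "proj d v"
  have nv: "(\<Sum>i<d. cnj (v $ i) * v $ i) = 1"
  proof -
    have "cnj z * z = complex_of_real ((cmod z)\<^sup>2)" for z
      unfolding complex_norm_square by (rule mult.commute)
    then have "(\<Sum>i<d. cnj (v $ i) * v $ i) = complex_of_real ((hilbert_norm v)\<^sup>2)"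
      using v(1) by (simp only: hilbert_norm_square of_real_sum carrier_vecD)
    then show ?thesis using v(2) by simp
  qed
  have adj: "mat_adjoint ?P = ?P" by (intro eq_matI) (auto simp: proj_def)
  have idem: "?P * ?P = ?P"
  proof (rule eq_matI)
    fix i j assume ij: "i < dim_row ?P" "j < dim_col ?P"
    then have "(?P * ?P) $$ (i, j) = (\<Sum>k<d. v $ i * cnj (v $ j) * (cnj (v $ k) * v $ k))"
      by (subst mult_mat_index[of _ d d _ d]) (auto simp: proj_def mult_ac intro!: sum.cong)
    also have "\<dots> = v $ i * cnj (v $ j)" by (simp add: sum_distrib_left[symmetric] nv)
    finally show "(?P * ?P) $$ (i, j) = ?P $$ (i, j)" using ij by (simp add: proj_def)
  qed (simp_all add: proj_def)
  have B: "mat_adjoint ?P * ?P = ?P" by (simp add: adj idem)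
  obtain es where es: "char_poly ?P = (\<Prod>a\<leftarrow>es. [:- a, 1:])" "mat_trace ?P = sum_list es"
    using mat_trace_eq_sum_eigenvalues[OF proj_carrier] by blast
  have ev: "a = 0 \<or> a = 1" if a: "a \<in> set es" for a
  proof -
    have "eigenvalue ?P a" using sum_eigenvalues(2)[OF proj_carrier es(1)] a by simp
    then obtain u where u: "u \<in> carrier_vec d" "u \<noteq> 0\<^sub>v d" "?P *\<^sub>v u = a \<cdot>\<^sub>v u"
      unfolding eigenvalue_def eigenvector_def by (auto simp: proj_def)
    have "?P *\<^sub>v (?P *\<^sub>v u) = ?P *\<^sub>v u"
      using u(1) idem by (simp add: assoc_mult_mat_vec[of _ d d _ d, symmetric])
    then have "a \<cdot>\<^sub>v (a \<cdot>\<^sub>v u) = a \<cdot>\<^sub>v u" using u by (simp add: mult_mat_vec[of _ d d])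
    moreover obtain i where i: "i < d" "u $ i \<noteq> 0"
    proof (rule ccontr)
      assume "\<not> thesis"
      then have "u = 0\<^sub>v d" using that u(1) by (intro eq_vecI) auto
      then show False using u(2) by simp
    qed
    ultimately have "a * (a * u $ i) = a * u $ i" using u(1) by (metis carrier_vecD index_smult_vec(1) index_smult_vec(2))
    then show ?thesis using i(2) by simp
  qed
  have "trace_norm ?P = (\<Sum>a\<leftarrow>es. sqrt (Re a))"
    unfolding trace_norm_def Let_def B by (rule sum_eigenvalues(1)[OF proj_carrier es(1)])
  also have "\<dots> = (\<Sum>a\<leftarrow>es. Re a)" by (intro arg_cong[of _ _ sum_list] map_cong refl) (use ev in fastforce)
  also have "\<dots> = Re (sum_list es)" by (induction es) auto
  also have "sum_list es = (\<Sum>i<d. cnj (v $ i) * v $ i)"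
    unfolding es(2)[symmetric] mat_trace_def by (simp add: proj_def mult.commute)
  finally show ?thesis by (simp add: nv)
qed

lemma fidelity_sum: "fidelity v X = Re (\<Sum>a<d. \<Sum>b<d. X $$ (a, b) * (v $ b * cnj (v $ a)))"
  if "X \<in> carrier_mat d d" "v \<in> carrier_vec d"
proof -
  have "(X *\<^sub>v v) \<bullet>c v = (\<Sum>a<d. (\<Sum>b<d. X $$ (a, b) * v $ b) * cnj (v $ a))"
    unfolding cscalar_prod_sum[OF mult_mat_vec_carrier[OF that] that(2)]
    by (intro sum.cong refl) (simp only: mult_mat_vec_index[OF that] lessThan_iff)
  then show ?thesis unfolding fidelity_def by (simp add: sum_distrib_right mult.assoc)
qed

lemma fidelity_add:
  "X \<in> carrier_mat d d \<Longrightarrow> Y \<in> carrier_mat d d \<Longrightarrow> v \<in> carrier_vec d \<Longrightarrow> fidelity v (X + Y) = fidelity v X + fidelity v Y"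
  unfolding fidelity_def by (simp add: add_mult_distrib_mat_vec[of _ d d] add_scalar_prod_distrib[of _ d])

lemma fidelity_diff:
  "X \<in> carrier_mat d d \<Longrightarrow> Y \<in> carrier_mat d d \<Longrightarrow> v \<in> carrier_vec d \<Longrightarrow> fidelity v (X - Y) = fidelity v X - fidelity v Y"
  unfolding fidelity_def by (simp add: minus_mult_distrib_mat_vec[of _ d d] minus_scalar_prod_distrib[of _ d])

lemma fidelity_smult:
  "X \<in> carrier_mat d d \<Longrightarrow> v \<in> carrier_vec d \<Longrightarrow> fidelity v (complex_of_real r \<cdot>\<^sub>m X) = r * fidelity v X"
  unfolding fidelity_def by (simp add: smult_mat_mult_vec[of _ d d])

lemma conj_channel_carrier [simp]: "A \<in> carrier_mat d d \<Longrightarrow> X \<in> carrier_mat d d \<Longrightarrow> conj_channel A X \<in> carrier_mat d d"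
  unfolding conj_channel_def by (intro mult_carrier_mat[of _ d d]) auto

lemma conj_channel_add:
  assumes "A \<in> carrier_mat d d" "X \<in> carrier_mat d d" "Y \<in> carrier_mat d d"
  shows "conj_channel A (X + Y) = conj_channel A X + conj_channel A Y"
  unfolding conj_channel_def using assms
  by (simp add: mult_add_distrib_mat[of _ d d _ d] add_mult_distrib_mat[of _ d d _ _ d])

lemma conj_channel_smult:
  assumes "A \<in> carrier_mat d d" "X \<in> carrier_mat d d"
  shows "conj_channel A (c \<cdot>\<^sub>m X) = c \<cdot>\<^sub>m conj_channel A X"
  unfolding conj_channel_def using assms
  by (simp add: mult_smult_distrib[of _ d d _ d] mult_smult_assoc_mat[of _ d d _ d])

lemma conj_channel_proj:
  assumes A: "A \<in> carrier_mat d d" and v: "v \<in> carrier_vec d"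
  shows "conj_channel A (proj d v) = proj d (A *\<^sub>v v)"
proof (rule eq_matI)
  fix i j assume "i < dim_row (proj d (A *\<^sub>v v))" "j < dim_col (proj d (A *\<^sub>v v))"
  then have ij: "i < d" "j < d" by (simp_all add: proj_def)
  have AP: "(A * proj d v) $$ (i, k) = (\<Sum>a<d. A $$ (i, a) * v $ a) * cnj (v $ k)" if "k < d" for k
    using ij that by (subst mult_mat_index[OF A proj_carrier]) (auto simp: proj_def sum_distrib_right mult.assoc)
  have "conj_channel A (proj d v) $$ (i, j) = (\<Sum>k<d. (A * proj d v) $$ (i, k) * mat_adjoint A $$ (k, j))"
    unfolding conj_channel_def using A ij by (intro mult_mat_index[of _ d d _ d] mult_carrier_mat[of _ d d]) auto
  also have "\<dots> = (\<Sum>k<d. (\<Sum>a<d. A $$ (i, a) * v $ a) * cnj (A $$ (j, k) * v $ k))"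
    using A ij by (intro sum.cong refl) (auto simp: AP mult_ac simp del: index_mult_mat)
  also have "\<dots> = (A *\<^sub>v v) $ i * cnj ((A *\<^sub>v v) $ j)"
    unfolding mult_mat_vec_index[OF A v ij(1)] mult_mat_vec_index[OF A v ij(2)]
    by (simp add: sum_distrib_left)
  also have "\<dots> = proj d (A *\<^sub>v v) $$ (i, j)" using ij by (simp add: proj_def del: index_mult_mat_vec)
  finally show "conj_channel A (proj d v) $$ (i, j) = proj d (A *\<^sub>v v) $$ (i, j)" .
qed (use A in \<open>auto simp: conj_channel_def proj_def\<close>)

text \<open>Heisenberg picture: the evolution is moved from the state to the vector it is tested
  against.\<close>

lemma fidelity_conj_channel:
  assumes A: "A \<in> carrier_mat d d" and X: "X \<in> carrier_mat d d" and v: "v \<in> carrier_vec d"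
  shows "fidelity v (conj_channel A X) = fidelity (mat_adjoint A *\<^sub>v v) X"
proof -
  have c: "mat_adjoint A *\<^sub>v v \<in> carrier_vec d" by (rule mult_mat_vec_carrier[OF mat_adjoint_carrier[OF A] v])
  have c2: "X *\<^sub>v (mat_adjoint A *\<^sub>v v) \<in> carrier_vec d" by (rule mult_mat_vec_carrier[OF X c])
  have "conj_channel A X *\<^sub>v v = A *\<^sub>v (X *\<^sub>v (mat_adjoint A *\<^sub>v v))"
    unfolding conj_channel_def
    using assoc_mult_mat_vec[OF mult_carrier_mat[OF A X] mat_adjoint_carrier[OF A] v] assoc_mult_mat_vec[OF A X c] by simp
  then show ?thesis unfolding fidelity_def using cscalar_prod_adjoint[OF A c2 v] by simp
qed

lemma fidelity_proj:
  assumes v: "v \<in> carrier_vec d" and w: "w \<in> carrier_vec d"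
  shows "fidelity w (proj d v) = (cmod (w \<bullet>c v))\<^sup>2"
proof -
  have "fidelity w (proj d v) = Re (\<Sum>a<d. \<Sum>b<d. (v $ a * cnj (w $ a)) * (w $ b * cnj (v $ b)))"
    unfolding fidelity_sum[OF proj_carrier w] by (intro arg_cong[of _ _ Re] sum.cong refl) (simp add: proj_def mult_ac)
  also have "(\<Sum>a<d. \<Sum>b<d. (v $ a * cnj (w $ a)) * (w $ b * cnj (v $ b))) = (v \<bullet>c w) * (w \<bullet>c v)"
    unfolding cscalar_prod_sum[OF v w] cscalar_prod_sum[OF w v] by (rule sum_product[symmetric])
  also have "\<dots> = complex_of_real ((cmod (w \<bullet>c v))\<^sup>2)"
    unfolding cscalar_prod_commute[OF v w] complex_norm_square by (simp add: mult.commute)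
  finally show ?thesis by simp
qed

text \<open>Density matrices as sums of unnormalised pure states, \<open>r\<close> being the trace. Channels preserve this
  form, so that no spectral decomposition of states is needed.\<close>

inductive ensemble :: "nat \<Rightarrow> real \<Rightarrow> complex mat \<Rightarrow> bool" for d where
  ensemble_empty: "ensemble d 0 (0\<^sub>m d d)"
| ensemble_insert: "v \<in> carrier_vec d \<Longrightarrow> ensemble d r X \<Longrightarrow> ensemble d ((hilbert_norm v)\<^sup>2 + r) (proj d v + X)"

lemma ensemble_carrier: "ensemble d r X \<Longrightarrow> X \<in> carrier_mat d d"
  by (induction rule: ensemble.induct) auto

lemma ensemble_add: "ensemble d r X \<Longrightarrow> ensemble d s Y \<Longrightarrow> ensemble d (r + s) (X + Y)"
proof (induction rule: ensemble.induct)
  case ensemble_empty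
  then show ?case using ensemble_carrier[of d s Y] by simp
next
  case (ensemble_insert v r X)
  have "ensemble d ((hilbert_norm v)\<^sup>2 + (r + s)) (proj d v + (X + Y))"
    by (intro ensemble.ensemble_insert ensemble_insert)
  then show ?case
    using ensemble_carrier[OF ensemble_insert(2)] ensemble_carrier[OF ensemble_insert.prems]
    by (simp add: add.assoc assoc_add_mat[of _ d d])
qed

lemma ensemble_proj: "v \<in> carrier_vec d \<Longrightarrow> ensemble d ((hilbert_norm v)\<^sup>2) (proj d v)"
  using ensemble_insert[OF _ ensemble_empty, of v] by simp

text \<open>Bounds the entries of every state that a realization can produce, whence their
  integrability over the chain.\<close>

lemma ensemble_entry_bound:
  assumes "ensemble d r X" "a < d" "b < d"
  shows "cmod (X $$ (a, b)) \<le> r"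
  using assms
proof (induction rule: ensemble.induct)
  case (ensemble_insert v r X)
  have comp: "cmod (v $ i) \<le> hilbert_norm v" if "i < d" for i
  proof (rule power2_le_imp_le)
    have "(cmod (v $ i))\<^sup>2 \<le> (\<Sum>i<d. (cmod (v $ i))\<^sup>2)" by (rule member_le_sum) (use that in auto)
    then show "(cmod (v $ i))\<^sup>2 \<le> (hilbert_norm v)\<^sup>2" using ensemble_insert(1) by (simp add: hilbert_norm_square)
  qed simp
  have "cmod (proj d v $$ (a, b)) \<le> hilbert_norm v * hilbert_norm v"
    using ensemble_insert.prems comp by (simp add: proj_def norm_mult mult_mono)
  moreover have "cmod (X $$ (a, b)) \<le> r" using ensemble_insert by simp
  moreover have "(proj d v + X) $$ (a, b) = proj d v $$ (a, b) + X $$ (a, b)"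
    using ensemble_carrier[OF ensemble_insert(2)] ensemble_insert.prems by simp
  ultimately show ?case
    using norm_triangle_ineq[of "proj d v $$ (a, b)" "X $$ (a, b)"] by (simp add: power2_eq_square)
qed simp

section \<open>Kraus maps\<close>

definition kraus_map :: "nat \<Rightarrow> complex mat list \<Rightarrow> complex mat \<Rightarrow> complex mat" where
  "kraus_map d As X = foldr (+) (map (\<lambda>A. conj_channel A X) As) (0\<^sub>m d d)"

lemma kraus_map_simps [simp]:
  "kraus_map d [] X = 0\<^sub>m d d"
  "kraus_map d (A # As) X = conj_channel A X + kraus_map d As X"
  by (simp_all add: kraus_map_def)

lemma kraus_map_carrier [simp]:
  "set As \<subseteq> carrier_mat d d \<Longrightarrow> X \<in> carrier_mat d d \<Longrightarrow> kraus_map d As X \<in> carrier_mat d d"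
  by (induction As) auto

lemma add_mat_swap:
  fixes A B X Y :: "'a::comm_monoid_add mat"
  assumes "A \<in> carrier_mat n m" "B \<in> carrier_mat n m" "X \<in> carrier_mat n m" "Y \<in> carrier_mat n m"
  shows "(A + B) + (X + Y) = (A + X) + (B + Y)"
  by (rule eq_matI) (use assms in \<open>auto simp: add_ac\<close>)

lemma kraus_map_add:
  assumes "set As \<subseteq> carrier_mat d d" "X \<in> carrier_mat d d" "Y \<in> carrier_mat d d"
  shows "kraus_map d As (X + Y) = kraus_map d As X + kraus_map d As Y"
  using assms(1)
proof (induction As)
  case (Cons A As)
  then have A: "A \<in> carrier_mat d d" and As: "set As \<subseteq> carrier_mat d d" by auto
  show ?case
    using Cons.IH[OF As] conj_channel_add[OF A assms(2,3)]
      add_mat_swap[of "conj_channel A X" d d "conj_channel A Y" "kraus_map d As X" "kraus_map d As Y"] A As assms(2,3)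
    by simp
qed simp

lemma kraus_map_smult:
  assumes "set As \<subseteq> carrier_mat d d" "X \<in> carrier_mat d d"
  shows "kraus_map d As (c \<cdot>\<^sub>m X) = c \<cdot>\<^sub>m kraus_map d As X"
  using assms(1)
proof (induction As)
  case (Cons A As)
  then have A: "A \<in> carrier_mat d d" and As: "set As \<subseteq> carrier_mat d d" by auto
  have "conj_channel A X \<in> carrier_mat d d" "kraus_map d As X \<in> carrier_mat d d" using A As assms(2) by auto
  then show ?case
    using Cons.IH[OF As] conj_channel_smult[OF A assms(2)]
    by (simp add: add_smult_distrib_left_mat[of _ d d])
qed simp

lemma kraus_map_proj:
  assumes "set As \<subseteq> carrier_mat d d" and v: "v \<in> carrier_vec d"
  shows "ensemble d (\<Sum>A\<leftarrow>As. (hilbert_norm (A *\<^sub>v v))\<^sup>2) (kraus_map d As (proj d v))"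
  using assms(1)
proof (induction As)
  case (Cons A As)
  then have A: "A \<in> carrier_mat d d" and As: "set As \<subseteq> carrier_mat d d" by auto
  show ?case
    using ensemble_add[OF ensemble_proj[OF mult_mat_vec_carrier[OF A v]] Cons.IH[OF As]]
    by (simp add: conj_channel_proj[OF A v])
qed (simp add: ensemble_empty)

text \<open>Each \<open>A\<close> is moved across the inner product. By the completeness relation of
  a channel the right-hand side becomes the squared norm of \<open>v\<close>, so the trace of a pure
  state is preserved.\<close>

lemma kraus_norm_sum:
  assumes "set As \<subseteq> carrier_mat d d" and v: "v \<in> carrier_vec d"
  shows "(\<Sum>A\<leftarrow>As. (hilbert_norm (A *\<^sub>v v))\<^sup>2) =
    Re ((foldr (+) (map (\<lambda>A. mat_adjoint A * A) As) (0\<^sub>m d d) *\<^sub>v v) \<bullet>c v)"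
  using assms(1)
proof (induction As)
  case Nil
  have "0\<^sub>m d d *\<^sub>v v = 0\<^sub>v d" using v by auto
  then show ?case using v by simp
next
  case (Cons A As)
  then have A: "A \<in> carrier_mat d d" and As: "set As \<subseteq> carrier_mat d d" by auto
  let ?S = "foldr (+) (map (\<lambda>A. mat_adjoint A * A) As) (0\<^sub>m d d)"
  have S: "?S \<in> carrier_mat d d"
    using As by (induction As) (auto intro!: add_carrier_mat mult_carrier_mat[of _ d d])
  have AA: "mat_adjoint A * A \<in> carrier_mat d d" by (rule mult_carrier_mat[OF mat_adjoint_carrier[OF A] A])
  have Av: "A *\<^sub>v v \<in> carrier_vec d" by (rule mult_mat_vec_carrier[OF A v])
  have AAv: "mat_adjoint A *\<^sub>v (A *\<^sub>v v) \<in> carrier_vec d" by (rule mult_mat_vec_carrier[OF mat_adjoint_carrier[OF A] Av])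
  have "(hilbert_norm (A *\<^sub>v v))\<^sup>2 = Re ((A *\<^sub>v v) \<bullet>c (A *\<^sub>v v))"
    unfolding norm_embed_vec[symmetric] power2_norm_eq_inner by (rule inner_embed_vec[OF Av Av])
  also have "(A *\<^sub>v v) \<bullet>c (A *\<^sub>v v) = v \<bullet>c (mat_adjoint A *\<^sub>v (A *\<^sub>v v))"
    by (rule cscalar_prod_adjoint[OF A v Av])
  also have "Re \<dots> = Re ((mat_adjoint A *\<^sub>v (A *\<^sub>v v)) \<bullet>c v)"
    by (subst cscalar_prod_commute[OF v AAv]) simp
  also have "mat_adjoint A *\<^sub>v (A *\<^sub>v v) = (mat_adjoint A * A) *\<^sub>v v"
    by (rule assoc_mult_mat_vec[OF mat_adjoint_carrier[OF A] A v, symmetric])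
  finally have 1: "(hilbert_norm (A *\<^sub>v v))\<^sup>2 = Re (((mat_adjoint A * A) *\<^sub>v v) \<bullet>c v)" .
  have "fidelity v (mat_adjoint A * A + ?S) = fidelity v (mat_adjoint A * A) + fidelity v ?S"
    by (rule fidelity_add[OF AA S v])
  then show ?case using 1 Cons.IH[OF As] by (simp add: fidelity_def)
qed

lemma quantum_channelE:
  assumes "quantum_channel d \<Phi>"
  obtains As where "set As \<subseteq> carrier_mat d d" "\<And>X. X \<in> carrier_mat d d \<Longrightarrow> \<Phi> X = kraus_map d As X"
    "\<And>v. v \<in> carrier_vec d \<Longrightarrow> (\<Sum>A\<leftarrow>As. (hilbert_norm (A *\<^sub>v v))\<^sup>2) = (hilbert_norm v)\<^sup>2"
proof -
  obtain As where As: "set As \<subseteq> carrier_mat d d"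
    "foldr (+) (map (\<lambda>A. mat_adjoint A * A) As) (0\<^sub>m d d) = 1\<^sub>m d"
    "\<And>X. X \<in> carrier_mat d d \<Longrightarrow> \<Phi> X = kraus_map d As X"
    using assms unfolding quantum_channel_def kraus_map_def by blast
  have "(\<Sum>A\<leftarrow>As. (hilbert_norm (A *\<^sub>v v))\<^sup>2) = (hilbert_norm v)\<^sup>2" if v: "v \<in> carrier_vec d" for v
  proof -
    have "Re (v \<bullet>c v) = (hilbert_norm v)\<^sup>2"
      unfolding norm_embed_vec[symmetric] power2_norm_eq_inner by (rule inner_embed_vec[OF v v, symmetric])
    then show ?thesis unfolding kraus_norm_sum[OF As(1) v] As(2) using v by simp
  qed
  then show ?thesis using that As by blast
qed

lemma channel_carrier: "quantum_channel d \<Phi> \<Longrightarrow> X \<in> carrier_mat d d \<Longrightarrow> \<Phi> X \<in> carrier_mat d d"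
  by (erule quantum_channelE) simp

lemma channel_add:
  "quantum_channel d \<Phi> \<Longrightarrow> X \<in> carrier_mat d d \<Longrightarrow> Y \<in> carrier_mat d d \<Longrightarrow> \<Phi> (X + Y) = \<Phi> X + \<Phi> Y"
  by (erule quantum_channelE) (simp add: kraus_map_add)

lemma channel_smult: "quantum_channel d \<Phi> \<Longrightarrow> X \<in> carrier_mat d d \<Longrightarrow> \<Phi> (c \<cdot>\<^sub>m X) = c \<cdot>\<^sub>m \<Phi> X"
  by (erule quantum_channelE) (simp add: kraus_map_smult)

text \<open>A Kraus operator \<open>A\<close> maps the projection on \<open>v\<close> to that on
  \<open>A *\<^sub>v v\<close>, so an ensemble goes to an ensemble, and the squared norms add up to
  the old one.\<close>

lemma channel_ensemble:
  assumes \<Phi>: "quantum_channel d \<Phi>" and X: "ensemble d r X"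
  shows "ensemble d r (\<Phi> X)"
proof -
  obtain As where As: "set As \<subseteq> carrier_mat d d" "\<And>X. X \<in> carrier_mat d d \<Longrightarrow> \<Phi> X = kraus_map d As X"
    "\<And>v. v \<in> carrier_vec d \<Longrightarrow> (\<Sum>A\<leftarrow>As. (hilbert_norm (A *\<^sub>v v))\<^sup>2) = (hilbert_norm v)\<^sup>2"
    using \<Phi> by (rule quantum_channelE) blast
  show ?thesis using X
  proof (induction rule: ensemble.induct)
    case ensemble_empty
    have "\<Phi> (0\<^sub>m d d) = \<Phi> (0 \<cdot>\<^sub>m 0\<^sub>m d d)" by (intro arg_cong[of _ _ \<Phi>] eq_matI) auto
    also have "\<dots> = 0 \<cdot>\<^sub>m \<Phi> (0\<^sub>m d d)" by (rule channel_smult[OF \<Phi>]) simp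
    also have "\<dots> = 0\<^sub>m d d" using channel_carrier[OF \<Phi>, of "0\<^sub>m d d"] by (intro eq_matI) auto
    finally show ?case by (simp add: ensemble.ensemble_empty)
  next
    case (ensemble_insert v r X)
    have "ensemble d ((hilbert_norm v)\<^sup>2) (\<Phi> (proj d v))"
      using kraus_map_proj[OF As(1) ensemble_insert(1)] As(2,3) ensemble_insert(1) by simp
    then show ?case
      using ensemble_add[OF _ ensemble_insert.IH] channel_add[OF \<Phi> proj_carrier ensemble_carrier[OF ensemble_insert(2)]]
      by simp
  qed
qed

text \<open>The induced norm is evaluated at unit projections, and linearity extends the estimate to
  ensembles with the trace \<open>r\<close> as a factor; the trace norm of a mixed state never has
  to be computed.\<close>

lemma channel_fidelity_error:
  assumes \<Phi>: "quantum_channel d \<Phi>" and W: "W \<in> carrier_mat d d" and \<epsilon>: "0 \<le> \<epsilon>"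
    and err: "induced_trace_norm d (\<lambda>X. \<Phi> X - conj_channel W X) \<le> ennreal \<epsilon>"
    and \<phi>: "\<phi> \<in> carrier_vec d" "hilbert_norm \<phi> \<le> 1" and X: "ensemble d r X"
  shows "fidelity \<phi> (conj_channel W X) - r * \<epsilon> \<le> fidelity \<phi> (\<Phi> X)"
proof -
  have unit: "fidelity \<phi> (conj_channel W (proj d u)) - \<epsilon> \<le> fidelity \<phi> (\<Phi> (proj d u))"
    if u: "u \<in> carrier_vec d" "hilbert_norm u = 1" for u
  proof -
    let ?D = "\<Phi> (proj d u) - conj_channel W (proj d u)"
    have c: "\<Phi> (proj d u) \<in> carrier_mat d d" "conj_channel W (proj d u) \<in> carrier_mat d d"
      using channel_carrier[OF \<Phi>] W by auto
    have D: "?D \<in> carrier_mat d d" by (rule minus_carrier_mat[OF c(2)])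
    have "ennreal (trace_norm ?D) \<le> induced_trace_norm d (\<lambda>X. \<Phi> X - conj_channel W X)"
      unfolding induced_trace_norm_def by (rule SUP_upper) (simp add: trace_norm_proj[OF u])
    then have "ennreal (trace_norm ?D) \<le> ennreal \<epsilon>" using err by (rule order_trans)
    then have "trace_norm ?D \<le> \<epsilon>" using \<epsilon> by simp
    moreover have "- trace_norm ?D \<le> fidelity \<phi> ?D" by (rule fidelity_ge_trace_norm[OF D \<phi>])
    ultimately show ?thesis unfolding fidelity_diff[OF c \<phi>(1)] by simp
  qed
  have pure: "fidelity \<phi> (conj_channel W (proj d v)) - (hilbert_norm v)\<^sup>2 * \<epsilon> \<le> fidelity \<phi> (\<Phi> (proj d v))"
    if v: "v \<in> carrier_vec d" for v
  proof -
    \<comment> \<open>Normalisation; when \<open>v\<close> has norm zero the scalar factor is zero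
      and \<open>u\<close> is arbitrary.\<close>
    obtain u where su: "proj d v = complex_of_real ((hilbert_norm v)\<^sup>2) \<cdot>\<^sub>m proj d u"
      "hilbert_norm v = 0 \<or> u \<in> carrier_vec d \<and> hilbert_norm u = 1"
    proof (cases "hilbert_norm v = 0")
      case True
      then have "v = 0\<^sub>v d" using hilbert_norm_zero_iff[OF v] by simp
      then have "proj d v = complex_of_real ((hilbert_norm v)\<^sup>2) \<cdot>\<^sub>m proj d v"
        using True by (intro eq_matI) (auto simp: proj_def)
      then show ?thesis using that True by blast
    next
      case False
      let ?r = "hilbert_norm v"
      let ?u = "complex_of_real (1 / ?r) \<cdot>\<^sub>v v"
      have r: "0 < ?r" using False hilbert_norm_nonneg[of v] by linarith
      have "?u \<in> carrier_vec d" "hilbert_norm ?u = 1"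
        using v r by (simp_all add: hilbert_norm_smult norm_divide)
      moreover have "proj d v = complex_of_real (?r\<^sup>2) \<cdot>\<^sub>m proj d ?u"
        using v r by (intro eq_matI) (auto simp: proj_def power2_eq_square)
      ultimately show ?thesis using that by blast
    qed
    let ?q = "(hilbert_norm v)\<^sup>2"
    have pv: "proj d v = complex_of_real ?q \<cdot>\<^sub>m proj d u" by (rule su(1))
    have f1: "fidelity \<phi> (conj_channel W (proj d v)) = ?q * fidelity \<phi> (conj_channel W (proj d u))"
      unfolding pv conj_channel_smult[OF W proj_carrier] by (rule fidelity_smult) (use W \<phi> in auto)
    have f2: "fidelity \<phi> (\<Phi> (proj d v)) = ?q * fidelity \<phi> (\<Phi> (proj d u))"
      unfolding pv channel_smult[OF \<Phi> proj_carrier] by (rule fidelity_smult) (use channel_carrier[OF \<Phi>] \<phi> in auto)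
    show ?thesis
    proof (cases "hilbert_norm v = 0")
      case False
      then have "?q * (fidelity \<phi> (conj_channel W (proj d u)) - \<epsilon>) \<le> ?q * fidelity \<phi> (\<Phi> (proj d u))"
        using unit su(2) by (intro mult_left_mono) auto
      then show ?thesis unfolding f1 f2 by (simp add: algebra_simps)
    qed (simp add: f1 f2)
  qed
  show ?thesis using X
  proof (induction rule: ensemble.induct)
    case ensemble_empty
    have z: "0\<^sub>m d d = (0::complex) \<cdot>\<^sub>m 0\<^sub>m d d" by (intro eq_matI) auto
    have z': "fidelity \<phi> (0 \<cdot>\<^sub>m Y) = 0" if "Y \<in> carrier_mat d d" for Y
      using fidelity_smult[OF that \<phi>(1), of 0] by simp
    have "fidelity \<phi> (conj_channel W (0\<^sub>m d d)) = 0"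
      by (subst z, subst conj_channel_smult[OF W], simp, rule z') (use W in simp)
    moreover have "fidelity \<phi> (\<Phi> (0\<^sub>m d d)) = 0"
      by (subst z, subst channel_smult[OF \<Phi>], simp, rule z') (rule channel_carrier[OF \<Phi>], simp)
    ultimately show ?case by simp
  next
    case (ensemble_insert v r X)
    have Xc: "X \<in> carrier_mat d d" by (rule ensemble_carrier[OF ensemble_insert(2)])
    have "fidelity \<phi> (\<Phi> (proj d v + X)) = fidelity \<phi> (\<Phi> (proj d v)) + fidelity \<phi> (\<Phi> X)"
      unfolding channel_add[OF \<Phi> proj_carrier Xc]
      by (rule fidelity_add) (use channel_carrier[OF \<Phi>] Xc \<phi> in auto)
    moreover have "fidelity \<phi> (conj_channel W (proj d v + X)) = fidelity \<phi> (conj_channel W (proj d v)) + fidelity \<phi> (conj_channel W X)"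
      unfolding conj_channel_add[OF W proj_carrier Xc]
      by (rule fidelity_add) (use W Xc \<phi> in auto)
    ultimately show ?case
      using pure[OF ensemble_insert(1)] ensemble_insert.IH by (simp add: algebra_simps)
  qed
qed

text \<open>With \<open>y\<close> the image of \<open>\<phi>\<close> under the adjoint, the squared
  norm of \<open>y\<close> is the real part of the product of \<open>W *\<^sub>v y\<close> with
  \<open>\<phi>\<close>, at most \<open>hilbert_norm y * hilbert_norm \<phi>\<close>. This keeps
  test vectors that are pulled back in the unit ball.\<close>

lemma adjoint_contraction:
  assumes W: "W \<in> carrier_mat d d" and iso: "\<And>v. v \<in> carrier_vec d \<Longrightarrow> hilbert_norm (W *\<^sub>v v) = hilbert_norm v"
    and \<phi>: "\<phi> \<in> carrier_vec d"
  shows "hilbert_norm (mat_adjoint W *\<^sub>v \<phi>) \<le> hilbert_norm \<phi>"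
proof -
  let ?y = "mat_adjoint W *\<^sub>v \<phi>"
  have y: "?y \<in> carrier_vec d" by (rule mult_mat_vec_carrier[OF mat_adjoint_carrier[OF W] \<phi>])
  have Wy: "W *\<^sub>v ?y \<in> carrier_vec d" by (rule mult_mat_vec_carrier[OF W y])
  have "hilbert_norm ?y * hilbert_norm ?y = Re (?y \<bullet>c ?y)"
    using power2_norm_eq_inner[of "embed_vec ?y"] inner_embed_vec[OF y y] by (simp add: norm_embed_vec power2_eq_square)
  also have "\<dots> = Re ((W *\<^sub>v ?y) \<bullet>c \<phi>)" by (simp only: cscalar_prod_adjoint[OF W y \<phi>])
  also have "\<dots> \<le> hilbert_norm (W *\<^sub>v ?y) * hilbert_norm \<phi>" using Re_cscalar_prod_le[OF Wy \<phi>] by simp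
  also have "\<dots> = hilbert_norm ?y * hilbert_norm \<phi>" by (simp add: iso[OF y])
  finally show ?thesis
    by (cases "hilbert_norm ?y = 0") (auto simp: mult_le_cancel_left less_le)
qed

text \<open>The fidelity with \<open>\<phi>\<close> after the exact evolutions is the fidelity with \<open>\<phi>\<close> pulled back through
  them before; so one approximate evolution at a time can be replaced.\<close>

fun pull_back :: "(nat \<Rightarrow> real \<Rightarrow> complex mat) \<Rightarrow> (nat \<times> real) list \<Rightarrow> complex vec \<Rightarrow> complex vec" where
  "pull_back W [] \<phi> = \<phi>"
| "pull_back W ((k, \<tau>) # l) \<phi> = mat_adjoint (W k \<tau>) *\<^sub>v pull_back W l \<phi>"

fun push_forward :: "(nat \<Rightarrow> real \<Rightarrow> complex mat) \<Rightarrow> (nat \<times> real) list \<Rightarrow> complex vec \<Rightarrow> complex vec" where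
  "push_forward W [] v = v"
| "push_forward W ((k, \<tau>) # l) v = push_forward W l (W k \<tau> *\<^sub>v v)"

lemma push_forward_carrier:
  "(\<And>k \<tau>. W k \<tau> \<in> carrier_mat d d) \<Longrightarrow> v \<in> carrier_vec d \<Longrightarrow> push_forward W l v \<in> carrier_vec d"
  by (induction W l v rule: push_forward.induct) (auto intro: mult_mat_vec_carrier)

lemma pull_back_carrier:
  "(\<And>k \<tau>. W k \<tau> \<in> carrier_mat d d) \<Longrightarrow> \<phi> \<in> carrier_vec d \<Longrightarrow> pull_back W l \<phi> \<in> carrier_vec d"
  by (induction W l \<phi> rule: pull_back.induct) (auto intro: mult_mat_vec_carrier[OF mat_adjoint_carrier])

lemma pull_back_cscalar_prod:
  assumes "\<And>k \<tau>. W k \<tau> \<in> carrier_mat d d" and "\<phi> \<in> carrier_vec d" "v \<in> carrier_vec d"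
  shows "pull_back W l \<phi> \<bullet>c v = \<phi> \<bullet>c push_forward W l v"
  using assms(3)
proof (induction l arbitrary: v)
  case (Cons p l)
  obtain k \<tau> where p: "p = (k, \<tau>)" by (cases p)
  have b: "pull_back W l \<phi> \<in> carrier_vec d" by (rule pull_back_carrier[OF assms(1,2)])
  have Wv: "W k \<tau> *\<^sub>v v \<in> carrier_vec d" by (rule mult_mat_vec_carrier[OF assms(1) Cons.prems])
  have Wb: "mat_adjoint (W k \<tau>) *\<^sub>v pull_back W l \<phi> \<in> carrier_vec d"
    by (rule mult_mat_vec_carrier[OF mat_adjoint_carrier[OF assms(1)] b])
  have "(mat_adjoint (W k \<tau>) *\<^sub>v pull_back W l \<phi>) \<bullet>c v = pull_back W l \<phi> \<bullet>c (W k \<tau> *\<^sub>v v)"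
    unfolding cscalar_prod_commute[OF Wb Cons.prems] cscalar_prod_commute[OF b Wv]
      cscalar_prod_adjoint[OF assms(1) Cons.prems b] ..
  then show ?case using Cons.IH[OF Wv] by (simp add: p)
qed simp

lemma pull_back_norm:
  assumes "\<And>k \<tau>. W k \<tau> \<in> carrier_mat d d"
    and "\<And>k \<tau> v. (k, \<tau>) \<in> set l \<Longrightarrow> v \<in> carrier_vec d \<Longrightarrow> hilbert_norm (W k \<tau> *\<^sub>v v) = hilbert_norm v"
    and "\<phi> \<in> carrier_vec d"
  shows "hilbert_norm (pull_back W l \<phi>) \<le> hilbert_norm \<phi>"
  using assms(2)
proof (induction l)
  case (Cons p l)
  obtain k \<tau> where p: "p = (k, \<tau>)" by (cases p)
  have "hilbert_norm (mat_adjoint (W k \<tau>) *\<^sub>v pull_back W l \<phi>) \<le> hilbert_norm (pull_back W l \<phi>)"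
  proof (rule adjoint_contraction[OF assms(1) _ pull_back_carrier[OF assms(1,3)]])
    show "hilbert_norm (W k \<tau> *\<^sub>v v) = hilbert_norm v" if "v \<in> carrier_vec d" for v
      by (rule Cons.prems[OF _ that]) (simp add: p)
  qed
  also have "\<dots> \<le> hilbert_norm \<phi>" by (rule Cons.IH[OF Cons.prems]) simp_all
  finally show ?case by (simp add: p)
qed simp

lemma run_realization_ensemble:
  assumes "\<And>k \<tau>. (k, \<tau>) \<in> set l \<Longrightarrow> quantum_channel d (sim k \<tau> \<epsilon>)" "ensemble d r X"
  shows "ensemble d r (run_realization sim \<epsilon> l X)"
  using assms
proof (induction l arbitrary: X)
  case (Cons p l)
  obtain k \<tau> where p: "p = (k, \<tau>)" by (cases p)
  have "ensemble d r (sim k \<tau> \<epsilon> X)"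
    by (rule channel_ensemble[OF Cons.prems(1) Cons.prems(2)]) (simp add: p)
  then have "ensemble d r (run_realization sim \<epsilon> l (sim k \<tau> \<epsilon> X))"
    by (rule Cons.IH[rotated]) (rule Cons.prems(1), simp)
  then show ?case by (simp add: run_realization_def p)
qed (simp add: run_realization_def)

text \<open>The first evolution is replaced while the remaining ones are still exact and absorbed in
  the test vector, at a cost of \<open>\<epsilon>\<close> since the state has trace 1; the remaining
  list then starts from the implemented state.\<close>

lemma run_realization_fidelity:
  assumes W: "\<And>k \<tau>. W k \<tau> \<in> carrier_mat d d"
    and "\<And>k \<tau> v. (k, \<tau>) \<in> set l \<Longrightarrow> v \<in> carrier_vec d \<Longrightarrow> hilbert_norm (W k \<tau> *\<^sub>v v) = hilbert_norm v"
    and "\<And>k \<tau>. (k, \<tau>) \<in> set l \<Longrightarrow> quantum_channel d (sim k \<tau> \<epsilon>)"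
    and "\<And>k \<tau>. (k, \<tau>) \<in> set l \<Longrightarrow> induced_trace_norm d (\<lambda>X. sim k \<tau> \<epsilon> X - conj_channel (W k \<tau>) X) \<le> ennreal \<epsilon>"
    and \<epsilon>: "0 \<le> \<epsilon>" and \<phi>: "\<phi> \<in> carrier_vec d" "hilbert_norm \<phi> \<le> 1" and "ensemble d 1 X"
  shows "fidelity (pull_back W l \<phi>) X - real (length l) * \<epsilon> \<le> fidelity \<phi> (run_realization sim \<epsilon> l X)"
  using assms(2-4,8)
proof (induction l arbitrary: X)
  case (Cons p l)
  obtain k \<tau> where p: "p = (k, \<tau>)" by (cases p)
  have ch: "quantum_channel d (sim k \<tau> \<epsilon>)" by (rule Cons.prems(2)) (simp add: p)
  have b: "pull_back W l \<phi> \<in> carrier_vec d" by (rule pull_back_carrier[OF W \<phi>(1)])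
  have nb: "hilbert_norm (pull_back W l \<phi>) \<le> 1"
    by (rule order_trans[OF pull_back_norm[OF W Cons.prems(1) \<phi>(1)] \<phi>(2)]) simp_all
  have "fidelity (pull_back W (p # l) \<phi>) X = fidelity (pull_back W l \<phi>) (conj_channel (W k \<tau>) X)"
    unfolding p pull_back.simps by (rule fidelity_conj_channel[OF W ensemble_carrier[OF Cons.prems(4)] b, symmetric])
  also have "\<dots> - 1 * \<epsilon> \<le> fidelity (pull_back W l \<phi>) (sim k \<tau> \<epsilon> X)"
    by (rule channel_fidelity_error[OF ch W \<epsilon> Cons.prems(3) b nb Cons.prems(4)]) (simp add: p)
  finally have 1: "fidelity (pull_back W (p # l) \<phi>) X - \<epsilon> \<le> fidelity (pull_back W l \<phi>) (sim k \<tau> \<epsilon> X)" by simp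
  have "fidelity (pull_back W l \<phi>) (sim k \<tau> \<epsilon> X) - real (length l) * \<epsilon> \<le> fidelity \<phi> (run_realization sim \<epsilon> l (sim k \<tau> \<epsilon> X))"
    by (rule Cons.IH[OF Cons.prems(1-3) channel_ensemble[OF ch Cons.prems(4)]]) simp_all
  then show ?case using 1 by (simp add: run_realization_def p algebra_simps)
qed (simp add: run_realization_def)

text \<open>For the overlap \<open>z\<close> the sum
  \<open>(Re z - 1)\<^sup>2 + (Im z)\<^sup>2\<close> is nonnegative, which makes the estimate linear
  in the evolved vector.\<close>

lemma run_realization_fidelity_proj:
  assumes W: "\<And>k \<tau>. W k \<tau> \<in> carrier_mat d d"
    and "\<And>k \<tau> v. (k, \<tau>) \<in> set l \<Longrightarrow> v \<in> carrier_vec d \<Longrightarrow> hilbert_norm (W k \<tau> *\<^sub>v v) = hilbert_norm v"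
    and "\<And>k \<tau>. (k, \<tau>) \<in> set l \<Longrightarrow> quantum_channel d (sim k \<tau> \<epsilon>)"
    and "\<And>k \<tau>. (k, \<tau>) \<in> set l \<Longrightarrow> induced_trace_norm d (\<lambda>X. sim k \<tau> \<epsilon> X - conj_channel (W k \<tau>) X) \<le> ennreal \<epsilon>"
    and \<epsilon>: "0 \<le> \<epsilon>" and \<phi>: "\<phi> \<in> carrier_vec d" "hilbert_norm \<phi> \<le> 1"
    and \<psi>: "\<psi> \<in> carrier_vec d" "hilbert_norm \<psi> = 1"
  shows "2 * inner (embed_vec \<phi>) (embed_vec (push_forward W l \<psi>)) - 1 - real (length l) * \<epsilon>
    \<le> fidelity \<phi> (run_realization sim \<epsilon> l (proj d \<psi>))"
proof -
  define z where "z = \<phi> \<bullet>c push_forward W l \<psi>"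
  have e: "ensemble d 1 (proj d \<psi>)" using ensemble_proj[OF \<psi>(1)] \<psi>(2) by simp
  have "fidelity (pull_back W l \<phi>) (proj d \<psi>) - real (length l) * \<epsilon> \<le> fidelity \<phi> (run_realization sim \<epsilon> l (proj d \<psi>))"
    by (rule run_realization_fidelity[where W = W and sim = sim, OF assms(1-7) e])
  moreover have "fidelity (pull_back W l \<phi>) (proj d \<psi>) = (cmod z)\<^sup>2"
    unfolding fidelity_proj[OF \<psi>(1) pull_back_carrier[OF W \<phi>(1)]] pull_back_cscalar_prod[OF W \<phi>(1) \<psi>(1)] z_def ..
  moreover have "2 * Re z - 1 \<le> (cmod z)\<^sup>2"
  proof -
    have "0 \<le> (Re z - 1)\<^sup>2 + (Im z)\<^sup>2" by simp
    then show ?thesis by (simp add: cmod_power2 power2_diff)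
  qed
  moreover have "Re z = inner (embed_vec \<phi>) (embed_vec (push_forward W l \<psi>))"
    unfolding z_def by (rule inner_embed_vec[OF \<phi>(1) push_forward_carrier[OF W \<psi>(1)], symmetric])
  ultimately show ?thesis by linarith
qed

section \<open>Measurability of the compiled channel\<close>

definition unit_mat :: "nat \<Rightarrow> nat \<Rightarrow> nat \<Rightarrow> complex mat" where
  "unit_mat d i j = mat d d (\<lambda>(a, b). of_bool (a = i \<and> b = j))"

lemma unit_mat_carrier [simp]: "unit_mat d i j \<in> carrier_mat d d"
  by (simp add: unit_mat_def)

lemma conj_channel_index:
  assumes A: "A \<in> carrier_mat d d" and X: "X \<in> carrier_mat d d" and ab: "a < d" "b < d"
  shows "conj_channel A X $$ (a, b) = (\<Sum>j<d. \<Sum>i<d. X $$ (i, j) * (A $$ (a, i) * cnj (A $$ (b, j))))"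
proof -
  have "conj_channel A X $$ (a, b) = (\<Sum>j<d. (A * X) $$ (a, j) * mat_adjoint A $$ (j, b))"
    unfolding conj_channel_def by (rule mult_mat_index[OF mult_carrier_mat[OF A X] mat_adjoint_carrier[OF A] ab])
  also have "\<dots> = (\<Sum>j<d. (\<Sum>i<d. A $$ (a, i) * X $$ (i, j)) * cnj (A $$ (b, j)))"
    using A ab by (intro sum.cong refl) (simp add: mult_mat_index[OF A X ab(1)] del: index_mult_mat)
  also have "\<dots> = (\<Sum>j<d. \<Sum>i<d. X $$ (i, j) * (A $$ (a, i) * cnj (A $$ (b, j))))"
    by (simp add: sum_distrib_right sum_distrib_left mult_ac)
  finally show ?thesis .
qed

lemma conj_channel_unit_mat:
  assumes A: "A \<in> carrier_mat d d" and ab: "a < d" "b < d" and ij: "i < d" "j < d"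
  shows "conj_channel A (unit_mat d i j) $$ (a, b) = A $$ (a, i) * cnj (A $$ (b, j))"
proof -
  have "conj_channel A (unit_mat d i j) $$ (a, b) =
      (\<Sum>j'<d. \<Sum>i'<d. if i' = i then (if j' = j then A $$ (a, i) * cnj (A $$ (b, j)) else 0) else 0)"
    unfolding conj_channel_index[OF A unit_mat_carrier ab]
    by (intro sum.cong refl) (auto simp: unit_mat_def)
  also have "\<dots> = A $$ (a, i) * cnj (A $$ (b, j))" using ij by simp
  finally show ?thesis .
qed

text \<open>Expansion over matrix units. It separates the two ways in which a random duration enters
  an entry: through the argument \<open>X\<close> and through the channel itself.\<close>

lemma channel_index:
  assumes \<Phi>: "quantum_channel d \<Phi>" and X: "X \<in> carrier_mat d d" and ab: "a < d" "b < d"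
  shows "\<Phi> X $$ (a, b) = (\<Sum>j<d. \<Sum>i<d. X $$ (i, j) * \<Phi> (unit_mat d i j) $$ (a, b))"
proof -
  obtain As where As: "set As \<subseteq> carrier_mat d d" "\<And>X. X \<in> carrier_mat d d \<Longrightarrow> \<Phi> X = kraus_map d As X"
    using \<Phi> by (rule quantum_channelE) blast
  have "kraus_map d As X $$ (a, b) = (\<Sum>j<d. \<Sum>i<d. X $$ (i, j) * kraus_map d As (unit_mat d i j) $$ (a, b))"
    using As(1)
  proof (induction As)
    case (Cons A As)
    then have A: "A \<in> carrier_mat d d" and As: "set As \<subseteq> carrier_mat d d" by auto
    have split: "kraus_map d (A # As) Y $$ (a, b) = conj_channel A Y $$ (a, b) + kraus_map d As Y $$ (a, b)"
      if Y: "Y \<in> carrier_mat d d" for Y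
      using kraus_map_carrier[OF As Y] ab by simp
    have "kraus_map d (A # As) X $$ (a, b) =
        (\<Sum>j<d. \<Sum>i<d. X $$ (i, j) * (A $$ (a, i) * cnj (A $$ (b, j)))) +
        (\<Sum>j<d. \<Sum>i<d. X $$ (i, j) * kraus_map d As (unit_mat d i j) $$ (a, b))"
      unfolding split[OF X] conj_channel_index[OF A X ab] Cons.IH[OF As] ..
    also have "\<dots> = (\<Sum>j<d. \<Sum>i<d. X $$ (i, j) * kraus_map d (A # As) (unit_mat d i j) $$ (a, b))"
      unfolding sum.distrib[symmetric]
      by (intro sum.cong refl) (simp only: split[OF unit_mat_carrier] conj_channel_unit_mat[OF A ab] lessThan_iff distrib_left)
    finally show ?case .
  qed (use ab in simp)
  then show ?thesis using As(2) X by simp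
qed

lemma elementary_implementationD:
  assumes "elementary_implementation d Q Hs C \<alpha> \<beta> sim cost" "0 < \<epsilon>" "\<epsilon> < 1" "k \<in> {1..Q}"
  shows "0 \<le> \<tau> \<Longrightarrow> quantum_channel d (sim k \<tau> \<epsilon>)"
    and "0 \<le> \<tau> \<Longrightarrow> induced_trace_norm d (\<lambda>X. sim k \<tau> \<epsilon> X -
      conj_channel (mat_exp d ((- \<i> * complex_of_real \<tau>) \<cdot>\<^sub>m Hs k)) X) \<le> ennreal \<epsilon>"
    and "0 \<le> \<tau> \<Longrightarrow> cost k \<tau> \<epsilon> \<le> (\<alpha> + \<beta> * C * \<tau>) * ln (1 / \<epsilon>)"
    and "X \<in> carrier_mat d d \<Longrightarrow> a < d \<Longrightarrow> b < d \<Longrightarrow>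
      (\<lambda>\<tau>. sim k \<tau> \<epsilon> X $$ (a, b)) \<in> borel_measurable (restrict_space borel {0..})"
  using assms unfolding elementary_implementation_def by blast+

lemma measurable_run_realization_map:
  fixes kfs :: "(nat \<times> ('b \<Rightarrow> real)) list"
  assumes impl: "elementary_implementation d Q Hs C \<alpha> \<beta> sim cost" and \<epsilon>: "0 < \<epsilon>" "\<epsilon> < 1"
    and kfs: "\<And>k f. (k, f) \<in> set kfs \<Longrightarrow> k \<in> {1..Q} \<and> f \<in> borel_measurable N \<and> (\<forall>\<omega>\<in>space N. 0 \<le> f \<omega>)"
    and X: "\<And>\<omega>. \<omega> \<in> space N \<Longrightarrow> X \<omega> \<in> carrier_mat d d"
      "\<And>a b. a < d \<Longrightarrow> b < d \<Longrightarrow> (\<lambda>\<omega>. X \<omega> $$ (a, b)) \<in> borel_measurable N"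
    and ab: "a < d" "b < d"
  shows "(\<lambda>\<omega>. run_realization sim \<epsilon> (map (\<lambda>(k, f). (k, f \<omega>)) kfs) (X \<omega>) $$ (a, b)) \<in> borel_measurable N"
  using kfs X
proof (induction kfs arbitrary: X)
  case Nil
  then show ?case using ab by (simp add: run_realization_def)
next
  case (Cons kf kfs)
  note ch = elementary_implementationD(1)[OF impl \<epsilon>] and meas = elementary_implementationD(4)[OF impl \<epsilon>]
  obtain k f where kf: "kf = (k, f)" by (cases kf)
  have k: "k \<in> {1..Q}" and f: "f \<in> borel_measurable N" "\<And>\<omega>. \<omega> \<in> space N \<Longrightarrow> 0 \<le> f \<omega>"
    using Cons.prems(1)[of k f] kf by auto
  \<comment> \<open>Measurability of \<open>sim\<close> in the duration is given on nonnegative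
    durations, so the target space of \<open>f\<close> is restricted accordingly.\<close>
  have f': "f \<in> measurable N (restrict_space borel {0..})"
    by (rule measurable_restrict_space2) (use f in auto)
  have "(\<lambda>\<omega>. run_realization sim \<epsilon> (map (\<lambda>(k, f). (k, f \<omega>)) kfs) (sim k (f \<omega>) \<epsilon> (X \<omega>)) $$ (a, b)) \<in> borel_measurable N"
  proof (rule Cons.IH)
    show "k \<in> {1..Q} \<and> f \<in> borel_measurable N \<and> (\<forall>\<omega>\<in>space N. 0 \<le> f \<omega>)" if "(k, f) \<in> set kfs" for k f
      by (rule Cons.prems(1)) (simp add: that)
    show "sim k (f \<omega>) \<epsilon> (X \<omega>) \<in> carrier_mat d d" if "\<omega> \<in> space N" for \<omega>
      by (rule channel_carrier[OF ch[OF k f(2)[OF that]] Cons.prems(2)[OF that]])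
    fix p q assume pq: "p < d" "q < d"
    \<comment> \<open>Channel and argument both depend on \<open>\<omega>\<close>; expanded over
      matrix units the entry is a finite sum of products of measurable functions.\<close>
    have "(\<lambda>\<omega>. \<Sum>j<d. \<Sum>i<d. X \<omega> $$ (i, j) * sim k (f \<omega>) \<epsilon> (unit_mat d i j) $$ (p, q)) \<in> borel_measurable N"
    proof (intro borel_measurable_sum borel_measurable_times)
      fix i j assume "j \<in> {..<d}" "i \<in> {..<d}"
      then show "(\<lambda>\<omega>. X \<omega> $$ (i, j)) \<in> borel_measurable N" by (intro Cons.prems(3)) auto
      show "(\<lambda>\<omega>. sim k (f \<omega>) \<epsilon> (unit_mat d i j) $$ (p, q)) \<in> borel_measurable N"
        by (rule measurable_compose[OF f' meas[OF k unit_mat_carrier pq]])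
    qed
    then show "(\<lambda>\<omega>. sim k (f \<omega>) \<epsilon> (X \<omega>) $$ (p, q)) \<in> borel_measurable N"
      by (rule measurable_cong[THEN iffD1, rotated])
        (rule channel_index[OF ch[OF k f(2)] Cons.prems(2) pq, symmetric])
  qed
  then show ?case by (simp add: kf run_realization_def)
qed

lemma (in realization_measure) run_realization_measurable:
  assumes impl: "elementary_implementation d Q Hs C \<alpha> \<beta> sim cost" and \<epsilon>: "0 < \<epsilon>" "\<epsilon> < 1"
    and X: "X \<in> carrier_mat d d" and ab: "a < d" "b < d"
  shows "(\<lambda>l. run_realization sim \<epsilon> l X $$ (a, b)) \<in> borel_measurable M"
proof (rule measurable_by_shape)
  fix ks assume ks: "set ks \<subseteq> {1..Q}"
  have "(\<lambda>l. run_realization sim \<epsilon> (map (\<lambda>(k, f). (k, f l)) (shape_durations ks)) X $$ (a, b))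
      \<in> borel_measurable (restrict_space M (shape ks))"
  proof (rule measurable_run_realization_map[OF impl \<epsilon>])
    fix k f assume "(k, f) \<in> set (shape_durations ks)"
    then obtain m where m: "m < length ks" "k = ks ! m" "f = (\<lambda>l. snd (l ! m))"
      by (rule shape_durations_member)
    have "0 \<le> f l" if "l \<in> space (restrict_space M (shape ks))" for l
    proof -
      have l: "l \<in> space M" "map fst l = ks" using that by (auto simp: space_restrict_space shape_def)
      then have "l ! m \<in> set l" using m(1) by auto
      then show ?thesis using realization_props(3)[OF l(1)] m(3) by fastforce
    qed
    then show "k \<in> {1..Q} \<and> f \<in> borel_measurable (restrict_space M (shape ks)) \<and>
        (\<forall>l\<in>space (restrict_space M (shape ks)). 0 \<le> f l)"
      using ks m duration_measurable[OF m(1)] nth_mem[OF m(1)] by blast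
  qed (use X ab in auto)
  then show "(\<lambda>l. run_realization sim \<epsilon> l X $$ (a, b)) \<in> borel_measurable (restrict_space M (shape ks))"
    by (rule measurable_cong[THEN iffD1, rotated]) (simp add: space_restrict_space shape_durations_eq)
qed

section \<open>The compiler\<close>

lemma run_eq_push_forward:
  assumes "skew_flows Q (\<lambda>k. mat_act d (- \<i> \<cdot>\<^sub>m Hs k)) C (\<lambda>k. hamiltonian_flow d (Hs k))" and v: "v \<in> carrier_vec d"
  shows "skew_flows.run (\<lambda>k. hamiltonian_flow d (Hs k)) l (embed_vec v) =
    embed_vec (push_forward (\<lambda>k \<tau>. mat_exp d ((- \<i> * complex_of_real \<tau>) \<cdot>\<^sub>m Hs k)) l v)"
  using v
proof (induction l arbitrary: v)
  case Nil
  then show ?case by (simp add: skew_flows.run_def[OF assms(1)])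
next
  case (Cons p l)
  obtain k \<tau> where p: "p = (k, \<tau>)" by (cases p)
  have "mat_exp d ((- \<i> * complex_of_real \<tau>) \<cdot>\<^sub>m Hs k) *\<^sub>v v \<in> carrier_vec d"
    by (rule mult_mat_vec_carrier[OF mat_exp_carrier Cons.prems])
  from Cons.IH[OF this] show ?case
    by (simp only: skew_flows.run_def[OF assms(1)] p fold_simps case_prod_conv o_apply push_forward.simps hamiltonian_flow_embed[OF Cons.prems])
qed

lemma total_gate_cost:
  fixes cost :: "nat \<Rightarrow> real \<Rightarrow> real \<Rightarrow> real"
  assumes "\<And>k \<tau>. (k, \<tau>) \<in> set l \<Longrightarrow> cost k \<tau> \<epsilon> \<le> (\<alpha> + \<beta> * C * \<tau>) * L"
  shows "(\<Sum>(k, \<tau>)\<leftarrow>l. cost k \<tau> \<epsilon>) \<le> (\<alpha> * real (length l) + \<beta> * C * sum_list (map snd l)) * L"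
  using assms
proof (induction l)
  case (Cons p l)
  obtain k \<tau> where p: "p = (k, \<tau>)" by (cases p)
  have "cost k \<tau> \<epsilon> \<le> (\<alpha> + \<beta> * C * \<tau>) * L" by (rule Cons.prems) (simp add: p)
  moreover have "(\<Sum>(k, \<tau>)\<leftarrow>l. cost k \<tau> \<epsilon>) \<le> (\<alpha> * real (length l) + \<beta> * C * sum_list (map snd l)) * L"
    by (rule Cons.IH) (rule Cons.prems, simp)
  ultimately show ?case by (simp add: p algebra_simps)
qed simp

text \<open>The durations of every realization sum to \<open>T\<close>, so the cost bound is affine
  in the number of stays and \<open>expected_length\<close> suffices.\<close>

lemma (in compiler_chain) expected_gates_bound:
  assumes cost: "\<And>k \<tau>. k \<in> {1..Q} \<Longrightarrow> 0 \<le> \<tau> \<Longrightarrow> cost k \<tau> \<epsilon> \<le> (\<alpha> + \<beta> * C * \<tau>) * L"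
    and nn: "0 \<le> \<alpha>" "0 \<le> \<beta>" "0 \<le> C" "0 \<le> L"
  shows "expected_gates cost \<epsilon> M \<le> ennreal ((\<alpha> * (1 + lam * T) + \<beta> * C * T) * L)"
proof -
  have "expected_gates cost \<epsilon> M \<le> (\<integral>\<^sup>+l. ennreal (\<alpha> * L) * ennreal (real (length l)) + ennreal (\<beta> * C * T * L) \<partial>M)"
    unfolding expected_gates_def
  proof (rule nn_integral_mono)
    fix l assume l: "l \<in> space M"
    have "(\<Sum>(k, \<tau>)\<leftarrow>l. cost k \<tau> \<epsilon>) \<le> (\<alpha> * real (length l) + \<beta> * C * sum_list (map snd l)) * L"
      by (rule total_gate_cost) (use cost realization_props(3)[OF l] in \<open>force intro: less_imp_le\<close>)
    also have "\<dots> = \<alpha> * L * real (length l) + \<beta> * C * T * L"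
      unfolding realization_props(4)[OF l] by (simp add: algebra_simps)
    finally have "ennreal (\<Sum>(k, \<tau>)\<leftarrow>l. cost k \<tau> \<epsilon>) \<le> ennreal (\<alpha> * L * real (length l) + \<beta> * C * T * L)"
      by (rule ennreal_leI)
    then show "ennreal (\<Sum>(k, \<tau>)\<leftarrow>l. cost k \<tau> \<epsilon>) \<le> ennreal (\<alpha> * L) * ennreal (real (length l)) + ennreal (\<beta> * C * T * L)"
      using nn T_pos by (simp add: ennreal_mult ennreal_plus)
  qed
  also have "\<dots> = ennreal (\<alpha> * L) * (\<integral>\<^sup>+l. ennreal (real (length l)) \<partial>M) + ennreal (\<beta> * C * T * L)"
    by (subst nn_integral_add) (auto simp: nn_integral_cmult emeasure_space_1)
  also have "\<dots> \<le> ennreal (\<alpha> * L) * ennreal (1 + lam * T) + ennreal (\<beta> * C * T * L)"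
    by (intro add_right_mono mult_left_mono expected_length) simp
  also have "\<dots> = ennreal (\<alpha> * L * (1 + lam * T) + \<beta> * C * T * L)"
    using nn T_pos lam_pos by (simp add: ennreal_mult ennreal_plus)
  also have "\<alpha> * L * (1 + lam * T) + \<beta> * C * T * L = (\<alpha> * (1 + lam * T) + \<beta> * C * T) * L"
    by (simp add: algebra_simps)
  finally show ?thesis .
qed

lemma (in compiler_chain) length_integrable:
  "integrable M (\<lambda>l. real (length l))" "integral\<^sup>L M (\<lambda>l. real (length l)) \<le> 1 + lam * T"
proof -
  have [measurable]: "(\<lambda>l. real (length l)) \<in> borel_measurable M" by measurable
  have fin: "(\<integral>\<^sup>+l. ennreal (real (length l)) \<partial>M) < \<infinity>"
    using expected_length by (rule order.strict_trans1) simp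
  show int: "integrable M (\<lambda>l. real (length l))"
    by (rule integrableI_nonneg) (use fin in auto)
  have "ennreal (integral\<^sup>L M (\<lambda>l. real (length l))) \<le> ennreal (1 + lam * T)"
    using expected_length by (subst (asm) nn_integral_eq_integral[OF int]) auto
  then show "integral\<^sup>L M (\<lambda>l. real (length l)) \<le> 1 + lam * T"
    using lam_pos T_pos by (subst (asm) ennreal_le_iff) (auto intro: add_nonneg_nonneg)
qed

text \<open>The loss of \<open>expected_overlap\<close> enters doubled through the linear bound; the
  implementation error \<open>\<epsilon>\<close> is paid once per stay, on average at most
  \<open>1 + lam * T\<close> times.\<close>

lemma (in compiler_chain) compiled_channel_fidelity:
  assumes C: "0 < C" and Hs: "\<And>k. k \<in> {1..Q} \<Longrightarrow> hermitian_op d (Hs k) \<and> operator_norm d (Hs k) \<le> ennreal C"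
    and impl: "elementary_implementation d Q Hs C \<alpha> \<beta> sim cost"
    and \<epsilon>: "0 < \<epsilon>" "\<epsilon> < 1" and \<psi>: "\<psi> \<in> carrier_vec d" "hilbert_norm \<psi> = 1"
  shows "1 - 4 * C\<^sup>2 * T / lam - \<epsilon> * (1 + lam * T) \<le>
    fidelity (time_ordered_exp d (total_hamiltonian d Q Hs w) T *\<^sub>v \<psi>) (compiled_channel d sim \<epsilon> M (proj d \<psi>))"
proof -
  let ?H = "total_hamiltonian d Q Hs w"
  let ?W = "\<lambda>k \<tau>. mat_exp d ((- \<i> * complex_of_real \<tau>) \<cdot>\<^sub>m Hs k)"
  let ?G = "\<lambda>k. mat_act d (- \<i> \<cdot>\<^sub>m Hs k)"
  let ?E = "\<lambda>k. hamiltonian_flow d (Hs k)"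
  note ch = elementary_implementationD(1)[OF impl \<epsilon>]
  have Hc: "Hs k \<in> carrier_mat d d" if "k \<in> {1..Q}" for k using Hs[OF that] by (simp add: hermitian_op_def)
  interpret D: dyson d ?H T
  proof
    show "continuous_on {0..T} (\<lambda>s. ?H s $$ (i, j))" if "i < d" "j < d" for i j
    proof -
      have "continuous_on {0..T} (\<lambda>s. \<Sum>k=1..Q. complex_of_real (w k s) * Hs k $$ (i, j))"
        by (intro continuous_intros w_continuous)
      then show ?thesis using that by (simp add: total_hamiltonian_def)
    qed
  qed (use T_pos in auto)
  define u where "u t = embed_vec (D.U t *\<^sub>v \<psi>)" for t
  have flows: "skew_flow (?G k) C (?E k)" if "k \<in> {1..Q}" for k
    using Hs[OF that] C by (intro skew_flow_hamiltonian) auto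
  interpret F: compiled_flow Q T c w w' lam M ?G C ?E u
  proof (intro compiled_flow.intro compiled_flow_axioms.intro skew_flows.intro compiler_chain_axioms)
    show "(u has_vector_derivative (\<Sum>k=1..Q. w k t *\<^sub>R ?G k (u t))) (at t within {0..T})" if "t \<in> {0..T}" for t
      using D.U_vec_deriv[OF \<psi>(1) that] unfolding u_def by (simp only: mat_act_total_hamiltonian[OF Hc])
    show "norm (u 0) = 1" using \<psi> by (simp add: u_def D.U_0 norm_embed_vec)
  qed (rule flows)
  define \<phi> where "\<phi> = D.U T *\<^sub>v \<psi>"
  have \<phi>: "\<phi> \<in> carrier_vec d" "hilbert_norm \<phi> \<le> 1"
    using mult_mat_vec_carrier[OF D.U_carrier \<psi>(1)] F.norm_u[of T] T_pos by (simp_all add: \<phi>_def u_def norm_embed_vec)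
  have u0: "u 0 = embed_vec \<psi>" using \<psi> by (simp add: u_def D.U_0)
  let ?R = "\<lambda>l. run_realization sim \<epsilon> l (proj d \<psi>)"
  have in_l: "k \<in> {1..Q}" "0 \<le> \<tau>" if "l \<in> space M" "(k, \<tau>) \<in> set l" for l k \<tau>
    using realization_props(3)[OF that] by auto
  have iso: "hilbert_norm (?W k \<tau> *\<^sub>v v) = hilbert_norm v" if k: "k \<in> {1..Q}" "0 \<le> \<tau>" and v: "v \<in> carrier_vec d" for k \<tau> v
    using skew_flow.norm_E[OF flows[OF k(1)] k(2), of "embed_vec v"]
    unfolding hamiltonian_flow_embed[OF v] norm_embed_vec .
  have low: "2 * inner (u T) (F.run l (u 0)) - 1 - real (length l) * \<epsilon> \<le> fidelity \<phi> (?R l)" if l: "l \<in> space M" for l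
    unfolding u0 run_eq_push_forward[OF F.skew_flows_axioms \<psi>(1)]
    unfolding u_def \<phi>_def[symmetric]
  proof (rule run_realization_fidelity_proj[OF mat_exp_carrier _ _ _ less_imp_le[OF \<epsilon>(1)] \<phi> \<psi>])
    show "hilbert_norm (?W k \<tau> *\<^sub>v v) = hilbert_norm v" if "(k, \<tau>) \<in> set l" "v \<in> carrier_vec d" for k \<tau> v
      by (rule iso[OF in_l[OF l that(1)] that(2)])
    show "quantum_channel d (sim k \<tau> \<epsilon>)" if "(k, \<tau>) \<in> set l" for k \<tau> by (rule ch[OF in_l[OF l that]])
    show "induced_trace_norm d (\<lambda>X. sim k \<tau> \<epsilon> X - conj_channel (?W k \<tau>) X) \<le> ennreal \<epsilon>" if "(k, \<tau>) \<in> set l" for k \<tau>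
      by (rule elementary_implementationD(2)[OF impl \<epsilon> in_l[OF l that]])
  qed
  have ens: "ensemble d 1 (?R l)" if l: "l \<in> space M" for l
    by (rule run_realization_ensemble) (use ch in_l[OF l] ensemble_proj[OF \<psi>(1)] \<psi>(2) in auto)
  have int: "integrable M (\<lambda>l. ?R l $$ (a, b))" if ab: "a < d" "b < d" for a b
  proof (rule integrable_const_bound[of _ 1])
    show "AE l in M. norm (?R l $$ (a, b)) \<le> 1"
      by (rule AE_I2) (rule ensemble_entry_bound[OF ens ab])
    show "(\<lambda>l. ?R l $$ (a, b)) \<in> borel_measurable M"
      by (rule run_realization_measurable[OF impl \<epsilon> proj_carrier ab])
  qed
  let ?c = "\<lambda>a b. \<phi> $ b * cnj (\<phi> $ a)"
  have int2: "integrable M (\<lambda>l. \<Sum>a<d. \<Sum>b<d. ?R l $$ (a, b) * ?c a b)"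
    by (intro Bochner_Integration.integrable_sum integrable_mult_left int) auto
  have fid: "fidelity \<phi> (?R l) = Re (\<Sum>a<d. \<Sum>b<d. ?R l $$ (a, b) * ?c a b)" if l: "l \<in> space M" for l
    by (rule fidelity_sum[OF ensemble_carrier[OF ens[OF l]] \<phi>(1)])
  \<comment> \<open>Fidelity is the real part of a finite linear combination of entries, and the
    compiled channel is averaged entrywise, so averaging and fidelity commute.\<close>
  have "fidelity \<phi> (compiled_channel d sim \<epsilon> M (proj d \<psi>)) =
      Re (\<Sum>a<d. \<Sum>b<d. (\<integral>l. ?R l $$ (a, b) \<partial>M) * ?c a b)"
    by (subst fidelity_sum[of _ d]) (auto simp: compiled_channel_def \<phi>(1))
  also have "(\<Sum>a<d. \<Sum>b<d. (\<integral>l. ?R l $$ (a, b) \<partial>M) * ?c a b) = (\<Sum>a<d. \<Sum>b<d. \<integral>l. ?R l $$ (a, b) * ?c a b \<partial>M)"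
    by (intro sum.cong refl integral_mult_left[symmetric] int) auto
  also have "\<dots> = (\<Sum>a<d. \<integral>l. (\<Sum>b<d. ?R l $$ (a, b) * ?c a b) \<partial>M)"
    by (intro sum.cong refl Bochner_Integration.integral_sum[symmetric] integrable_mult_left int) auto
  also have "\<dots> = (\<integral>l. (\<Sum>a<d. \<Sum>b<d. ?R l $$ (a, b) * ?c a b) \<partial>M)"
    by (intro Bochner_Integration.integral_sum[symmetric] Bochner_Integration.integrable_sum integrable_mult_left int) auto
  also have "Re \<dots> = (\<integral>l. Re (\<Sum>a<d. \<Sum>b<d. ?R l $$ (a, b) * ?c a b) \<partial>M)"
    by (rule integral_Re[OF int2, symmetric])
  finally have eq: "fidelity \<phi> (compiled_channel d sim \<epsilon> M (proj d \<psi>)) = (\<integral>l. Re (\<Sum>a<d. \<Sum>b<d. ?R l $$ (a, b) * ?c a b) \<partial>M)" .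
  note int3 = F.overlap_integrable length_integrable(1)
  have "1 - 4 * C\<^sup>2 * T / lam - \<epsilon> * (1 + lam * T) \<le>
      2 * (\<integral>l. inner (u T) (F.run l (u 0)) \<partial>M) - 1 - (\<integral>l. real (length l) \<partial>M) * \<epsilon>"
  proof -
    have "4 * C\<^sup>2 * T / lam = 2 * (2 * C\<^sup>2 * T / lam)" by simp
    then show ?thesis
      using F.expected_overlap mult_right_mono[OF length_integrable(2) less_imp_le[OF \<epsilon>(1)]] by (simp only: mult.commute[of \<epsilon>])
  qed
  also have "\<dots> = (\<integral>l. 2 * inner (u T) (F.run l (u 0)) - 1 - real (length l) * \<epsilon> \<partial>M)"
    using int3 by (simp add: prob_space)
  also have "\<dots> \<le> (\<integral>l. Re (\<Sum>a<d. \<Sum>b<d. ?R l $$ (a, b) * ?c a b) \<partial>M)"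
  proof (rule integral_mono)
    show "integrable M (\<lambda>l. 2 * inner (u T) (F.run l (u 0)) - 1 - real (length l) * \<epsilon>)"
      using int3 by (intro Bochner_Integration.integrable_diff integrable_mult_left integrable_mult_right) auto
    show "integrable M (\<lambda>l. Re (\<Sum>a<d. \<Sum>b<d. ?R l $$ (a, b) * ?c a b))"
      by (rule integrable_Re[OF int2])
    show "2 * inner (u T) (F.run l (u 0)) - 1 - real (length l) * \<epsilon> \<le> Re (\<Sum>a<d. \<Sum>b<d. ?R l $$ (a, b) * ?c a b)"
      if "l \<in> space M" for l using low[OF that] fid[OF that] by simp
  qed
  finally show ?thesis unfolding \<phi>_def[symmetric] eq .
qed

text \<open>The bound is read as an asymptotic one for large
  \<open>C * T / \<epsilon>\<^sub>0\<close>: \<open>K\<close> is absolute, and the threshold depends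
  only on \<open>\<kappa>\<close>, which measures the speed of the weights in units of
  \<open>C\<close>. The condition \<open>1 <= C * T * (C * T / \<epsilon>\<^sub>0)\<close> lets the
  initial stay, present even without jumps, be absorbed into the term for the jumps.\<close>

theorem theorem2:
  shows "\<exists>K>0. \<forall>\<kappa>\<ge>0. \<exists>x\<^sub>0>0.
    \<forall>(d :: nat) (Q :: nat) (Hs :: nat \<Rightarrow> complex mat) (w :: nat \<Rightarrow> real \<Rightarrow> real) w'
      (C :: real) (T :: real) (\<alpha> :: real) (\<beta> :: real) (\<epsilon>\<^sub>0 :: real) sim cost.
      0 < d \<and> 0 < C \<and> 0 < T \<and> 0 < \<epsilon>\<^sub>0 \<and> 0 \<le> \<alpha> \<and> 0 \<le> \<beta> \<and>
      (\<forall>k\<in>{1..Q}. hermitian_op d (Hs k) \<and> operator_norm d (Hs k) \<le> ennreal C) \<and>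
      slowly_varying_weights Q T (\<kappa> * C) w w' \<and>
      elementary_implementation d Q Hs C \<alpha> \<beta> sim cost \<and>
      x\<^sub>0 \<le> C * T / \<epsilon>\<^sub>0 \<and> 1 \<le> C * T * (C * T / \<epsilon>\<^sub>0) \<longrightarrow>
      (\<exists>lam>0. \<exists>\<epsilon>\<^sub>1. 0 < \<epsilon>\<^sub>1 \<and> \<epsilon>\<^sub>1 < 1 \<and>
        (\<forall>t\<in>{0..T}. \<forall>i\<in>{1..Q}. \<forall>j\<in>{1..Q} - {i}. 0 \<le> compiler_rate lam w w' t i j) \<and>
        (\<forall>M. markov_chain_law Q T (\<lambda>i. w i 0) (compiler_rate lam w w') M \<longrightarrow>
          1 - \<epsilon>\<^sub>0 \<le> channel_fidelity d (time_ordered_exp d (total_hamiltonian d Q Hs w) T)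
                        (compiled_channel d sim \<epsilon>\<^sub>1 M) \<and>
          expected_gates cost \<epsilon>\<^sub>1 M
            \<le> ennreal (K * (C * T * (\<alpha> * C * T / \<epsilon>\<^sub>0 + \<beta>) * ln (C * T / \<epsilon>\<^sub>0)))))"
proof (rule exI[of _ "27 :: real"], intro conjI allI impI, goal_cases)
  \<comment> \<open>The constant is \<open>27 = 9 * 3\<close>: the expected length is at most
    \<open>9 * (C * T * x)\<close> and the logarithm at most \<open>3 * ln x\<close>.\<close>
  case (2 \<kappa>)
  show ?case
  \<comment> \<open>From \<open>18 <= x\<close> follows \<open>ln 18 <= ln x\<close>, and from
    \<open>\<kappa> / 8 <= x\<close> follows \<open>\<kappa> * C <= lam\<close>, hence nonnegative
    rates.\<close>
  proof (rule exI[of _ "max 18 (\<kappa> / 8)"], intro conjI allI impI, goal_cases)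
    case (2 d Q Hs w w' C T \<alpha> \<beta> \<epsilon>\<^sub>0 sim cost)
    define x where "x = C * T / \<epsilon>\<^sub>0"
    \<comment> \<open>Turns \<open>4 * C\<^sup>2 * T / lam\<close> into
      \<open>C * T / (2 * x)\<close>, which is \<open>\<epsilon>\<^sub>0 / 2\<close>.\<close>
    define lam where "lam = 8 * C * x"
    \<comment> \<open>Multiplied by the bound \<open>9 * (C * T * x)\<close> on the expected length
      this is again \<open>C * T / (2 * x)\<close>.\<close>
    define \<epsilon>\<^sub>1 where "\<epsilon>\<^sub>1 = 1 / (18 * x\<^sup>2)"
    have d: "0 < d" and C: "0 < C" and T: "0 < T" and \<epsilon>\<^sub>0: "0 < \<epsilon>\<^sub>0" and \<alpha>: "0 \<le> \<alpha>" and \<beta>: "0 \<le> \<beta>"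
      and Hs: "\<And>k. k \<in> {1..Q} \<Longrightarrow> hermitian_op d (Hs k) \<and> operator_norm d (Hs k) \<le> ennreal C"
      and sv: "slowly_varying_weights Q T (\<kappa> * C) w w'"
      and impl: "elementary_implementation d Q Hs C \<alpha> \<beta> sim cost"
      and x: "18 \<le> x" "\<kappa> / 8 \<le> x" and CTx: "1 \<le> C * T * x"
      using 2 unfolding x_def by auto
    have lam: "0 < lam" using C x by (simp add: lam_def)
    have \<epsilon>\<^sub>1: "0 < \<epsilon>\<^sub>1" "\<epsilon>\<^sub>1 < 1"
    proof -
      have "1 < x\<^sup>2" using x(1) by (intro one_less_power) auto
      then have "1 < 18 * x\<^sup>2" by simp
      then show "0 < \<epsilon>\<^sub>1" "\<epsilon>\<^sub>1 < 1" unfolding \<epsilon>\<^sub>1_def by (subst zero_less_divide_iff divide_less_eq_1_pos; linarith)+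
    qed
    interpret chain_weights Q T "\<kappa> * C" w w' lam
    proof
      have "\<kappa> * C \<le> 8 * x * C" using x(2) C by (intro mult_right_mono) auto
      then show "\<kappa> * C \<le> lam" by (simp add: lam_def mult_ac)
    qed (use sv T lam in auto)
    have CT: "C * T = x * \<epsilon>\<^sub>0" using \<epsilon>\<^sub>0 by (simp add: x_def)
    have lamT: "1 + lam * T \<le> 9 * (C * T * x)" using CTx by (simp add: lam_def algebra_simps)
    have L: "0 \<le> ln (1 / \<epsilon>\<^sub>1)" "ln (1 / \<epsilon>\<^sub>1) \<le> 3 * ln x"
    proof -
      have "ln (1 / \<epsilon>\<^sub>1) = ln 18 + 2 * ln x" using x(1) by (simp add: \<epsilon>\<^sub>1_def ln_mult ln_realpow)
      moreover have "0 \<le> ln (18::real)" "ln 18 \<le> ln x" using x(1) by auto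
      ultimately show "0 \<le> ln (1 / \<epsilon>\<^sub>1)" "ln (1 / \<epsilon>\<^sub>1) \<le> 3 * ln x" by linarith+
    qed
    show ?case
    proof (rule exI[of _ lam], intro conjI, rule lam, rule exI[of _ \<epsilon>\<^sub>1], intro conjI ballI allI impI)
      show "0 < \<epsilon>\<^sub>1" "\<epsilon>\<^sub>1 < 1" by (fact \<epsilon>\<^sub>1)+
      show "0 \<le> compiler_rate lam w w' t i j" if "t \<in> {0..T}" "j \<in> {1..Q} - {i}" for t i j
        using that by (intro compiler_rate_nonneg) auto
      fix M assume "markov_chain_law Q T (\<lambda>i. w i 0) (compiler_rate lam w w') M"
      then interpret compiler_chain Q T "\<kappa> * C" w w' lam M by unfold_locales
      show "1 - \<epsilon>\<^sub>0 \<le> channel_fidelity d (time_ordered_exp d (total_hamiltonian d Q Hs w) T) (compiled_channel d sim \<epsilon>\<^sub>1 M)"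
        unfolding channel_fidelity_def
      proof (rule cINF_greatest)
        \<comment> \<open>The rule \<open>cINF_greatest\<close> asks for a nonempty set; a positive
          dimension provides a unit vector.\<close>
        have "unit_vec d 0 \<in> pure_states d"
          using d by (simp add: pure_states_def hilbert_norm_def)
        then show "pure_states d \<noteq> {}" by blast
        fix \<psi> assume "\<psi> \<in> pure_states d"
        then have \<psi>: "\<psi> \<in> carrier_vec d" "hilbert_norm \<psi> = 1" by (auto simp: pure_states_def)
        have a: "4 * C\<^sup>2 * T / lam = \<epsilon>\<^sub>0 / 2"
        proof -
          have "4 * C\<^sup>2 * T = 4 * C * (C * T)" by (simp add: power2_eq_square)
          then show ?thesis unfolding CT lam_def using C x(1) by (simp add: field_simps)
        qed
        have "\<epsilon>\<^sub>1 * (1 + lam * T) \<le> \<epsilon>\<^sub>1 * (9 * (C * T * x))" using lamT \<epsilon>\<^sub>1 by (intro mult_left_mono) auto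
        also have "\<dots> = \<epsilon>\<^sub>0 / 2" unfolding CT \<epsilon>\<^sub>1_def using x(1) by (simp add: field_simps power2_eq_square)
        finally have "1 - \<epsilon>\<^sub>0 \<le> 1 - 4 * C\<^sup>2 * T / lam - \<epsilon>\<^sub>1 * (1 + lam * T)" unfolding a by simp
        also have "\<dots> \<le> fidelity (time_ordered_exp d (total_hamiltonian d Q Hs w) T *\<^sub>v \<psi>) (compiled_channel d sim \<epsilon>\<^sub>1 M (proj d \<psi>))"
          by (rule compiled_channel_fidelity[OF C Hs impl \<epsilon>\<^sub>1 \<psi>])
        finally show "1 - \<epsilon>\<^sub>0 \<le> fidelity (time_ordered_exp d (total_hamiltonian d Q Hs w) T *\<^sub>v \<psi>) (compiled_channel d sim \<epsilon>\<^sub>1 M (proj d \<psi>))" .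
      qed
      have "expected_gates cost \<epsilon>\<^sub>1 M \<le> ennreal ((\<alpha> * (1 + lam * T) + \<beta> * C * T) * ln (1 / \<epsilon>\<^sub>1))"
        by (rule expected_gates_bound[where cost = cost, OF elementary_implementationD(3)[OF impl \<epsilon>\<^sub>1]]) (use \<alpha> \<beta> C L in auto)
      also have "\<dots> \<le> ennreal (27 * (C * T * (\<alpha> * C * T / \<epsilon>\<^sub>0 + \<beta>) * ln (C * T / \<epsilon>\<^sub>0)))"
      proof (rule ennreal_leI)
        have nn: "0 \<le> ln x" using x(1) by simp
        have CTp: "0 \<le> C * T" using C T by simp
        have "(\<alpha> * (1 + lam * T) + \<beta> * C * T) * ln (1 / \<epsilon>\<^sub>1) \<le> (\<alpha> * (9 * (C * T * x)) + 9 * (\<beta> * C * T)) * (3 * ln x)"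
        proof (rule mult_mono)
          have "\<alpha> * (1 + lam * T) \<le> \<alpha> * (9 * (C * T * x))" by (rule mult_left_mono[OF lamT \<alpha>])
          moreover have "0 \<le> \<beta> * C * T" using \<beta> C T by simp
          ultimately show "\<alpha> * (1 + lam * T) + \<beta> * C * T \<le> \<alpha> * (9 * (C * T * x)) + 9 * (\<beta> * C * T)" by linarith
          show "0 \<le> \<alpha> * (9 * (C * T * x)) + 9 * (\<beta> * C * T)" using \<alpha> \<beta> C T x(1) by simp
        qed (use L in auto)
        also have "\<dots> = 27 * (C * T * (\<alpha> * x + \<beta>) * ln x)" by (simp add: algebra_simps)
        finally show "(\<alpha> * (1 + lam * T) + \<beta> * C * T) * ln (1 / \<epsilon>\<^sub>1) \<le>
            27 * (C * T * (\<alpha> * C * T / \<epsilon>\<^sub>0 + \<beta>) * ln (C * T / \<epsilon>\<^sub>0))"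
          by (simp add: x_def mult.assoc)
      qed
      finally show "expected_gates cost \<epsilon>\<^sub>1 M \<le> ennreal (27 * (C * T * (\<alpha> * C * T / \<epsilon>\<^sub>0 + \<beta>) * ln (C * T / \<epsilon>\<^sub>0)))" .
    qed
  qed simp
qed simp

end
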